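(* Let $k\ge 3$ be a fixed integer, and consider the $(1:b)$ $k$-star Avoider-Enforcer game played on the edge set of $K_n$ (Avoider loses if and only if his graph at the end of the game contains a copy of $K_{1,k}$, i.e. a vertex of degree at least $k$). Let $f^{mon}=f^{mon}(n)$, $f^-=f^-(n)$, $f^+=f^+(n)$ denote the monotone, lower and upper threshold biases of this game, and let $e^+_{n,k}, e^-_{n,k}$ be as defined in the context. Then, with asymptotic notation referring to $n\to\infty$ (with $k$ fixed): (i) $f^{mon}=\Theta(n^{\frac{k}{k-1}})$; (ii) $e^+_{n,k}\le f^+ = O(n^{\frac{k}{k-1}})$ holds for all values of $n$, and $f^+=\Theta(n^{\frac{k}{k-1}})$ holds for infinitely many values of $n$; (iii) $\Omega(n^{\frac{k+1}{k}}) = e^-_{n,k}\le f^- = O(n^{\frac{k+1}{k}}\log n)$ holds for all values of $n$, and $f^-=\Theta(n^{\frac{k+1}{k}})$ holds for infinitely many values of $n$.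
   Context: Avoider-Enforcer games on $K_n$: the board is $X=E(K_n)$, the target family $\mathcal{F}$ consists of the edge sets of all copies of the star $K_{1,k}$ in $K_n$. Avoider and Enforcer alternately claim previously unclaimed edges, Avoider moving first. In the strict $(1:b)$ game, Avoider claims exactly $1$ and Enforcer exactly $b$ unclaimed edges per move (if fewer unclaimed edges remain than the required number, the player claims all of them). In the monotone $(1:b)$ game, Avoider claims at least $1$ and Enforcer at least $b$ unclaimed edges per move (with the same rule when too few remain). The game ends when all edges are claimed; Avoider loses iff he has claimed all elements of some target set, otherwise he wins. The monotone threshold bias $f^{mon}$ is the largest non-negative integer such that Enforcer wins the monotone $(1:b)$ game if and only if $b\le f^{mon}$. The lower threshold bias $f^-$ is the largest integer such that Enforcer wins the strict $(1:b)$ game for every $b\le f^-$; the upper threshold bias $f^+$ is the smallest integer such that Avoider wins the strict $(1:b)$ game for every $b>f^+$. For positive integers $n,b$, let $r=r(n,b)$ be the integer with $1\le r\le b+1$ and $\binom{n}{2}\equiv r \pmod{b+1}$. Define $e^+_{n,k}=\max\{b\le 0.4n^{\frac{k}{k-1}} : r(n,b)<\frac{n^{k+1}}{(2b)^{k-1}}\}$ and $e^-_{n,k}=\max\{b\le 0.4n^{\frac{k}{k-1}} : r(n,b')<\frac{n^{k+1}}{(2b')^{k-1}} \text{ for every } 1\le b'\le b\}$, where $b,b'$ range over positive integers.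
   Formalization: The inequalities e^+ ≤ f^+ and e^- ≤ f^- are stated for all sufficiently large n (k fixed) rather than for all n, since they fail for small n: for k = n = 3 no K_{1,3} exists, so f^+ = f^- = 0, while e^+, e^- ≥ 1. *)

theory Defs
  imports Complex_Main "HOL-Library.Landau_Symbols" "HOL-Number_Theory.Cong"
begin

datatype player = Avoider | Enforcer

text \<open>A move rule maps a bias and the set of unclaimed elements to the set of legal moves.\<close>

type_synonym 'a move_rule = "nat \<Rightarrow> 'a set \<Rightarrow> 'a set set"

definition strict_moves :: "'a move_rule" where
  "strict_moves q U = {S. S \<subseteq> U \<and> card S = min q (card U)}"

definition monotone_moves :: "'a move_rule" where
  "monotone_moves q U = {S. S \<subseteq> U \<and> card S \<ge> min q (card U)}"

text \<open>A history is the list of all moves made so far, in chronological order. Avoider moves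
  first, so his moves are those at even positions.\<close>

definition turn :: "'a set list \<Rightarrow> player" where
  "turn h = (if even (length h) then Avoider else Enforcer)"

definition avoider_claimed :: "'a set list \<Rightarrow> 'a set" where
  "avoider_claimed h = \<Union> {h ! i | i. i < length h \<and> even i}"

definition unclaimed :: "'a set \<Rightarrow> 'a set list \<Rightarrow> 'a set" where
  "unclaimed X h = X - \<Union> (set h)"

fun bias :: "nat \<Rightarrow> player \<Rightarrow> nat" where
  "bias b Avoider = 1"
| "bias b Enforcer = b"

definition legal_moves :: "'a move_rule \<Rightarrow> nat \<Rightarrow> 'a set \<Rightarrow> 'a set list \<Rightarrow> 'a set set" where
  "legal_moves R b X h = R (bias b (turn h)) (unclaimed X h)"

text \<open>The histories that can arise when player \<open>P\<close> follows the strategy \<open>\<sigma>\<close> and the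
  opponent makes arbitrary legal moves.\<close>

inductive consistent_history ::
    "'a move_rule \<Rightarrow> nat \<Rightarrow> 'a set \<Rightarrow> player \<Rightarrow> ('a set list \<Rightarrow> 'a set) \<Rightarrow> 'a set list \<Rightarrow> bool"
  for R b X P \<sigma> where
  start: "consistent_history R b X P \<sigma> []"
| own_move: "consistent_history R b X P \<sigma> h \<Longrightarrow> unclaimed X h \<noteq> {} \<Longrightarrow> turn h = P \<Longrightarrow>
    consistent_history R b X P \<sigma> (h @ [\<sigma> h])"
| opponent_move: "consistent_history R b X P \<sigma> h \<Longrightarrow> unclaimed X h \<noteq> {} \<Longrightarrow> turn h \<noteq> P \<Longrightarrow>
    S \<in> legal_moves R b X h \<Longrightarrow> consistent_history R b X P \<sigma> (h @ [S])"

definition avoider_loses :: "'a set set \<Rightarrow> 'a set list \<Rightarrow> bool" where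
  "avoider_loses F h \<longleftrightarrow> (\<exists>T\<in>F. T \<subseteq> avoider_claimed h)"

fun won_by :: "player \<Rightarrow> 'a set set \<Rightarrow> 'a set list \<Rightarrow> bool" where
  "won_by Avoider F h \<longleftrightarrow> \<not> avoider_loses F h"
| "won_by Enforcer F h \<longleftrightarrow> avoider_loses F h"

definition winning_strategy ::
    "'a move_rule \<Rightarrow> nat \<Rightarrow> 'a set \<Rightarrow> 'a set set \<Rightarrow> player \<Rightarrow> ('a set list \<Rightarrow> 'a set) \<Rightarrow> bool" where
  "winning_strategy R b X F P \<sigma> \<longleftrightarrow> (\<forall>h. consistent_history R b X P \<sigma> h \<longrightarrow>
     (unclaimed X h \<noteq> {} \<and> turn h = P \<longrightarrow> \<sigma> h \<in> legal_moves R b X h) \<and>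
     (unclaimed X h = {} \<longrightarrow> won_by P F h))"

definition wins_game :: "player \<Rightarrow> 'a move_rule \<Rightarrow> nat \<Rightarrow> 'a set \<Rightarrow> 'a set set \<Rightarrow> bool" where
  "wins_game P R b X F \<longleftrightarrow> (\<exists>\<sigma>. winning_strategy R b X F P \<sigma>)"

definition complete_edges :: "nat \<Rightarrow> nat set set" where
  "complete_edges n = {e. e \<subseteq> {..<n} \<and> card e = 2}"

definition star_copies :: "nat \<Rightarrow> nat \<Rightarrow> nat set set set" where
  "star_copies k n = {(\<lambda>v. {c, v}) ` L | c L. c < n \<and> L \<subseteq> {..<n} - {c} \<and> card L = k}"

definition wins_star_game :: "player \<Rightarrow> nat set move_rule \<Rightarrow> nat \<Rightarrow> nat \<Rightarrow> nat \<Rightarrow> bool" where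
  "wins_star_game P R k n b \<longleftrightarrow> wins_game P R b (complete_edges n) (star_copies k n)"

text \<open>Biases are positive integers; a threshold bias may be 0.\<close>

definition f_mon :: "nat \<Rightarrow> nat \<Rightarrow> nat" where
  "f_mon k n = (GREATEST f. \<forall>b\<ge>1. wins_star_game Enforcer monotone_moves k n b \<longleftrightarrow> b \<le> f)"

definition f_minus :: "nat \<Rightarrow> nat \<Rightarrow> nat" where
  "f_minus k n = (GREATEST f. \<forall>b\<ge>1. b \<le> f \<longrightarrow> wins_star_game Enforcer strict_moves k n b)"

definition f_plus :: "nat \<Rightarrow> nat \<Rightarrow> nat" where
  "f_plus k n = (LEAST f. \<forall>b>f. wins_star_game Avoider strict_moves k n b)"

definition star_rem :: "nat \<Rightarrow> nat \<Rightarrow> nat" where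
  "star_rem n b = (THE r. 1 \<le> r \<and> r \<le> b + 1 \<and> [n choose 2 = r] (mod (b + 1)))"

definition small_remainder :: "nat \<Rightarrow> nat \<Rightarrow> nat \<Rightarrow> bool" where
  "small_remainder k n b \<longleftrightarrow> real (star_rem n b) < real n ^ (k + 1) / (2 * real b) ^ (k - 1)"

text \<open>The sets below can be empty for finitely many small \<open>n\<close>; the value of \<open>Max\<close> is then
  irrelevant.\<close>

definition e_plus :: "nat \<Rightarrow> nat \<Rightarrow> nat" where
  "e_plus k n = Max {b. 1 \<le> b \<and> real b \<le> 0.4 * real n powr (real k / (real k - 1)) \<and>
     small_remainder k n b}"

definition e_minus :: "nat \<Rightarrow> nat \<Rightarrow> nat" where
  "e_minus k n = Max {b. 1 \<le> b \<and> real b \<le> 0.4 * real n powr (real k / (real k - 1)) \<and>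
     (\<forall>b'. 1 \<le> b' \<and> b' \<le> b \<longrightarrow> small_remainder k n b')}"

text \<open>\<open>f = \<Theta>(g)\<close> for infinitely many values of the argument: there is one infinite set of
  arguments, enumerated by \<open>s\<close>, along which the bounds hold with fixed constants.\<close>

definition theta_infinitely_often :: "(nat \<Rightarrow> real) \<Rightarrow> (nat \<Rightarrow> real) \<Rightarrow> bool" where
  "theta_infinitely_often f g \<longleftrightarrow>
     (\<exists>s :: nat \<Rightarrow> nat. strict_mono s \<and> (\<lambda>i. f (s i)) \<in> \<Theta>(\<lambda>i. g (s i)))"

end

theory Submission
  imports Defs "HOL-Real_Asymp.Real_Asymp"
begin

text \<open>
  Write \<open>N = n choose 2\<close>, and call the degree of a vertex in Avoider's graph its level.

  Avoider always claims an edge whose larger endpoint level is as small as possible. When this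
  minimum is \<open>j\<close>, all unclaimed edges meet the vertices of level at least \<open>j\<close>; if there are \<open>a j\<close>
  of them, at most \<open>a j * n / (b + 1)\<close> rounds are left, and each creates at most two vertices of
  level \<open>j + 1\<close>. So \<open>a j \<le> n * (2 * n / (b + 1)) ^ j\<close>, and level \<open>k\<close> is never reached if
  \<open>b + 1 \<ge> 2 * n powr (k / (k - 1))\<close>, or, in the strict game, if the remainder \<open>r\<close>, which is the
  number of edges from which Avoider chooses last, exceeds \<open>n * a (k - 1)\<close>.

  Enforcer reverses this. He declares vertices of the lowest level dead one after another by
  claiming their edges to the vertices already dead, so that every edge Avoider claims raises a
  vertex that is still alive. The potential that weighs an unclaimed edge between a dead vertex
  and a living one of level \<open>d\<close> by \<open>\<rho> ^ d\<close>, where \<open>\<rho>\<close> is about \<open>b / n\<close>, does not drop as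
  long as the lowest level stays the same, and drops by at most \<open>b * \<rho> ^ j\<close> when it rises to \<open>j\<close>.
  Hence about \<open>n ^ (k + 1) / (2 * b ^ (k - 1))\<close> unclaimed edges are left when all living vertices
  have level \<open>k - 1\<close>, and Enforcer wins if the last edge that Avoider must claim is among them.

  It remains to choose \<open>b\<close>: rounding a quotient of \<open>N\<close> up or down makes the remainder of \<open>N\<close>
  modulo \<open>b + 1\<close> almost maximal or very small, with \<open>b\<close> determined up to a constant factor.
\<close>

section \<open>Positional games\<close>

definition admissible_rule :: "'a move_rule \<Rightarrow> bool" where
  "admissible_rule R \<longleftrightarrow> (\<forall>q U. strict_moves q U \<subseteq> R q U \<and> R q U \<subseteq> monotone_moves q U)"

lemma admissible_rule_strict: "admissible_rule strict_moves"
  by (auto simp: admissible_rule_def strict_moves_def monotone_moves_def)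

lemma admissible_rule_monotone: "admissible_rule monotone_moves"
  by (auto simp: admissible_rule_def strict_moves_def monotone_moves_def)

lemma admissible_ruleI:
  "admissible_rule R \<Longrightarrow> S \<subseteq> U \<Longrightarrow> card S = min q (card U) \<Longrightarrow> S \<in> R q U"
  unfolding admissible_rule_def strict_moves_def by blast

lemma admissible_ruleD:
  assumes "admissible_rule R" "S \<in> R q U"
  shows "S \<subseteq> U" "min q (card U) \<le> card S"
proof -
  have "S \<in> monotone_moves q U" using assms unfolding admissible_rule_def by blast
  then show "S \<subseteq> U" "min q (card U) \<le> card S" by (auto simp: monotone_moves_def)
qed

lemma admissible_rule_move_nonempty:
  assumes "admissible_rule R" "S \<in> R q U" "finite U" "U \<noteq> {}" "q \<ge> 1"
  shows "S \<noteq> {}"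
proof -
  have "card U > 0" using assms by (simp add: card_gt_0_iff)
  then show ?thesis using admissible_ruleD(2)[OF assms(1,2)] \<open>q \<ge> 1\<close> by auto
qed

fun opponent :: "player \<Rightarrow> player" where
  "opponent Avoider = Enforcer"
| "opponent Enforcer = Avoider"

fun claim :: "player \<Rightarrow> 'a set \<Rightarrow> 'a set \<Rightarrow> 'a set" where
  "claim Avoider S G = G \<union> S"
| "claim Enforcer S G = G"

lemma turn_Nil [simp]: "turn [] = Avoider"
  by (simp add: turn_def)

lemma turn_snoc [simp]: "turn (h @ [S]) = opponent (turn h)"
  by (simp add: turn_def)

lemma neq_player_iff: "Q \<noteq> P \<longleftrightarrow> Q = opponent P"
  by (cases Q; cases P) auto

lemma unclaimed_Nil [simp]: "unclaimed X [] = X"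
  by (simp add: unclaimed_def)

lemma unclaimed_snoc [simp]: "unclaimed X (h @ [S]) = unclaimed X h - S"
  by (auto simp: unclaimed_def)

lemma avoider_claimed_Nil [simp]: "avoider_claimed [] = {}"
  by (simp add: avoider_claimed_def)

lemma avoider_claimed_snoc [simp]:
  "avoider_claimed (h @ [S]) = claim (turn h) S (avoider_claimed h)"
proof -
  have claimed_eq: "avoider_claimed g = (\<Union>i\<in>{i. i < length g \<and> even i}. g ! i)"
    for g :: "'a set list"
    by (auto simp: avoider_claimed_def)
  have "{i. i < length (h @ [S]) \<and> even i}
      = {i. i < length h \<and> even i} \<union> (if even (length h) then {length h} else {})"
    by (auto simp: less_Suc_eq)
  moreover have "(\<Union>i\<in>{i. i < length h \<and> even i}. (h @ [S]) ! i)
      = (\<Union>i\<in>{i. i < length h \<and> even i}. h ! i)"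
    by (intro SUP_cong) (auto simp: nth_append)
  ultimately show ?thesis by (simp add: claimed_eq turn_def Un_commute)
qed

lemma wins_game_by_invariant:
  assumes init: "I Avoider {} X"
    and own: "\<And>G U. I P G U \<Longrightarrow> U \<noteq> {} \<Longrightarrow>
      \<exists>S\<in>R (bias b P) U. I (opponent P) (claim P S G) (U - S)"
    and opp: "\<And>G U S. I (opponent P) G U \<Longrightarrow> U \<noteq> {} \<Longrightarrow> S \<in> R (bias b (opponent P)) U \<Longrightarrow>
      I P (claim (opponent P) S G) (U - S)"
    and final: "\<And>h. I (turn h) (avoider_claimed h) {} \<Longrightarrow> won_by P F h"
  shows "wins_game P R b X F"
proof -
  define good where "good h S \<longleftrightarrow> S \<in> legal_moves R b X h
    \<and> I (opponent P) (claim P S (avoider_claimed h)) (unclaimed X h - S)" for h S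
  define \<sigma> where "\<sigma> h = (SOME S. good h S)" for h
  have \<sigma>: "good h (\<sigma> h)"
    if "I P (avoider_claimed h) (unclaimed X h)" "unclaimed X h \<noteq> {}" "turn h = P" for h
  proof -
    have "\<exists>S. good h S" using own[OF that(1,2)] that(3) by (auto simp: good_def legal_moves_def)
    then show ?thesis unfolding \<sigma>_def by (rule someI_ex)
  qed
  have invariant: "I (turn h) (avoider_claimed h) (unclaimed X h)"
    if "consistent_history R b X P \<sigma> h" for h
    using that
  proof induction
    case start
    then show ?case using init by simp
  next
    case (own_move h)
    then show ?case using \<sigma>[of h] by (simp add: good_def)
  next
    case (opponent_move h S)
    have "turn h = opponent P" using opponent_move.hyps(3) by (simp only: neq_player_iff)
    moreover have "opponent (opponent P) = P" by (cases P) auto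
    ultimately show ?case using opponent_move opp by (simp add: legal_moves_def)
  qed
  have "winning_strategy R b X F P \<sigma>"
    unfolding winning_strategy_def using invariant \<sigma> final by (metis good_def)
  then show ?thesis by (auto simp: wins_game_def)
qed

definition position :: "'a set \<Rightarrow> 'a set \<Rightarrow> 'a set \<Rightarrow> bool" where
  "position X G U \<longleftrightarrow> G \<subseteq> X \<and> U \<subseteq> X \<and> G \<inter> U = {}"

lemma position_move: "position X G U \<Longrightarrow> S \<subseteq> U \<Longrightarrow> position X (G \<union> S) (U - S)"
  by (auto simp: position_def)

lemma position_Diff: "position X G U \<Longrightarrow> position X G (U - T)"
  by (auto simp: position_def)

lemma avoider_wins_by_invariant:
  assumes R: "admissible_rule R"
    and init: "I {} X"
    and final: "\<And>G. I G {} \<Longrightarrow> position X G {} \<Longrightarrow> \<not> (\<exists>T\<in>F. T \<subseteq> G)"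
    and step: "\<And>G U. I G U \<Longrightarrow> position X G U \<Longrightarrow> U \<noteq> {} \<Longrightarrow>
      \<exists>S\<in>R 1 U. \<forall>T\<in>R b (U - S). I (G \<union> S) (U - S - T)"
  shows "wins_game Avoider R b X F"
proof -
  define J where "J P G U \<longleftrightarrow> position X G U \<and>
    (case P of Avoider \<Rightarrow> I G U | Enforcer \<Rightarrow> \<forall>T\<in>R b U. I G (U - T))" for P G U
  show ?thesis
  proof (rule wins_game_by_invariant[where I = J])
    show "J Avoider {} X" using init by (simp add: J_def position_def)
  next
    fix G U assume "J Avoider G U" "U \<noteq> {}"
    then show "\<exists>S\<in>R (bias b Avoider) U. J (opponent Avoider) (claim Avoider S G) (U - S)"
      using step[of G U] admissible_ruleD(1)[OF R] by (fastforce simp: J_def intro: position_move)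
  next
    fix G U S assume "J (opponent Avoider) G U" "S \<in> R (bias b (opponent Avoider)) U"
    then show "J Avoider (claim (opponent Avoider) S G) (U - S)"
      by (simp add: J_def position_Diff)
  next
    fix h assume J: "J (turn h) (avoider_claimed h) {}"
    have "{} \<in> R b {}" by (rule admissible_ruleI[OF R]) auto
    then have "I (avoider_claimed h) {}" using J by (cases "turn h") (auto simp: J_def)
    then show "won_by Avoider F h" using J final by (auto simp: J_def avoider_loses_def)
  qed
qed

lemma enforcer_wins_by_invariant:
  assumes R: "admissible_rule R"
    and init: "I {} X"
    and final: "\<And>G. I G {} \<Longrightarrow> position X G {} \<Longrightarrow> \<exists>T\<in>F. T \<subseteq> G"
    and step: "\<And>G U S. I G U \<Longrightarrow> position X G U \<Longrightarrow> U \<noteq> {} \<Longrightarrow> S \<in> R 1 U \<Longrightarrow>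
      \<exists>T\<in>R b (U - S). I (G \<union> S) (U - S - T)"
  shows "wins_game Enforcer R b X F"
proof -
  define J where "J P G U \<longleftrightarrow> position X G U \<and>
    (case P of Avoider \<Rightarrow> I G U | Enforcer \<Rightarrow> \<exists>T\<in>R b U. I G (U - T))" for P G U
  show ?thesis
  proof (rule wins_game_by_invariant[where I = J])
    show "J Avoider {} X" using init by (simp add: J_def position_def)
  next
    fix G U assume "J Enforcer G U"
    then show "\<exists>S\<in>R (bias b Enforcer) U. J (opponent Enforcer) (claim Enforcer S G) (U - S)"
      by (auto simp: J_def position_Diff)
  next
    fix G U S assume "J (opponent Enforcer) G U" "U \<noteq> {}" "S \<in> R (bias b (opponent Enforcer)) U"
    then show "J Enforcer (claim (opponent Enforcer) S G) (U - S)"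
      using step[of G U S] admissible_ruleD(1)[OF R] by (simp add: J_def position_move)
  next
    fix h assume "J (turn h) (avoider_claimed h) {}"
    then show "won_by Enforcer F h"
      using final by (cases "turn h") (auto simp: J_def avoider_loses_def)
  qed
qed

lemma avoider_wins_imp_not_enforcer_wins:
  assumes R: "admissible_rule R" and "finite X" and "b \<ge> 1" and "wins_game Avoider R b X F"
  shows "\<not> wins_game Enforcer R b X F"
proof
  assume "wins_game Enforcer R b X F"
  with assms(4) obtain \<sigma> \<tau> where \<sigma>: "winning_strategy R b X F Avoider \<sigma>"
    and \<tau>: "winning_strategy R b X F Enforcer \<tau>" by (auto simp: wins_game_def)
  have False if "consistent_history R b X Avoider \<sigma> h" "consistent_history R b X Enforcer \<tau> h" for h
    using that
  proof (induction "card (unclaimed X h)" arbitrary: h rule: less_induct)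
    case less
    have ne: "unclaimed X h \<noteq> {}" using less.prems \<sigma> \<tau> by (auto simp: winning_strategy_def)
    have fin: "finite (unclaimed X h)" using \<open>finite X\<close> by (simp add: unclaimed_def)
    define S where "S = (case turn h of Avoider \<Rightarrow> \<sigma> h | Enforcer \<Rightarrow> \<tau> h)"
    have legal: "S \<in> legal_moves R b X h"
      using \<sigma> \<tau> less.prems ne by (cases "turn h") (auto simp: winning_strategy_def S_def)
    have "consistent_history R b X Avoider \<sigma> (h @ [S])"
      "consistent_history R b X Enforcer \<tau> (h @ [S])"
      using less.prems ne legal
      by (cases "turn h"; auto simp: S_def intro: consistent_history.intros)+
    moreover have "card (unclaimed X (h @ [S])) < card (unclaimed X h)"
    proof -
      have move: "S \<in> R (bias b (turn h)) (unclaimed X h)"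
        using legal by (simp add: legal_moves_def)
      have "bias b (turn h) \<ge> 1" using \<open>b \<ge> 1\<close> by (cases "turn h") auto
      then have "S \<noteq> {}" "S \<subseteq> unclaimed X h"
        using admissible_rule_move_nonempty[OF R move fin ne] admissible_ruleD(1)[OF R move] by auto
      then show ?thesis using fin by (intro psubset_card_mono) auto
    qed
    ultimately show False using less.hyps by blast
  qed
  from this[of "[]"] show False by (auto intro: consistent_history.intros)
qed

lemma enforcer_wins_monotone_antimono:
  assumes "wins_game Enforcer monotone_moves b X F" and "b' \<le> b"
  shows "wins_game Enforcer monotone_moves b' X F"
proof -
  obtain \<tau> where \<tau>: "winning_strategy monotone_moves b X F Enforcer \<tau>"
    using assms by (auto simp: wins_game_def)
  have consistent: "consistent_history monotone_moves b X Enforcer \<tau> h"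
    if "consistent_history monotone_moves b' X Enforcer \<tau> h" for h
    using that
  proof induction
    case (opponent_move h S)
    then have "turn h = Avoider" by (cases "turn h") auto
    with opponent_move show ?case
      by (intro consistent_history.intros) (auto simp: legal_moves_def)
  qed (auto intro: consistent_history.intros)
  have legal: "legal_moves monotone_moves b X h \<subseteq> legal_moves monotone_moves b' X h"
    if "turn h = Enforcer" for h
    using that \<open>b' \<le> b\<close> by (auto simp: legal_moves_def monotone_moves_def)
  have "winning_strategy monotone_moves b' X F Enforcer \<tau>"
    using \<tau> consistent legal unfolding winning_strategy_def by blast
  then show ?thesis by (auto simp: wins_game_def)
qed

section \<open>The star game\<close>

definition deg :: "nat set set \<Rightarrow> nat \<Rightarrow> nat" where
  "deg G v = card {e \<in> G. v \<in> e}"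

lemma finite_complete_edges [simp]: "finite (complete_edges n)"
  by (rule finite_subset[of _ "Pow {..<n}"]) (auto simp: complete_edges_def)

lemma card_complete_edges: "card (complete_edges n) = n choose 2"
  unfolding complete_edges_def by (subst n_subsets) auto

lemma card_complete_edges_inside:
  assumes "finite W" "W \<subseteq> {..<n}"
  shows "card {e \<in> complete_edges n. e \<subseteq> W} = card W choose 2"
proof -
  have "{e \<in> complete_edges n. e \<subseteq> W} = {e. e \<subseteq> W \<and> card e = 2}"
    using assms by (auto simp: complete_edges_def)
  then show ?thesis using n_subsets[OF assms(1)] by simp
qed

lemma doubleton_in_complete_edges_iff:
  "{v, w} \<in> complete_edges n \<longleftrightarrow> v < n \<and> w < n \<and> v \<noteq> w"
  by (auto simp: complete_edges_def card_2_iff)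

lemma complete_edges_cases:
  assumes "e \<in> complete_edges n"
  obtains v w where "e = {v, w}" "v \<noteq> w" "v < n" "w < n"
  using assms by (auto simp: complete_edges_def card_2_iff)

lemma position_complete_edges_finite:
  assumes "position (complete_edges n) G U"
  shows "finite G" "finite U"
  using assms by (auto simp: position_def intro: finite_subset[OF _ finite_complete_edges])

lemma deg_mono: "finite G' \<Longrightarrow> G \<subseteq> G' \<Longrightarrow> deg G v \<le> deg G' v"
  unfolding deg_def by (intro card_mono) auto

lemma deg_empty [simp]: "deg {} v = 0"
  by (simp add: deg_def)

lemma deg_Un_disjoint:
  assumes "finite G" "finite H" "G \<inter> H = {}"
  shows "deg (G \<union> H) v = deg G v + deg H v"
proof -
  have "{e \<in> G \<union> H. v \<in> e} = {e \<in> G. v \<in> e} \<union> {e \<in> H. v \<in> e}" by auto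
  then show ?thesis unfolding deg_def using assms by (simp add: card_Un_disjoint disjoint_iff)
qed

lemma deg_insert:
  assumes "finite G" "e \<notin> G"
  shows "deg (insert e G) v = deg G v + (if v \<in> e then 1 else 0)"
proof -
  have "{a. a = e \<and> v \<in> a} = (if v \<in> e then {e} else {})" by auto
  then have "deg {e} v = (if v \<in> e then 1 else 0)" by (simp add: deg_def)
  moreover have "deg (G \<union> {e}) v = deg G v + deg {e} v" using assms by (intro deg_Un_disjoint) auto
  ultimately show ?thesis by simp
qed

lemma deg_move:
  assumes "position (complete_edges n) G U" "S \<subseteq> U"
  shows "deg (G \<union> S) v = deg G v + deg S v"
  using assms position_complete_edges_finite[OF assms(1)]
  by (intro deg_Un_disjoint) (auto simp: position_def intro: finite_subset)

lemma deg_eq_card_neighbours: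
  assumes "G \<subseteq> complete_edges n"
  shows "deg G v = card {w. {v, w} \<in> G}"
proof -
  have "{e \<in> G. v \<in> e} = (\<lambda>w. {v, w}) ` {w. {v, w} \<in> G}"
  proof (intro equalityI subsetI)
    fix e assume e: "e \<in> {e \<in> G. v \<in> e}"
    then have "e \<in> complete_edges n" using assms by blast
    then obtain x y where "e = {x, y}" by (rule complete_edges_cases)
    with e have "e = {v, x} \<or> e = {v, y}" by (auto simp: insert_commute)
    with e show "e \<in> (\<lambda>w. {v, w}) ` {w. {v, w} \<in> G}" by auto
  qed auto
  moreover have "inj_on (\<lambda>w. {v, w}) {w. {v, w} \<in> G}"
    by (auto simp: inj_on_def doubleton_eq_iff)
  ultimately show ?thesis by (simp add: deg_def card_image)
qed

lemma deg_complete_edges: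
  assumes "v < n"
  shows "deg (complete_edges n) v = n - 1"
proof -
  have "{w. {v, w} \<in> complete_edges n} = {..<n} - {v}"
    using assms by (auto simp: doubleton_in_complete_edges_iff)
  then show ?thesis using deg_eq_card_neighbours[of "complete_edges n" n v] assms by simp
qed

lemma sum_deg:
  assumes "G \<subseteq> complete_edges n"
  shows "(\<Sum>v<n. deg G v) = 2 * card G"
proof -
  have fin: "finite G" using assms finite_complete_edges by (rule finite_subset)
  have "(\<Sum>v<n. deg G v) = (\<Sum>v<n. \<Sum>e\<in>G. if v \<in> e then 1 else 0)"
    unfolding deg_def using fin by (intro sum.cong) (auto simp: sum.If_cases Int_def)
  also have "\<dots> = (\<Sum>e\<in>G. \<Sum>v<n. if v \<in> e then 1 else 0)" by (rule sum.swap)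
  also have "\<dots> = (\<Sum>e\<in>G. 2)"
  proof (intro sum.cong refl)
    fix e assume "e \<in> G"
    then have "e \<subseteq> {..<n}" "card e = 2" using assms by (auto simp: complete_edges_def)
    then show "(\<Sum>v<n. if v \<in> e then 1 else 0) = (2::nat)"
      by (simp add: sum.If_cases Int_absorb1)
  qed
  finally show ?thesis by simp
qed

lemma card_le_if_deg_le:
  assumes "G \<subseteq> complete_edges n" "\<And>v. deg G v \<le> d"
  shows "2 * card G \<le> n * d"
proof -
  have "2 * card G = (\<Sum>v<n. deg G v)" using sum_deg[OF assms(1)] by simp
  also have "\<dots> \<le> (\<Sum>v<n. d)" by (intro sum_mono assms(2))
  finally show ?thesis by simp
qed

lemma card_le_if_deg_pos:
  assumes "G \<subseteq> complete_edges n" "W \<subseteq> {..<n}" "\<And>v. v \<in> W \<Longrightarrow> 1 \<le> deg G v"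
  shows "card W \<le> 2 * card G"
proof -
  have "card W = (\<Sum>v\<in>W. 1)" by simp
  also have "\<dots> \<le> (\<Sum>v\<in>W. deg G v)" using assms(3) by (intro sum_mono)
  also have "\<dots> \<le> (\<Sum>v<n. deg G v)" using assms(2) by (intro sum_mono2) auto
  finally show ?thesis using sum_deg[OF assms(1)] by simp
qed

lemma card_edges_touching_le:
  assumes "U \<subseteq> complete_edges n" "finite W" "\<And>e. e \<in> U \<Longrightarrow> e \<inter> W \<noteq> {}"
  shows "card U \<le> card W * n"
proof -
  have "U \<subseteq> (\<Union>v\<in>W. (\<lambda>w. {v, w}) ` {..<n})"
  proof
    fix e assume e: "e \<in> U"
    then have "e \<in> complete_edges n" using assms(1) by blast
    then obtain v w where vw: "e = {v, w}" "v < n" "w < n" by (rule complete_edges_cases)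
    moreover have "{w, v} = {v, w}" by auto
    ultimately show "e \<in> (\<Union>v\<in>W. (\<lambda>w. {v, w}) ` {..<n})" using assms(3)[OF e] by fastforce
  qed
  then have "card U \<le> card (\<Union>v\<in>W. (\<lambda>w. {v, w}) ` {..<n})"
    using assms(2) by (intro card_mono) auto
  also have "\<dots> \<le> (\<Sum>v\<in>W. card ((\<lambda>w. {v, w}) ` {..<n}))" using assms(2) by (rule card_UN_le)
  also have "\<dots> \<le> (\<Sum>v\<in>W. n)"
    by (intro sum_mono) (use card_image_le[of "{..<n}"] in auto)
  finally show ?thesis by simp
qed

lemma contains_star_iff:
  assumes "G \<subseteq> complete_edges n" "k \<ge> 1"
  shows "(\<exists>T\<in>star_copies k n. T \<subseteq> G) \<longleftrightarrow> (\<exists>v. k \<le> deg G v)"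
proof
  assume "\<exists>T\<in>star_copies k n. T \<subseteq> G"
  then obtain c L where L: "L \<subseteq> {..<n} - {c}" "card L = k" "(\<lambda>v. {c, v}) ` L \<subseteq> G"
    by (auto simp: star_copies_def)
  have "{w. {c, w} \<in> G} \<subseteq> {..<n}" using assms(1) by (auto simp: complete_edges_def)
  then have "finite {w. {c, w} \<in> G}" by (rule finite_subset) simp
  then have "card L \<le> card {w. {c, w} \<in> G}" using L by (intro card_mono) auto
  then show "\<exists>v. k \<le> deg G v" using L(2) deg_eq_card_neighbours[OF assms(1)] by metis
next
  assume "\<exists>v. k \<le> deg G v"
  then obtain c where "k \<le> card {w. {c, w} \<in> G}" using deg_eq_card_neighbours[OF assms(1)] by metis
  then obtain L where L: "L \<subseteq> {w. {c, w} \<in> G}" "card L = k"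
    by (meson obtain_subset_with_card_n)
  then have edge: "c < n \<and> w < n \<and> c \<noteq> w" if "w \<in> L" for w
    using that assms(1) doubleton_in_complete_edges_iff by blast
  have "L \<noteq> {}" using L(2) assms(2) by auto
  then have "c < n" using edge by blast
  moreover have "L \<subseteq> {..<n} - {c}" using edge by auto
  ultimately show "\<exists>T\<in>star_copies k n. T \<subseteq> G"
    using L by (intro bexI[of _ "(\<lambda>v. {c, v}) ` L"]) (auto simp: star_copies_def)
qed

lemma avoider_wins_star_by_invariant:
  assumes R: "admissible_rule R" and "k \<ge> 1"
    and init: "I {} (complete_edges n)"
    and deg: "\<And>G U v. I G U \<Longrightarrow> deg G v < k"
    and step: "\<And>G U. I G U \<Longrightarrow> position (complete_edges n) G U \<Longrightarrow> U \<noteq> {} \<Longrightarrow>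
      \<exists>e\<in>U. \<forall>T\<in>R b (U - {e}). I (insert e G) (U - {e} - T)"
  shows "wins_star_game Avoider R k n b"
  unfolding wins_star_game_def
proof (rule avoider_wins_by_invariant[where I = I, OF R init])
  fix G assume "I G {}" "position (complete_edges n) G {}"
  then show "\<not> (\<exists>T\<in>star_copies k n. T \<subseteq> G)"
    using contains_star_iff[of G n k] deg[of G "{}"] \<open>k \<ge> 1\<close> by (auto simp: position_def not_le)
next
  fix G U assume I: "I G U" and pos: "position (complete_edges n) G U" and "U \<noteq> {}"
  then obtain e where e: "e \<in> U" "\<forall>T\<in>R b (U - {e}). I (insert e G) (U - {e} - T)"
    using step by blast
  have "card U > 0" using e(1) position_complete_edges_finite[OF pos] by (auto simp: card_gt_0_iff)
  then have "{e} \<in> R 1 U" using e(1) by (intro admissible_ruleI[OF R]) auto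
  then show "\<exists>S\<in>R 1 U. \<forall>T\<in>R b (U - S). I (G \<union> S) (U - S - T)" using e(2) by (intro bexI) auto
qed

lemma enforcer_wins_star_by_invariant:
  assumes R: "admissible_rule R" and "k \<ge> 1"
    and init: "I {} (complete_edges n)"
    and final: "\<And>G. I G {} \<Longrightarrow> position (complete_edges n) G {} \<Longrightarrow> \<exists>v. k \<le> deg G v"
    and step: "\<And>G U S. I G U \<Longrightarrow> position (complete_edges n) G U \<Longrightarrow> S \<in> R 1 U \<Longrightarrow>
      S \<subseteq> U \<Longrightarrow> S \<noteq> {} \<Longrightarrow> (\<And>v. deg (G \<union> S) v < k) \<Longrightarrow>
      \<exists>T\<in>R b (U - S). I (G \<union> S) (U - S - T)"
  shows "wins_star_game Enforcer R k n b"
  unfolding wins_star_game_def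
proof (rule enforcer_wins_by_invariant[OF R, where I = "\<lambda>G U. (\<exists>v. k \<le> deg G v) \<or> I G U"])
  show "(\<exists>v. k \<le> deg {} v) \<or> I {} (complete_edges n)" using init by simp
next
  fix G assume "(\<exists>v. k \<le> deg G v) \<or> I G {}" "position (complete_edges n) G {}"
  then show "\<exists>T\<in>star_copies k n. T \<subseteq> G"
    using final contains_star_iff[of G n k] \<open>k \<ge> 1\<close> by (auto simp: position_def)
next
  fix G U S
  assume I: "(\<exists>v. k \<le> deg G v) \<or> I G U" and pos: "position (complete_edges n) G U"
    and "U \<noteq> {}" and S: "S \<in> R 1 U"
  have "S \<subseteq> U" "S \<noteq> {}"
    using admissible_ruleD(1)[OF R S]
      admissible_rule_move_nonempty[OF R S position_complete_edges_finite(2)[OF pos] \<open>U \<noteq> {}\<close>]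
        by auto
  show "\<exists>T\<in>R b (U - S). (\<exists>v. k \<le> deg (G \<union> S) v) \<or> I (G \<union> S) (U - S - T)"
  proof (cases "\<exists>v. k \<le> deg (G \<union> S) v")
    case True
    obtain T where "T \<subseteq> U - S" "card T = min b (card (U - S))"
      by (meson min.cobounded2 obtain_subset_with_card_n)
    then have "T \<in> R b (U - S)" by (rule admissible_ruleI[OF R])
    then show ?thesis using True by blast
  next
    case False
    then have "deg (G \<union> S) v < k" for v by (simp add: not_le)
    moreover from this have "deg G v < k" for v
      using deg_move[OF pos \<open>S \<subseteq> U\<close>] by (metis add_lessD1)
    ultimately show ?thesis using step[OF _ pos S \<open>S \<subseteq> U\<close> \<open>S \<noteq> {}\<close>] I by (meson not_le)
  qed
qed

subsection \<open>Remainders in the strict game\<close>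

definition full_rounds :: "nat \<Rightarrow> nat \<Rightarrow> nat set set \<Rightarrow> bool" where
  "full_rounds n b U \<longleftrightarrow> (\<exists>t. n choose 2 = t * (b + 1) + card U)"

lemma full_rounds_complete_edges: "full_rounds n b (complete_edges n)"
  unfolding full_rounds_def by (intro exI[of _ 0]) (simp add: card_complete_edges)

lemma full_rounds_round:
  assumes "full_rounds n b U" "card U = card U' + (b + 1)"
  shows "full_rounds n b U'"
proof -
  obtain t where "n choose 2 = t * (b + 1) + card U" using assms(1) by (auto simp: full_rounds_def)
  then have "n choose 2 = Suc t * (b + 1) + card U'" using assms(2) by simp
  then show ?thesis unfolding full_rounds_def by blast
qed

text \<open>\<open>star_rem\<close> takes values in \<open>{1..b + 1}\<close>, hence the shift by 1.\<close>

lemma star_rem_eq_mod: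
  assumes "n \<ge> 2"
  shows "star_rem n b = ((n choose 2) - 1) mod (b + 1) + 1"
  unfolding star_rem_def
proof (rule the_equality)
  define N where "N = (n choose 2) - 1"
  have "n choose 2 \<noteq> 0" using assms by simp
  then have N: "n choose 2 = N + 1" by (simp add: N_def)
  have "(N mod (b + 1) + 1) mod (b + 1) = (N + 1) mod (b + 1)" by (rule mod_add_left_eq)
  then have "[N + 1 = N mod (b + 1) + 1] (mod (b + 1))" by (simp only: Cong.cong_def)
  moreover have "N mod (b + 1) + 1 \<le> b + 1" using mod_less_divisor[of "b + 1" N] by linarith
  ultimately show "1 \<le> ((n choose 2) - 1) mod (b + 1) + 1
      \<and> ((n choose 2) - 1) mod (b + 1) + 1 \<le> b + 1
      \<and> [n choose 2 = ((n choose 2) - 1) mod (b + 1) + 1] (mod (b + 1))"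
    unfolding N_def[symmetric] using N by auto
  fix r assume r: "1 \<le> r \<and> r \<le> b + 1 \<and> [n choose 2 = r] (mod (b + 1))"
  then have "[N + 1 = (r - 1) + 1] (mod (b + 1))" using N by simp
  then have "[N = r - 1] (mod (b + 1))" by (simp only: cong_add_rcancel_nat)
  moreover have "r - 1 < b + 1" using r by linarith
  ultimately have "N mod (b + 1) = r - 1" by (simp add: Cong.cong_def)
  then show "r = ((n choose 2) - 1) mod (b + 1) + 1" using r by (simp add: N_def)
qed

lemma star_rem_bounds:
  assumes "n \<ge> 2"
  shows "1 \<le> star_rem n b" "star_rem n b \<le> b + 1"
  using mod_less_divisor[of "b + 1" "(n choose 2) - 1"] star_rem_eq_mod[OF assms, of b] by linarith+

lemma star_rem_eqI:
  assumes "n \<ge> 2" "n choose 2 = t * (b + 1) + r" "1 \<le> r" "r \<le> b + 1"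
  shows "star_rem n b = r"
proof -
  have "(n choose 2) - 1 = t * (b + 1) + (r - 1)" using assms(2,3) by linarith
  moreover have "(t * (b + 1) + (r - 1)) mod (b + 1) = r - 1"
    using assms(3,4) by (subst mod_mult_self3) simp
  ultimately have "((n choose 2) - 1) mod (b + 1) = r - 1" by simp
  then show ?thesis using star_rem_eq_mod[OF assms(1), of b] assms(3) by simp
qed

lemma star_rem_le_card:
  assumes "n \<ge> 2" "full_rounds n b U" "card U \<ge> 1"
  shows "star_rem n b \<le> card U"
proof (rule ccontr)
  assume "\<not> star_rem n b \<le> card U"
  then have less: "card U < star_rem n b" by simp
  moreover obtain t where "n choose 2 = t * (b + 1) + card U"
    using assms(2) by (auto simp: full_rounds_def)
  ultimately have "star_rem n b = card U"
    using assms(1,3) star_rem_bounds(2)[OF assms(1), of b] by (intro star_rem_eqI) auto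
  with less show False by simp
qed

lemma less_card_if_star_rem_less_card:
  assumes "n \<ge> 2" "full_rounds n b U" "star_rem n b < card U"
  shows "b + 1 < card U"
proof (rule ccontr)
  assume "\<not> b + 1 < card U"
  moreover obtain t where "n choose 2 = t * (b + 1) + card U"
    using assms(2) by (auto simp: full_rounds_def)
  ultimately have "star_rem n b = card U" using assms(1,3) by (intro star_rem_eqI) auto
  then show False using assms(3) by simp
qed

section \<open>Avoider's strategy\<close>

definition high_count :: "nat \<Rightarrow> nat set set \<Rightarrow> nat \<Rightarrow> nat" where
  "high_count n G i = card {v \<in> {..<n}. i \<le> deg G v}"

lemma high_count_antimono: "i \<le> j \<Longrightarrow> high_count n G j \<le> high_count n G i"
  unfolding high_count_def by (intro card_mono) auto

lemma high_count_le: "high_count n G i \<le> n"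
  unfolding high_count_def using card_mono[of "{..<n}" "{v \<in> {..<n}. i \<le> deg G v}"] by auto

lemma high_count_insert:
  assumes "finite G" "e \<notin> G" "e \<in> complete_edges n" and low: "\<And>v. v \<in> e \<Longrightarrow> deg G v \<le> j"
  shows "high_count n (insert e G) (Suc i) \<le> high_count n G (Suc i) + (if i \<le> j then 2 else 0)"
proof -
  have "{v \<in> {..<n}. Suc i \<le> deg (insert e G) v}
      \<subseteq> {v \<in> {..<n}. Suc i \<le> deg G v} \<union> (if i \<le> j then e else {})"
    using low deg_insert[OF assms(1,2)] by (force split: if_splits)
  moreover have e: "finite e" "card e = 2"
    using assms(3) by (auto simp: complete_edges_def card_2_iff)
  ultimately have "high_count n (insert e G) (Suc i)
      \<le> card ({v \<in> {..<n}. Suc i \<le> deg G v} \<union> (if i \<le> j then e else {}))"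
    unfolding high_count_def by (intro card_mono) auto
  also have "\<dots> \<le> high_count n G (Suc i) + card (if i \<le> j then e else {})"
    unfolding high_count_def by (rule card_Un_le)
  finally show ?thesis using e(2) by (auto split: if_splits)
qed

definition level_bound :: "nat \<Rightarrow> nat \<Rightarrow> nat \<Rightarrow> real" where
  "level_bound n b i = real n * (2 * real n / real (b + 1)) ^ i"

lemma level_bound_nonneg: "0 \<le> level_bound n b i"
  by (simp add: level_bound_def)

lemma level_bound_Suc: "level_bound n b (Suc i) = 2 * (real n * level_bound n b i) / real (b + 1)"
  by (simp add: level_bound_def)

text \<open>At most \<open>card U / (b + 1)\<close> rounds are left, and each creates at most two vertices of
  degree \<open>i + 1\<close>.\<close>

definition levels_controlled :: "nat \<Rightarrow> nat \<Rightarrow> nat set set \<Rightarrow> nat set set \<Rightarrow> bool" where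
  "levels_controlled n b G U \<longleftrightarrow> (\<forall>i. high_count n G (Suc i) = 0 \<or>
     real (high_count n G (Suc i)) + 2 * real (card U) / real (b + 1) \<le> level_bound n b (Suc i))"

lemma rounds_left_Diff:
  assumes "card U' + (b + 1) \<le> card U"
  shows "2 * real (card U') / real (b + 1) + 2 \<le> 2 * real (card U) / real (b + 1)"
proof -
  define B where "B = real (b + 1)"
  have "B > 0" by (simp add: B_def)
  have "real (card U') + B \<le> real (card U)"
    using of_nat_mono[OF assms, where 'a = real] by (simp add: B_def)
  then have "2 * (real (card U') + B) / B \<le> 2 * real (card U) / B"
    using \<open>B > 0\<close> by (intro divide_right_mono) auto
  then have "2 * real (card U') / B + 2 \<le> 2 * real (card U) / B"
    using \<open>B > 0\<close> by (simp add: add_divide_distrib)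
  then show ?thesis by (simp only: B_def)
qed

lemma levels_controlled_high_count_le:
  assumes "levels_controlled n b G U"
  shows "real (high_count n G i) \<le> level_bound n b i"
proof (cases i)
  case 0
  then show ?thesis using high_count_le[of n G 0] by (simp add: level_bound_def)
next
  case (Suc i')
  have "0 \<le> 2 * real (card U) / real (b + 1)" by simp
  moreover have "high_count n G i = 0 \<or>
      real (high_count n G i) + 2 * real (card U) / real (b + 1) \<le> level_bound n b i"
    using assms unfolding Suc levels_controlled_def by blast
  ultimately show ?thesis using level_bound_nonneg[of n b i] by linarith
qed

lemma levels_controlled_round:
  assumes inv: "levels_controlled n b G U"
    and G: "finite G" "e \<notin> G" "e \<in> complete_edges n"
    and low: "\<And>v. v \<in> e \<Longrightarrow> deg G v \<le> j"
    and few: "card U \<le> high_count n G j * n"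
    and round: "card U' + (b + 1) \<le> card U"
  shows "levels_controlled n b (insert e G) U'"
  unfolding levels_controlled_def
proof (intro allI)
  fix i
  define B where "B = real (b + 1)"
  have left: "2 * real (card U') / B + 2 \<le> 2 * real (card U) / B"
    unfolding B_def using round by (rule rounds_left_Diff)
  have count: "high_count n (insert e G) (Suc i)
      \<le> high_count n G (Suc i) + (if i \<le> j then 2 else 0)"
    using high_count_insert[OF G low] by blast
  show "high_count n (insert e G) (Suc i) = 0 \<or>
    real (high_count n (insert e G) (Suc i)) + 2 * real (card U') / real (b + 1)
      \<le> level_bound n b (Suc i)"
  proof (cases "high_count n G (Suc i) = 0 \<and> i \<le> j")
    case True
    have "card U \<le> high_count n G i * n"
      using few high_count_antimono[of i j n G] True by (meson le_trans mult_le_mono1)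
    then have "real (card U) \<le> real n * real (high_count n G i)"
      by (metis mult.commute of_nat_le_iff of_nat_mult)
    also have "\<dots> \<le> real n * level_bound n b i"
      using levels_controlled_high_count_le[OF inv] by (intro mult_left_mono) auto
    finally have "2 * real (card U) / B \<le> level_bound n b (Suc i)"
      unfolding level_bound_Suc B_def by (intro divide_right_mono) auto
    then show ?thesis using left count True by (simp add: B_def)
  next
    case False
    have "high_count n G (Suc i) = 0 \<or>
        real (high_count n G (Suc i)) + 2 * real (card U) / B \<le> level_bound n b (Suc i)"
      using inv unfolding levels_controlled_def B_def by blast
    moreover have "real (high_count n (insert e G) (Suc i)) \<le> real (high_count n G (Suc i)) + 2"
      using count by (simp split: if_splits)
    ultimately show ?thesis using False count left unfolding B_def[symmetric] by auto
  qed
qed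

lemma levels_controlled_imp_critical:
  assumes inv: "levels_controlled n b G U" and "k \<ge> 2" and "U \<noteq> {}" "finite U"
    and few: "card U \<le> high_count n G (k - 1) * n"
  shows "1 < level_bound n b (k - 1)" "real (card U) \<le> real n * level_bound n b (k - 1)"
proof -
  have card: "card U > 0" using assms(3,4) by (simp add: card_gt_0_iff)
  then have "high_count n G (k - 1) \<noteq> 0" using few by (metis mult_0 not_le)
  moreover have "k - 1 = Suc (k - 2)" using \<open>k \<ge> 2\<close> by simp
  ultimately have "real (high_count n G (k - 1)) + 2 * real (card U) / real (b + 1)
      \<le> level_bound n b (k - 1)" using inv unfolding levels_controlled_def by metis
  moreover have "1 \<le> real (high_count n G (k - 1))"
    using \<open>high_count n G (k - 1) \<noteq> 0\<close> by simp
  moreover have "0 < 2 * real (card U) / real (b + 1)" using card by simp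
  ultimately show "1 < level_bound n b (k - 1)" by linarith
  have "real (card U) \<le> real n * real (high_count n G (k - 1))"
    using few by (metis mult.commute of_nat_le_iff of_nat_mult)
  also have "\<dots> \<le> real n * level_bound n b (k - 1)"
    using levels_controlled_high_count_le[OF inv] by (intro mult_left_mono) auto
  finally show "real (card U) \<le> real n * level_bound n b (k - 1)" .
qed

lemma ex_edge_of_min_degree:
  assumes "U \<subseteq> complete_edges n" "U \<noteq> {}"
  obtains e j where "e \<in> U" "\<And>v. v \<in> e \<Longrightarrow> deg G v \<le> j" "card U \<le> high_count n G j * n"
proof -
  define M where "M e = Max (deg G ` e)" for e
  have fin: "finite U" using assms(1) finite_complete_edges by (rule finite_subset)
  obtain e where e: "e \<in> U" "\<And>f. f \<in> U \<Longrightarrow> M e \<le> M f"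
    using arg_min_if_finite(1)[OF fin assms(2)] arg_min_least[OF fin assms(2)] by metis
  have edge: "finite f \<and> f \<noteq> {} \<and> f \<subseteq> {..<n}" if "f \<in> U" for f
    using that assms(1) by (auto simp: complete_edges_def card_2_iff subset_iff)
  have "f \<inter> {v \<in> {..<n}. M e \<le> deg G v} \<noteq> {}" if "f \<in> U" for f
  proof -
    have "M f \<in> deg G ` f" unfolding M_def using edge[OF that] by (intro Max_in) auto
    then show ?thesis using e(2)[OF that] edge[OF that] by auto
  qed
  then have "card U \<le> high_count n G (M e) * n"
    unfolding high_count_def by (intro card_edges_touching_le[OF assms(1)]) auto
  moreover have "deg G v \<le> M e" if "v \<in> e" for v using that edge[OF e(1)] by (simp add: M_def)
  ultimately show thesis using that[OF e(1)] by blast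
qed

lemma avoider_wins_star_if_uncritical:
  assumes R: "admissible_rule R" and k: "k \<ge> 2"
    and init: "Q (complete_edges n)"
    and step: "\<And>U e T. Q U \<Longrightarrow> U \<subseteq> complete_edges n \<Longrightarrow> e \<in> U \<Longrightarrow> T \<in> R b (U - {e}) \<Longrightarrow>
      U - {e} - T \<noteq> {} \<Longrightarrow> Q (U - {e} - T)"
    and uncritical: "\<And>U. Q U \<Longrightarrow> U \<noteq> {} \<Longrightarrow> finite U \<Longrightarrow>
      level_bound n b (k - 1) \<le> 1 \<or> real n * level_bound n b (k - 1) < real (card U)"
  shows "wins_star_game Avoider R k n b"
proof (rule avoider_wins_star_by_invariant[OF R, where
      I = "\<lambda>G U. (\<forall>v. deg G v < k) \<and> (U \<noteq> {} \<longrightarrow> Q U \<and> levels_controlled n b G U)"])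
  show "(\<forall>v. deg {} v < k) \<and> (complete_edges n \<noteq> {} \<longrightarrow>
      Q (complete_edges n) \<and> levels_controlled n b {} (complete_edges n))"
    using init k by (auto simp: levels_controlled_def high_count_def)
next
  fix G U
  assume inv: "(\<forall>v. deg G v < k) \<and> (U \<noteq> {} \<longrightarrow> Q U \<and> levels_controlled n b G U)"
    and pos: "position (complete_edges n) G U" and ne: "U \<noteq> {}"
  have fin: "finite G" "finite U" using position_complete_edges_finite[OF pos] by auto
  have U: "U \<subseteq> complete_edges n" using pos by (simp add: position_def)
  obtain e j where e: "e \<in> U" and low: "\<And>v. v \<in> e \<Longrightarrow> deg G v \<le> j"
    and few: "card U \<le> high_count n G j * n" using ex_edge_of_min_degree[OF U ne] by metis
  have new: "e \<notin> G" "e \<in> complete_edges n" using e pos by (auto simp: position_def)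
  have "Suc j < k"
  proof (rule ccontr)
    assume "\<not> Suc j < k"
    then have "card U \<le> high_count n G (k - 1) * n"
      using high_count_antimono[of "k - 1" j n G] by (intro order.trans[OF few] mult_le_mono1) simp
    then show False
      using levels_controlled_imp_critical[OF _ k ne fin(2)] uncritical[OF _ ne fin(2)] inv ne
      by (meson not_le)
  qed
  then have "deg (insert e G) v < k" for v
    using deg_insert[OF fin(1) new(1), of v] low[of v] inv by auto
  moreover have "Q (U - {e} - T) \<and> levels_controlled n b (insert e G) (U - {e} - T)"
    if T: "T \<in> R b (U - {e})" and ne': "U - {e} - T \<noteq> {}" for T
  proof
    show "Q (U - {e} - T)" using step[OF _ U e T ne'] inv ne by blast
    have T': "T \<subseteq> U - {e}" "min b (card (U - {e})) \<le> card T" using admissible_ruleD[OF R T] by auto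
    have "card (U - {e} - T) > 0" using ne' fin by (simp add: card_gt_0_iff)
    moreover have "card (U - {e} - T) = card U - 1 - card T"
      using T'(1) fin e by (simp add: card_Diff_subset finite_subset)
    ultimately have "card (U - {e} - T) + (b + 1) \<le> card U"
      using T'(2) e fin by (simp add: min_def split: if_splits)
    then show "levels_controlled n b (insert e G) (U - {e} - T)"
      using levels_controlled_round[OF _ fin(1) new low few] inv ne by blast
  qed
  ultimately show "\<exists>e\<in>U. \<forall>T\<in>R b (U - {e}). (\<forall>v. deg (insert e G) v < k) \<and>
      (U - {e} - T \<noteq> {} \<longrightarrow> Q (U - {e} - T) \<and> levels_controlled n b (insert e G) (U - {e} - T))"
    using e by blast
qed (use k in auto)

lemma avoider_wins_if_level_bound_le_1:
  assumes "admissible_rule R" "k \<ge> 2" "level_bound n b (k - 1) \<le> 1"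
  shows "wins_star_game Avoider R k n b"
  by (rule avoider_wins_star_if_uncritical[OF assms(1,2), where Q = "\<lambda>_. True"])
    (use assms(3) in auto)

lemma avoider_wins_strict_if_star_rem_large:
  assumes "k \<ge> 2" "n \<ge> 2" and large: "real n * level_bound n b (k - 1) < real (star_rem n b)"
  shows "wins_star_game Avoider strict_moves k n b"
proof (rule avoider_wins_star_if_uncritical[OF admissible_rule_strict assms(1),
      where Q = "full_rounds n b"])
  fix U e T
  assume full: "full_rounds n b U" and U: "U \<subseteq> complete_edges n" and e: "e \<in> U"
    and T: "T \<in> strict_moves b (U - {e})" and ne: "U - {e} - T \<noteq> {}"
  have fin: "finite (U - {e})" using U finite_complete_edges finite_subset by blast
  have T': "T \<subseteq> U - {e}" "card T = min b (card (U - {e}))" using T by (auto simp: strict_moves_def)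
  have "T \<noteq> U - {e}" using ne by blast
  then have "card T < card (U - {e})" using T'(1) fin by (intro psubset_card_mono) auto
  then have "card (U - {e} - T) + b = card (U - {e})"
    using T' fin by (simp add: card_Diff_subset finite_subset)
  moreover have "card U = Suc (card (U - {e}))" using fin e card_Suc_Diff1[of U e] by simp
  ultimately have "card U = card (U - {e} - T) + (b + 1)" by simp
  then show "full_rounds n b (U - {e} - T)" by (rule full_rounds_round[OF full])
next
  fix U :: "nat set set" assume "full_rounds n b U" "U \<noteq> {}" "finite U"
  then have "star_rem n b \<le> card U"
    by (intro star_rem_le_card[OF assms(2)]) (auto simp: Suc_le_eq card_gt_0_iff)
  then show "level_bound n b (k - 1) \<le> 1 \<or> real n * level_bound n b (k - 1) < real (card U)"
    using large by linarith
qed (rule full_rounds_complete_edges)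

section \<open>The level potential\<close>

lemma ex_bounded_distribution:
  assumes "finite K" "\<beta> \<le> card K * c"
  shows "\<exists>t :: 'a \<Rightarrow> nat. (\<forall>v\<in>K. t v \<le> c) \<and> sum t K = \<beta>"
  using assms
proof (induction arbitrary: \<beta> rule: finite_induct)
  case empty
  then show ?case by auto
next
  case (insert x K)
  have "\<beta> - min c \<beta> \<le> card K * c" using insert by auto
  then obtain t :: "'a \<Rightarrow> nat" where t: "\<forall>v\<in>K. t v \<le> c" "sum t K = \<beta> - min c \<beta>"
    using insert.IH by blast
  have "sum (t(x := min c \<beta>)) K = sum t K" using insert.hyps by (intro sum.cong) auto
  then show ?case
    using t insert.hyps by (intro exI[of _ "t(x := min c \<beta>)"]) auto
qed

text \<open>A vertex \<open>v\<close> enters only through the number \<open>u v\<close> of its unclaimed edges and through its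
  level \<open>d v\<close>; it is alive if \<open>u v > 0\<close>, and \<^emph>\<open>sound\<close> if Enforcer has claimed at most \<open>\<Delta>\<close> of its
  edges per unit of level. Enforcer kills vertices of the lowest level \<open>i\<close>, but his budget \<open>b\<close>
  rarely suffices for a whole number of them. After his move there is thus a set \<open>K\<close> of at most
  \<open>s\<close> vertices of level \<open>i\<close> that are partly damaged. Either each of them becomes sound again as
  soon as Avoider raises it (\<open>tight\<close>), or they are the last vertices of their level, are
  written off in the potential and killed next (\<open>surplus\<close>).\<close>

locale level_potential =
  fixes k b s m M \<Delta> \<mu> :: nat and \<rho> P0 :: real
  assumes k_ge_2: "k \<ge> 2" and m_le: "m \<le> s * \<Delta>" and sm_le: "s * m \<le> b"
    and margin: "(k - 1) * (\<Delta> + 1) + \<mu> \<le> M"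
    and \<rho>_ge_1: "\<rho> \<ge> 1" and \<rho>_gain: "real b + 1 \<le> (\<rho> - 1) * real \<mu>"
begin

definition sound :: "nat \<Rightarrow> nat \<Rightarrow> bool" where
  "sound u d \<longleftrightarrow> M \<le> u + d * (\<Delta> + 1)"

definition pot :: "'a set \<Rightarrow> ('a \<Rightarrow> nat) \<Rightarrow> ('a \<Rightarrow> nat) \<Rightarrow> real" where
  "pot A u d = (\<Sum>v\<in>A. \<rho> ^ d v * real (u v))"

definition threshold :: "nat \<Rightarrow> real" where
  "threshold i = P0 - real (b + s * m) * (\<Sum>l<i. \<rho> ^ l)"

definition alive_sound :: "'a set \<Rightarrow> nat \<Rightarrow> ('a \<Rightarrow> nat) \<Rightarrow> ('a \<Rightarrow> nat) \<Rightarrow> bool" where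
  "alive_sound A i u d \<longleftrightarrow> (\<forall>v\<in>A. u v > 0 \<longrightarrow> sound (u v) (d v) \<and> i \<le> d v)"

definition surplus :: "'a set \<Rightarrow> nat \<Rightarrow> 'a set \<Rightarrow> ('a \<Rightarrow> nat) \<Rightarrow> ('a \<Rightarrow> nat) \<Rightarrow> bool" where
  "surplus A i K u d \<longleftrightarrow> i < k \<and> K \<subseteq> A \<and> card K \<le> s \<and> alive_sound (A - K) i u d
     \<and> threshold i \<le> pot (A - K) u d"

definition tight :: "'a set \<Rightarrow> nat \<Rightarrow> 'a set \<Rightarrow> ('a \<Rightarrow> nat) \<Rightarrow> ('a \<Rightarrow> nat) \<Rightarrow> bool" where
  "tight A i K u d \<longleftrightarrow> Suc i < k \<and> K \<subseteq> A \<and> card K \<le> s \<and> alive_sound (A - K) i u d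
     \<and> (\<forall>v\<in>K. u v > 0 \<longrightarrow> sound (u v + \<Delta>) (d v) \<and> d v = i)
     \<and> threshold i - real b * \<rho> ^ i \<le> pot A u d"

definition stable :: "'a set \<Rightarrow> ('a \<Rightarrow> nat) \<Rightarrow> ('a \<Rightarrow> nat) \<Rightarrow> bool" where
  "stable A u d \<longleftrightarrow> (\<exists>i K. tight A i K u d \<or> surplus A i K u d)"

definition exhausted :: "'a set \<Rightarrow> ('a \<Rightarrow> nat) \<Rightarrow> ('a \<Rightarrow> nat) \<Rightarrow> bool" where
  "exhausted A u d \<longleftrightarrow> (\<forall>v\<in>A. u v > 0 \<longrightarrow> k \<le> Suc (d v)) \<and> threshold (k - 1) \<le> pot A u d"

definition spends :: "'a set \<Rightarrow> ('a \<Rightarrow> nat) \<Rightarrow> nat \<Rightarrow> ('a \<Rightarrow> nat) \<Rightarrow> ('a \<Rightarrow> nat) \<Rightarrow> bool" where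
  "spends A d \<beta> u u' \<longleftrightarrow> (\<forall>v\<in>A. u' v \<le> u v) \<and>
     (sum u A = sum u' A + \<beta> \<and> stable A u' d \<or> sum u A \<le> sum u' A + \<beta> \<and> exhausted A u' d)"

definition raises :: "'a set \<Rightarrow> ('a \<Rightarrow> nat) \<Rightarrow> ('a \<Rightarrow> nat) \<Rightarrow> ('a \<Rightarrow> nat) \<Rightarrow> ('a \<Rightarrow> nat) \<Rightarrow> bool" where
  "raises A u d u' d' \<longleftrightarrow> (\<forall>v\<in>A. u' v \<le> u v \<and> d v + (u v - u' v) \<le> d' v \<and> d' v < k)"

lemma surplus_imp_stable: "surplus A i K u d \<Longrightarrow> stable A u d"
  by (auto simp: stable_def)

lemma pot_cong: "(\<And>v. v \<in> A \<Longrightarrow> u v = u' v) \<Longrightarrow> pot A u d = pot A u' d"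
  unfolding pot_def by (intro sum.cong) auto

lemma alive_sound_cong:
  "(\<And>v. v \<in> A \<Longrightarrow> u v = u' v) \<Longrightarrow> alive_sound A i u d = alive_sound A i u' d"
  by (simp add: alive_sound_def)

lemma surplus_cong:
  assumes "\<And>v. v \<in> A \<Longrightarrow> u v = u' v"
  shows "surplus A i K u d = surplus A i K u' d"
proof -
  have "pot (A - K) u d = pot (A - K) u' d" using assms by (intro pot_cong) auto
  moreover have "alive_sound (A - K) i u d = alive_sound (A - K) i u' d"
    using assms by (intro alive_sound_cong) auto
  ultimately show ?thesis by (simp add: surplus_def)
qed

lemma tight_cong:
  assumes "\<And>v. v \<in> A \<Longrightarrow> u v = u' v"
  shows "tight A i K u d = tight A i K u' d"
proof -
  have "pot A u d = pot A u' d" using assms by (rule pot_cong)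
  moreover have "alive_sound (A - K) i u d = alive_sound (A - K) i u' d"
    using assms by (intro alive_sound_cong) auto
  moreover have "(\<forall>v\<in>K. u v > 0 \<longrightarrow> sound (u v + \<Delta>) (d v) \<and> d v = i)
      = (\<forall>v\<in>K. u' v > 0 \<longrightarrow> sound (u' v + \<Delta>) (d v) \<and> d v = i)" if "K \<subseteq> A"
    using assms that by (intro ball_cong) auto
  ultimately show ?thesis unfolding tight_def by metis
qed

lemma exhausted_cong:
  assumes "\<And>v. v \<in> A \<Longrightarrow> u v = u' v"
  shows "exhausted A u d = exhausted A u' d"
proof -
  have "pot A u d = pot A u' d" using assms by (rule pot_cong)
  then show ?thesis using assms by (simp add: exhausted_def)
qed

lemma stable_cong: "(\<And>v. v \<in> A \<Longrightarrow> u v = u' v) \<Longrightarrow> stable A u d = stable A u' d"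
  unfolding stable_def using surplus_cong tight_cong by metis

subsection \<open>Thresholds\<close>

lemma \<rho>_pos: "\<rho> > 0"
  using \<rho>_ge_1 by simp

lemma threshold_0 [simp]: "threshold 0 = P0"
  by (simp add: threshold_def)

lemma threshold_Suc: "threshold (Suc i) = threshold i - real (b + s * m) * \<rho> ^ i"
  by (simp add: threshold_def algebra_simps)

lemma threshold_antimono:
  assumes "i \<le> j"
  shows "threshold j \<le> threshold i"
proof -
  have "(\<Sum>l<i. \<rho> ^ l) \<le> (\<Sum>l<j. \<rho> ^ l)" using assms \<rho>_pos by (intro sum_mono2) auto
  then show ?thesis unfolding threshold_def by (intro diff_left_mono mult_left_mono) auto
qed

lemma threshold_less:
  assumes "i < j" "c \<le> real (b + s * m)"
  shows "threshold j \<le> threshold i - c * \<rho> ^ i"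
proof -
  have "threshold j \<le> threshold (Suc i)" using assms(1) by (intro threshold_antimono) simp
  moreover have "c * \<rho> ^ i \<le> real (b + s * m) * \<rho> ^ i"
    using assms(2) \<rho>_pos by (intro mult_right_mono) auto
  ultimately show ?thesis by (simp add: threshold_Suc)
qed

lemma threshold_ge:
  assumes \<rho>: "\<rho> = 1 + real (b + 1) / real \<mu>" and \<mu>: "\<mu> > 0"
    and c: "real (b + s * m) \<le> c * real (b + 1)" "c \<ge> 0"
  shows "P0 - c * real \<mu> * \<rho> ^ i \<le> threshold i"
proof -
  define \<Sigma> where "\<Sigma> = (\<Sum>l<i. \<rho> ^ l)"
  have "\<Sigma> \<ge> 0" unfolding \<Sigma>_def using \<rho>_pos by (intro sum_nonneg) auto
  have "\<rho> ^ i - 1 = (\<rho> - 1) * \<Sigma>" unfolding \<Sigma>_def by (rule power_diff_1_eq)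
  then have "real (b + 1) / real \<mu> * \<Sigma> \<le> \<rho> ^ i" using \<rho> by simp
  then have geometric: "real (b + 1) * \<Sigma> \<le> real \<mu> * \<rho> ^ i" using \<mu> by (simp add: field_simps)
  have "real (b + s * m) * \<Sigma> \<le> c * real (b + 1) * \<Sigma>"
    using c \<open>\<Sigma> \<ge> 0\<close> by (intro mult_right_mono) auto
  also have "\<dots> \<le> c * (real \<mu> * \<rho> ^ i)"
    using geometric c(2) by (simp only: mult.assoc) (rule mult_left_mono)
  finally show ?thesis unfolding threshold_def \<Sigma>_def by (simp add: mult.assoc)
qed

text \<open>With the budget \<open>\<beta>\<close> left, Enforcer has spent \<open>b - \<beta>\<close> edges on vertices of level at most
  \<open>i\<close>, and \<open>W\<close> is the potential of the rest. On the top level \<open>k - 1\<close> nothing may be spent.\<close>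

definition funded :: "nat \<Rightarrow> nat \<Rightarrow> real \<Rightarrow> bool" where
  "funded i \<beta> W \<longleftrightarrow> (Suc i < k \<longrightarrow> threshold i - (real b - real \<beta>) * \<rho> ^ i \<le> W)
     \<and> threshold (k - 1) \<le> W"

lemma funded_if_threshold_le:
  assumes "threshold i \<le> W" "i < k" "\<beta> \<le> b"
  shows "funded i \<beta> W"
proof -
  have "0 \<le> (real b - real \<beta>) * \<rho> ^ i" using assms(3) \<rho>_pos by simp
  moreover have "threshold (k - 1) \<le> threshold i" using assms(2) by (intro threshold_antimono) simp
  ultimately show ?thesis using assms(1) unfolding funded_def by linarith
qed

lemma fundedI:
  assumes "threshold i - (real b - real \<beta>) * \<rho> ^ i \<le> W" "Suc i < k"
  shows "funded i \<beta> W"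
proof -
  have "i < k - 1" using assms(2) by simp
  then have "threshold (k - 1) \<le> threshold i - (real b - real \<beta>) * \<rho> ^ i"
    by (rule threshold_less) (simp add: add_increasing2)
  then show ?thesis using assms unfolding funded_def by linarith
qed

lemma funded_higher_level:
  assumes "funded i \<beta> W" "i \<le> j" "Suc j < k" "\<beta> \<le> b"
  shows "funded j \<beta> W"
proof (cases "i = j")
  case False
  then have "threshold j \<le> threshold i - (real b - real \<beta>) * \<rho> ^ i"
    using assms(2) by (intro threshold_less) (auto simp: add_increasing2)
  then have "threshold j \<le> W" using assms unfolding funded_def by linarith
  then show ?thesis using assms(3,4) by (intro funded_if_threshold_le) auto
qed (use assms in simp)

lemma funded_kill:
  assumes "funded i \<beta> (W + \<rho> ^ i * real c)" "Suc i < k" "c \<le> \<beta>"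
  shows "funded i (\<beta> - c) W"
  using assms by (intro fundedI) (auto simp: funded_def of_nat_diff algebra_simps)

subsection \<open>Enforcer's reply\<close>

lemma pot_diff_at_level:
  assumes "\<And>v. v \<in> A \<Longrightarrow> u' v \<le> u v" "\<And>v. v \<in> A \<Longrightarrow> u' v < u v \<Longrightarrow> d v = i"
    and "sum u A = sum u' A + \<beta>"
  shows "pot A u d = pot A u' d + \<rho> ^ i * real \<beta>"
proof -
  have "pot A u d = (\<Sum>v\<in>A. \<rho> ^ d v * real (u' v) + \<rho> ^ i * (real (u v) - real (u' v)))"
    unfolding pot_def
  proof (intro sum.cong refl)
    fix v assume "v \<in> A"
    then show "\<rho> ^ d v * real (u v) = \<rho> ^ d v * real (u' v) + \<rho> ^ i * (real (u v) - real (u' v))"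
      using assms(1,2)[of v] by (cases "u' v = u v") (auto simp: algebra_simps)
  qed
  also have "\<dots> = pot A u' d + \<rho> ^ i * (real (sum u A) - real (sum u' A))"
    by (simp add: pot_def sum.distrib sum_subtractf sum_distrib_left right_diff_distrib)
  finally show ?thesis using assms(3) by simp
qed

lemma pot_mono:
  assumes "finite A" "B \<subseteq> A"
  shows "pot B u d \<le> pot A u d"
  unfolding pot_def using assms \<rho>_pos by (intro sum_mono2) auto

lemma pot_le_power:
  assumes "\<And>v. v \<in> A \<Longrightarrow> u v > 0 \<Longrightarrow> d v \<le> l"
  shows "pot A u d \<le> \<rho> ^ l * real (sum u A)"
proof -
  have "\<rho> ^ d v * real (u v) \<le> \<rho> ^ l * real (u v)" if "v \<in> A" for v
    using assms[OF that] \<rho>_ge_1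
    by (cases "u v = 0") (auto intro!: mult_right_mono power_increasing)
  then show ?thesis unfolding pot_def of_nat_sum sum_distrib_left by (rule sum_mono)
qed

lemma sum_le_budget:
  assumes "card K \<le> s" "\<And>v. v \<in> K \<Longrightarrow> u v \<le> m"
  shows "sum u K \<le> s * m"
proof -
  have "sum u K \<le> card K * m" using assms(2) sum_bounded_above[of K u m] by simp
  also have "\<dots> \<le> s * m" using assms(1) by (rule mult_le_mono1)
  finally show ?thesis .
qed

lemma spends_if_few_lowest:
  assumes A: "finite A" and bounded: "\<And>v. v \<in> A \<Longrightarrow> u v \<le> m" and alive: "alive_sound A i u d"
    and funded: "funded i \<beta> (pot A u d)" and i: "Suc i < k"
    and L: "L = {v \<in> A. u v > 0 \<and> d v = i}" and few: "card L \<le> s" and x: "x \<in> L" "\<beta> < u x"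
  shows "spends A d \<beta> u (u(x := u x - \<beta>))"
proof -
  define u' where "u' = u(x := u x - \<beta>)"
  have "x \<in> A" using x L by simp
  then have "sum u A = u x + sum u (A - {x})" "sum u' A = u x - \<beta> + sum u (A - {x})"
    using A by (simp_all add: u'_def sum.remove)
  then have sum_u: "sum u A = sum u' A + \<beta>" using x(2) by simp
  have "alive_sound (A - L) (Suc i) u' d"
    unfolding alive_sound_def
  proof (intro ballI impI)
    fix v assume v: "v \<in> A - L" "u' v > 0"
    then have "u' v = u v" using x(1) by (auto simp: u'_def)
    then show "sound (u' v) (d v) \<and> Suc i \<le> d v"
      using alive v L by (fastforce simp: alive_sound_def)
  qed
  moreover have "threshold (Suc i) \<le> pot (A - L) u' d"
  proof -
    have "pot A u d = pot L u d + pot (A - L) u d"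
      unfolding pot_def using A by (subst sum.subset_diff[of L]) (auto simp: L)
    moreover have "pot (A - L) u d = pot (A - L) u' d"
      unfolding pot_def using x(1) by (intro sum.cong) (auto simp: u'_def)
    moreover have "pot L u d \<le> \<rho> ^ i * real (sum u L)" by (rule pot_le_power) (simp add: L)
    moreover have "sum u L \<le> s * m" using few bounded L by (intro sum_le_budget) auto
    then have "\<rho> ^ i * real (sum u L) \<le> \<rho> ^ i * real (s * m)"
      using \<rho>_pos by (intro mult_left_mono) (simp_all only: of_nat_le_iff zero_le_power less_imp_le)
    moreover have "threshold i - (real b - real \<beta>) * \<rho> ^ i \<le> pot A u d"
      using funded i by (simp add: funded_def)
    moreover have "0 \<le> real \<beta> * \<rho> ^ i" using \<rho>_pos by simp
    ultimately show ?thesis unfolding threshold_Suc by (simp add: algebra_simps)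
  qed
  ultimately have "surplus A (Suc i) L u' d" using i few L by (auto simp: surplus_def)
  then have "spends A d \<beta> u u'" using sum_u by (auto simp: spends_def stable_def u'_def)
  then show ?thesis by (simp only: u'_def)
qed

lemma ex_spends_if_many_lowest:
  assumes A: "finite A" and bounded: "\<And>v. v \<in> A \<Longrightarrow> u v \<le> m" and alive: "alive_sound A i u d"
    and funded: "funded i \<beta> (pot A u d)" and i: "Suc i < k"
    and L: "L = {v \<in> A. u v > 0 \<and> d v = i}" and many: "s \<le> card L"
    and large: "\<And>v. v \<in> L \<Longrightarrow> \<beta> < u v" and ne: "L \<noteq> {}"
  shows "\<exists>u'. spends A d \<beta> u u'"
proof -
  obtain K where K: "K \<subseteq> L" "card K = s" using many by (meson obtain_subset_with_card_n)
  have "K \<subseteq> A" using K L by auto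
  then have "finite K" using A finite_subset by blast
  obtain x where "x \<in> L" using ne by blast
  then have "\<beta> \<le> m" using large[of x] bounded[of x] L by simp
  then have "\<beta> \<le> card K * \<Delta>" using m_le K(2) by simp
  then obtain t where t: "\<forall>v\<in>K. t v \<le> \<Delta>" "sum t K = \<beta>"
    using ex_bounded_distribution[OF \<open>finite K\<close>] by blast
  define u' where "u' v = (if v \<in> K then u v - t v else u v)" for v
  have "t v \<le> u v" if "v \<in> K" for v
    using that K(1) large[of v] t(2) member_le_sum[of v K t] \<open>finite K\<close> by auto
  then have "u v = u' v + (if v \<in> K then t v else 0)" for v by (simp add: u'_def)
  note u_eq = this
  have "sum u A = sum u' A + (\<Sum>v\<in>A. if v \<in> K then t v else 0)"
    by (simp add: u_eq sum.distrib[symmetric])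
  also have "(\<Sum>v\<in>A. if v \<in> K then t v else 0) = sum t K"
    using A \<open>K \<subseteq> A\<close> by (simp add: sum.inter_restrict[symmetric] Int_absorb1)
  finally have sum_u: "sum u A = sum u' A + \<beta>" using t(2) by simp
  have "pot A u d = pot A u' d + \<rho> ^ i * real \<beta>"
    by (rule pot_diff_at_level[OF _ _ sum_u]) (use K L in \<open>auto simp: u'_def split: if_splits\<close>)
  then have "threshold i - real b * \<rho> ^ i \<le> pot A u' d"
    using funded i by (simp add: funded_def algebra_simps)
  moreover have "alive_sound (A - K) i u' d"
    using alive by (auto simp: alive_sound_def u'_def)
  moreover have "sound (u' v + \<Delta>) (d v) \<and> d v = i" if "v \<in> K" for v
  proof -
    have "sound (u v) (d v)" "d v = i" using that K L alive by (auto simp: alive_sound_def)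
    moreover have "u v \<le> u' v + \<Delta>" using u_eq[of v] t(1) that by simp
    ultimately show ?thesis by (simp add: sound_def)
  qed
  ultimately have "tight A i K u' d" using i K \<open>K \<subseteq> A\<close> unfolding tight_def by blast
  then have "spends A d \<beta> u u'" using sum_u by (auto simp: spends_def stable_def u'_def)
  then show ?thesis by blast
qed

lemma ex_lowest_level:
  assumes A: "finite A" and alive: "alive_sound A i u d" and x: "x \<in> A" "u x > 0" "Suc (d x) < k"
  obtains j where "i \<le> j" "Suc j < k" "alive_sound A j u d" "\<exists>v\<in>A. u v > 0 \<and> d v = j"
proof -
  define B where "B = {v \<in> A. u v > 0}"
  have B: "finite B" "B \<noteq> {}" using A x by (auto simp: B_def)
  define j where "j = Min (d ` B)"
  have "j \<in> d ` B" unfolding j_def using B by (intro Min_in) auto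
  moreover have "j \<le> d v" if "v \<in> A" "u v > 0" for v
    unfolding j_def using B that by (auto simp: B_def)
  ultimately have "i \<le> j" "alive_sound A j u d" "\<exists>v\<in>A. u v > 0 \<and> d v = j" "j \<le> d x"
    using alive x by (auto simp: alive_sound_def B_def)
  then show thesis using that x(3) by fastforce
qed

lemma spends_kill:
  assumes "spends A d (\<beta> - u x) (u(x := 0)) u'" "finite A" "x \<in> A" "u x \<le> \<beta>"
  shows "spends A d \<beta> u u'"
proof -
  have "sum u A = u x + sum (u(x := 0)) A" using assms(2,3) by (simp add: sum.remove)
  moreover have "u' v \<le> u v" if "v \<in> A" for v
    using assms(1) that unfolding spends_def by (cases "v = x") force+
  ultimately show ?thesis using assms(1,4) by (auto simp: spends_def)
qed

lemma alive_sound_kill: "alive_sound A i u d \<Longrightarrow> alive_sound A i (u(x := 0)) d"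
  by (auto simp: alive_sound_def)

lemma funded_pot_kill:
  assumes "funded i \<beta> (pot A u d)" "Suc i < k" "finite A" "x \<in> A" "d x = i" "u x \<le> \<beta>"
  shows "funded i (\<beta> - u x) (pot A (u(x := 0)) d)"
proof -
  have "pot A u d = pot A (u(x := 0)) d + \<rho> ^ i * real (u x)"
    using assms(3-5) by (intro pot_diff_at_level) (auto simp: sum.remove split: if_splits)
  then show ?thesis using assms(1,2,6) funded_kill by simp
qed

lemma ex_spends_or_kill:
  assumes A: "finite A" and bounded: "\<And>v. v \<in> A \<Longrightarrow> u v \<le> m" and alive: "alive_sound A i u d"
    and funded: "funded i \<beta> (pot A u d)" and "\<beta> \<le> b"
  shows "(\<exists>u'. spends A d \<beta> u u') \<or> (\<exists>x\<in>A. \<exists>j. 0 < u x \<and> u x \<le> \<beta> \<and>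
    alive_sound A j (u(x := 0)) d \<and> funded j (\<beta> - u x) (pot A (u(x := 0)) d))"
proof (cases "\<exists>v\<in>A. u v > 0 \<and> Suc (d v) < k")
  case False
  then have "spends A d \<beta> u u"
    using funded by (auto simp: spends_def exhausted_def funded_def not_less)
  then show ?thesis by blast
next
  case True
  then obtain j where j: "i \<le> j" "Suc j < k" "alive_sound A j u d" "\<exists>v\<in>A. u v > 0 \<and> d v = j"
    using ex_lowest_level[OF A alive] by metis
  have funded_j: "funded j \<beta> (pot A u d)" using funded_higher_level funded \<open>\<beta> \<le> b\<close> j(1,2) by blast
  define L where "L = {v \<in> A. u v > 0 \<and> d v = j}"
  obtain y where "y \<in> L" using j(4) by (auto simp: L_def)
  consider (kill) x where "x \<in> L" "u x \<le> \<beta>" | (few) "card L \<le> s" "\<forall>v\<in>L. \<beta> < u v"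
    | (many) "s \<le> card L" "\<forall>v\<in>L. \<beta> < u v" by (meson nle_le not_le)
  then show ?thesis
  proof cases
    case kill
    then have x: "x \<in> A" "u x > 0" "d x = j" by (auto simp: L_def)
    then show ?thesis
      using alive_sound_kill[OF j(3)] funded_pot_kill[OF funded_j j(2) A x(1,3) kill(2)] kill(2)
      by blast
  next
    case few
    then have "\<beta> < u y" using \<open>y \<in> L\<close> by blast
    with \<open>y \<in> L\<close> show ?thesis
      using spends_if_few_lowest[OF A bounded j(3) funded_j j(2) L_def few(1)] by blast
  next
    case many
    then have "\<exists>u'. spends A d \<beta> u u'"
      using \<open>y \<in> L\<close>
      by (intro ex_spends_if_many_lowest[OF A bounded j(3) funded_j j(2) L_def]) auto
    then show ?thesis by blast
  qed
qed

lemma ex_spends: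
  assumes "finite A" "\<And>v. v \<in> A \<Longrightarrow> u v \<le> m" "alive_sound A i u d"
    and "funded i \<beta> (pot A u d)" "\<beta> \<le> b"
  shows "\<exists>u'. spends A d \<beta> u u'"
  using assms(2-)
proof (induction "card {v \<in> A. u v > 0}" arbitrary: u i \<beta> rule: less_induct)
  case less
  show ?case
  proof (rule ccontr)
    assume none: "\<not> ?case"
    then obtain x j where x: "x \<in> A" "0 < u x" "u x \<le> \<beta>"
      and j: "alive_sound A j (u(x := 0)) d" "funded j (\<beta> - u x) (pot A (u(x := 0)) d)"
      using ex_spends_or_kill[OF assms(1) less.prems] by blast
    have fewer: "card {v \<in> A. (u(x := 0)) v > 0} < card {v \<in> A. u v > 0}"
      using assms(1) x(1,2) by (intro psubset_card_mono) auto
    have "(u(x := 0)) v \<le> m" if "v \<in> A" for v using less.prems(1)[OF that] by simp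
    moreover have "\<beta> - u x \<le> b" using less.prems(4) by simp
    ultimately obtain u' where "spends A d (\<beta> - u x) (u(x := 0)) u'"
      using less.hyps[OF fewer _ j] by blast
    from spends_kill[OF this assms(1) x(1,3)] show False using none by blast
  qed
qed

lemma ex_spends_killing:
  assumes "finite A" "\<And>v. v \<in> A \<Longrightarrow> u v \<le> m" and K: "K \<subseteq> A" "sum u K \<le> \<beta>" and "\<beta> \<le> b"
    and "alive_sound (A - K) i u d" "funded i (\<beta> - sum u K) (pot (A - K) u d)"
  shows "\<exists>u'. spends A d \<beta> u u'"
proof -
  define w where "w v = (if v \<in> K then 0 else u v)" for v
  have "sum w A = sum w (A - K)"
    using assms(1) K(1) by (subst sum.subset_diff[of K]) (auto simp: w_def)
  also have "\<dots> = sum u (A - K)" by (intro sum.cong) (auto simp: w_def)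
  finally have "sum u A = sum w A + sum u K"
    using assms(1) K(1) by (simp add: sum.subset_diff[of K A])
  note sum_u = this
  have "pot A w d = pot (A - K) w d"
    unfolding pot_def using assms(1) K(1) by (subst sum.subset_diff[of K]) (auto simp: w_def)
  also have "\<dots> = pot (A - K) u d" unfolding pot_def by (intro sum.cong) (auto simp: w_def)
  finally have "funded i (\<beta> - sum u K) (pot A w d)" using assms(7) by simp
  moreover have "alive_sound A i w d" using assms(6) by (auto simp: alive_sound_def w_def)
  ultimately obtain u' where u': "spends A d (\<beta> - sum u K) w u'"
    using ex_spends[OF assms(1), of w i d "\<beta> - sum u K"] assms(2,5) unfolding w_def by fastforce
  have "u' v \<le> u v" if "v \<in> A" for v
    using u' that unfolding spends_def w_def by (cases "v \<in> K") force+
  then have "spends A d \<beta> u u'" using u' sum_u K(2) by (auto simp: spends_def)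
  then show ?thesis by blast
qed

lemma ex_spends_surplus:
  assumes "finite A" "\<And>v. v \<in> A \<Longrightarrow> u v \<le> m" "surplus A i K u d" "sum u K \<le> \<beta>" "\<beta> \<le> b"
  shows "\<exists>u'. spends A d \<beta> u u'"
proof (rule ex_spends_killing[OF assms(1,2) _ assms(4,5)])
  show "K \<subseteq> A" "alive_sound (A - K) i u d" using assms(3) by (auto simp: surplus_def)
  show "funded i (\<beta> - sum u K) (pot (A - K) u d)"
    using assms(3,5) by (intro funded_if_threshold_le) (auto simp: surplus_def)
qed

subsection \<open>Avoider's move\<close>

lemma sound_raise:
  assumes "sound (u + y) d" "y \<le> (u - u') * \<Delta>" "u' \<le> u" "d + (u - u') \<le> d'"
  shows "sound u' d'"
proof -
  obtain x where x: "u = u' + x" using assms(3) le_Suc_ex by blast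
  have "(d + x) * (\<Delta> + 1) \<le> d' * (\<Delta> + 1)" using assms(4) x by (intro mult_le_mono1) simp
  moreover have "(d + x) * (\<Delta> + 1) = d * (\<Delta> + 1) + x * \<Delta> + x" by (simp add: algebra_simps)
  ultimately show ?thesis using assms(1,2) x unfolding sound_def by simp
qed

lemma sound_ge:
  assumes "sound u d" "d < k"
  shows "\<mu> \<le> u"
proof -
  have "d * (\<Delta> + 1) \<le> (k - 1) * (\<Delta> + 1)" using assms(2) by (intro mult_le_mono1) simp
  then show ?thesis using assms(1) margin unfolding sound_def by linarith
qed

lemma raise_gain:
  assumes "sound u' d'" "d' < k" "u' \<le> u" "d + (u - u') \<le> d'"
  shows "\<rho> ^ d * (real u + real (u - u') * real b) \<le> \<rho> ^ d' * real u'"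
proof -
  define x where "x = u - u'"
  have "(\<rho> - 1) * real \<mu> \<le> (\<rho> - 1) * real u'"
    using sound_ge[OF assms(1,2)] \<rho>_ge_1 by (intro mult_left_mono) auto
  then have gain: "real b + 1 \<le> (\<rho> - 1) * real u'" using \<rho>_gain by linarith
  have "real u + real x * real b = real u' + real x * (real b + 1)"
    using assms(3) by (simp add: x_def of_nat_diff algebra_simps)
  also have "\<dots> \<le> real u' + real x * ((\<rho> - 1) * real u')"
    by (intro add_left_mono mult_left_mono gain) simp
  also have "\<dots> = (1 + real x * (\<rho> - 1)) * real u'" by (simp add: algebra_simps)
  also have "\<dots> \<le> \<rho> ^ x * real u'"
    using Bernoulli_inequality[of "\<rho> - 1" x] \<rho>_ge_1 by (intro mult_right_mono) auto
  finally have "\<rho> ^ d * (real u + real x * real b) \<le> \<rho> ^ d * (\<rho> ^ x * real u')"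
    using \<rho>_pos by (intro mult_left_mono) auto
  also have "\<dots> = \<rho> ^ (d + x) * real u'" by (simp add: power_add)
  also have "\<dots> \<le> \<rho> ^ d' * real u'"
    using assms(4) \<rho>_ge_1 by (intro mult_right_mono power_increasing) (auto simp: x_def)
  finally show ?thesis by (simp add: x_def)
qed

lemma alive_sound_raise:
  assumes "alive_sound A i u d" "raises A u d u' d'"
  shows "alive_sound A i u' d'" "pot A u d \<le> pot A u' d'"
proof -
  have raise: "u' v \<le> u v" "d v + (u v - u' v) \<le> d' v" "d' v < k" if "v \<in> A" for v
    using assms(2) that by (auto simp: raises_def)
  have sound: "sound (u' v) (d' v)" "i \<le> d v" if "v \<in> A" "u v > 0" for v
    using assms(1) that raise[OF that(1)] sound_raise[of "u v" 0 "d v" "u' v" "d' v"]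
    by (auto simp: alive_sound_def)
  show "alive_sound A i u' d'"
    unfolding alive_sound_def using sound raise by (meson add_leE le_less_trans not_le order.trans)
  show "pot A u d \<le> pot A u' d'"
    unfolding pot_def
  proof (intro sum_mono)
    fix v assume v: "v \<in> A"
    show "\<rho> ^ d v * real (u v) \<le> \<rho> ^ d' v * real (u' v)"
    proof (cases "u v > 0")
      case True
      have "\<rho> ^ d v * real (u v) \<le> \<rho> ^ d v * (real (u v) + real (u v - u' v) * real b)"
        using \<rho>_pos by (intro mult_left_mono) auto
      also have "\<dots> \<le> \<rho> ^ d' v * real (u' v)"
        using raise_gain[OF sound(1)[OF v True] raise(3,1,2)[OF v]] .
      finally show ?thesis .
    qed (use \<rho>_pos in simp)
  qed
qed

lemma surplus_raise:
  assumes "surplus A i K u d" "raises A u d u' d'"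
  shows "surplus A i K u' d'"
proof -
  have "raises (A - K) u d u' d'" using assms(2) by (auto simp: raises_def)
  then show ?thesis
    using assms(1) alive_sound_raise[of "A - K" i u d u' d'] by (auto simp: surplus_def)
qed

lemma tight_raise_alive_sound:
  assumes "tight A i K u d" "raises A u d u' d'" "v \<in> A" "u v > 0" "v \<in> K \<Longrightarrow> u' v \<noteq> u v"
  shows "sound (u' v) (d' v) \<and> i \<le> d v"
proof -
  have raise: "u' v \<le> u v" "d v + (u v - u' v) \<le> d' v" using assms(2,3) by (auto simp: raises_def)
  show ?thesis
  proof (cases "v \<in> K")
    case True
    then have "1 \<le> u v - u' v" using assms(5) raise(1) by simp
    then have "\<Delta> \<le> (u v - u' v) * \<Delta>" using mult_le_mono1[of 1 "u v - u' v" \<Delta>] by simp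
    moreover have "sound (u v + \<Delta>) (d v)" "d v = i"
      using True assms(1,4) by (auto simp: tight_def)
    ultimately show ?thesis using sound_raise raise by blast
  next
    case False
    then have "sound (u v + 0) (d v)" "i \<le> d v"
      using assms(1,3,4) by (auto simp: tight_def alive_sound_def)
    then show ?thesis using sound_raise[OF _ _ raise, of 0] by simp
  qed
qed

lemma tight_raise_pot:
  assumes A: "finite A" and tight: "tight A i K u d" and raises: "raises A u d u' d'"
    and K': "K' = {v \<in> K. u' v = u v}"
  shows "pot A u d + real (sum u A - sum u' A) * (real b * \<rho> ^ i)
    \<le> pot (A - K') u' d' + real (sum u' K') * \<rho> ^ i"
proof -
  have raise: "u' v \<le> u v" "d v + (u v - u' v) \<le> d' v" "d' v < k" if "v \<in> A" for v
    using raises that by (auto simp: raises_def)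
  have "K' \<subseteq> A" using tight K' by (auto simp: tight_def)
  have gain: "\<rho> ^ d v * real (u v) + real (u v - u' v) * (real b * \<rho> ^ i)
      \<le> (if v \<in> K' then real (u' v) * \<rho> ^ i else \<rho> ^ d' v * real (u' v))" if v: "v \<in> A" for v
  proof (cases "u v > 0 \<and> v \<notin> K'")
    case True
    then have sound: "sound (u' v) (d' v)" "i \<le> d v"
      using tight_raise_alive_sound[OF tight raises v] K' by auto
    have "real (u v - u' v) * (real b * \<rho> ^ i) \<le> real (u v - u' v) * (real b * \<rho> ^ d v)"
      using sound(2) \<rho>_ge_1 by (intro mult_left_mono power_increasing) auto
    then have "\<rho> ^ d v * real (u v) + real (u v - u' v) * (real b * \<rho> ^ i)
        \<le> \<rho> ^ d v * (real (u v) + real (u v - u' v) * real b)" by (simp add: algebra_simps)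
    also have "\<dots> \<le> \<rho> ^ d' v * real (u' v)" by (rule raise_gain[OF sound(1) raise(3,1,2)[OF v]])
    finally show ?thesis using True by simp
  next
    case False
    then show ?thesis
      using raise(1)[OF v] tight K' \<rho>_pos by (cases "u v = 0") (auto simp: tight_def)
  qed
  have "real (sum u A - sum u' A) = (\<Sum>v\<in>A. real (u v - u' v))"
    using raise(1) by (subst sum_subtractf_nat[symmetric]) (auto simp only: of_nat_sum)
  then have "pot A u d + real (sum u A - sum u' A) * (real b * \<rho> ^ i)
      = (\<Sum>v\<in>A. \<rho> ^ d v * real (u v) + real (u v - u' v) * (real b * \<rho> ^ i))"
    by (simp add: pot_def sum.distrib sum_distrib_right)
  also have "\<dots> \<le> (\<Sum>v\<in>A. if v \<in> K' then real (u' v) * \<rho> ^ i else \<rho> ^ d' v * real (u' v))"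
    by (intro sum_mono gain)
  also have "\<dots> = (\<Sum>v\<in>K'. real (u' v) * \<rho> ^ i) + pot (A - K') u' d'"
    using A \<open>K' \<subseteq> A\<close> by (simp add: sum.If_cases Int_absorb1 pot_def Diff_eq)
  finally show ?thesis by (simp add: sum_distrib_right)
qed

lemma ex_spends_tight:
  assumes A: "finite A" "\<And>v. v \<in> A \<Longrightarrow> u' v \<le> m" and tight: "tight A i K u d"
    and raises: "raises A u d u' d'" and move: "sum u' A < sum u A"
  shows "\<exists>w. spends A d' b u' w"
proof -
  define K' where "K' = {v \<in> K. u' v = u v}"
  have K: "K \<subseteq> A" "card K \<le> s" "Suc i < k" using tight by (auto simp: tight_def)
  then have "finite K" using A(1) finite_subset by blast
  then have "card K' \<le> s" using K(2) card_mono[of K K'] by (auto simp: K'_def)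
  moreover have "u' v \<le> m" if "v \<in> K'" for v using A(2)[of v] K(1) that by (auto simp: K'_def)
  ultimately have "sum u' K' \<le> s * m" by (rule sum_le_budget)
  then have cost: "sum u' K' \<le> b" using sm_le by simp
  show ?thesis
  proof (rule ex_spends_killing[OF A _ cost order.refl])
    show "K' \<subseteq> A" using K(1) by (auto simp: K'_def)
    show "alive_sound (A - K') i u' d'"
      unfolding alive_sound_def
    proof (intro ballI impI)
      fix v assume v: "v \<in> A - K'" "u' v > 0"
      then have "u' v \<le> u v" "d v \<le> d' v" using raises by (auto simp: raises_def dest: add_leD1)
      then show "sound (u' v) (d' v) \<and> i \<le> d' v"
        using tight_raise_alive_sound[OF tight raises, of v] v by (auto simp: K'_def)
    qed
    have "1 \<le> sum u A - sum u' A" using move by simp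
    then have "1 \<le> real (sum u A - sum u' A)" by (metis of_nat_1 of_nat_le_iff)
    moreover have "0 \<le> real b * \<rho> ^ i" using \<rho>_pos by simp
    ultimately have "1 * (real b * \<rho> ^ i) \<le> real (sum u A - sum u' A) * (real b * \<rho> ^ i)"
      by (rule mult_right_mono)
    moreover have "threshold i - real b * \<rho> ^ i \<le> pot A u d" using tight by (simp add: tight_def)
    ultimately have "threshold i - real (sum u' K') * \<rho> ^ i \<le> pot (A - K') u' d'"
      using tight_raise_pot[OF A(1) tight raises K'_def] by linarith
    then show "funded i (b - sum u' K') (pot (A - K') u' d')"
      using K(3) cost by (intro fundedI) (auto simp: of_nat_diff)
  qed
qed

lemma stable_reply:
  assumes "finite A" "\<And>v. v \<in> A \<Longrightarrow> u' v \<le> m" "stable A u d" "raises A u d u' d'"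
    and "sum u' A < sum u A"
  shows "\<exists>w. spends A d' b u' w"
proof -
  from assms(3) consider i K where "tight A i K u d" | i K where "surplus A i K u d"
    by (auto simp: stable_def)
  then show ?thesis
  proof cases
    case 1
    then show ?thesis using ex_spends_tight[OF assms(1,2) _ assms(4,5)] by blast
  next
    case (2 i K)
    then have surplus: "surplus A i K u' d'" using surplus_raise assms(4) by blast
    then have "sum u' K \<le> s * m"
      using assms(2) by (intro sum_le_budget) (auto simp: surplus_def)
    then show ?thesis using ex_spends_surplus[OF assms(1,2) surplus] sm_le by simp
  qed
qed

lemma stable_pot_ge:
  assumes "finite A" "stable A u d"
  shows "threshold (k - 1) \<le> pot A u d"
proof -
  from assms(2) consider i K where "tight A i K u d" | i K where "surplus A i K u d"
    by (auto simp: stable_def)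
  then show ?thesis
  proof cases
    case (1 i K)
    then have "threshold (k - 1) \<le> threshold i - real b * \<rho> ^ i"
      by (intro threshold_less) (auto simp: tight_def)
    then show ?thesis using 1 by (simp add: tight_def)
  next
    case (2 i K)
    then have "threshold (k - 1) \<le> threshold i"
      by (intro threshold_antimono) (auto simp: surplus_def)
    moreover have "pot (A - K) u d \<le> pot A u d" using assms(1) by (intro pot_mono) auto
    ultimately show ?thesis using 2 by (simp add: surplus_def)
  qed
qed

end

section \<open>Enforcer's strategy between two sets of vertices\<close>

definition doomed :: "nat \<Rightarrow> nat set set \<Rightarrow> nat set set \<Rightarrow> bool" where
  "doomed k G U \<longleftrightarrow> (\<forall>e\<in>U. \<exists>v\<in>e. k \<le> Suc (deg G v))"

lemma doomed_antimono: "doomed k G U \<Longrightarrow> U' \<subseteq> U \<Longrightarrow> doomed k G U'"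
  by (auto simp: doomed_def)

lemma doomed_move:
  assumes "doomed k G U" and pos: "position (complete_edges n) G U" and S: "S \<subseteq> U" "S \<noteq> {}"
  shows "\<exists>v. k \<le> deg (G \<union> S) v"
proof -
  obtain e v where e: "e \<in> S" "v \<in> e" "k \<le> Suc (deg G v)"
    using assms(1) S by (meson doomed_def ex_in_conv subsetD)
  have "finite S" using S(1) position_complete_edges_finite(2)[OF pos] finite_subset by blast
  then have "deg {e} v \<le> deg S v" using e(1) by (intro deg_mono) auto
  moreover have "deg {e} v = 1" using deg_insert[of "{}" e v] e(2) by simp
  ultimately show ?thesis using deg_move[OF pos S(1), of v] e(3) by (intro exI[of _ v]) simp
qed

locale two_sided = level_potential k b s m M \<Delta> \<mu> \<rho> P0
  for k b s m M \<Delta> \<mu> :: nat and \<rho> P0 :: real +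
  fixes n :: nat and A D :: "nat set"
  assumes A_subset: "A \<subseteq> {..<n}" and D_subset: "D \<subseteq> {..<n}" and disjoint: "A \<inter> D = {}"
    and card_D_le: "card D \<le> m"
begin

definition cross :: "nat \<Rightarrow> nat set set" where
  "cross v = (\<lambda>w. {v, w}) ` D"

definition free :: "nat set set \<Rightarrow> nat \<Rightarrow> nat" where
  "free U v = card (U \<inter> cross v)"

definition all_cross :: "nat set set \<Rightarrow> bool" where
  "all_cross U \<longleftrightarrow> U \<subseteq> (\<Union>v\<in>A. cross v)"

definition safe :: "nat set set \<Rightarrow> nat set set \<Rightarrow> bool" where
  "safe G U \<longleftrightarrow> all_cross U \<and> stable A (free U) (deg G) \<or> surplus A 0 {} (free U) (deg G)"

definition good_reply :: "nat set set \<Rightarrow> nat set set \<Rightarrow> nat \<Rightarrow> nat set set \<Rightarrow> bool" where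
  "good_reply G U \<beta> T \<longleftrightarrow> T \<subseteq> U \<and> (card T = \<beta> \<and> safe G (U - T) \<or>
     card T \<le> \<beta> \<and> doomed k G (U - T) \<and> threshold (k - 1) \<le> \<rho> ^ (k - 1) * real (card (U - T)))"

lemma finite_A [simp]: "finite A" and finite_D [simp]: "finite D"
  using A_subset D_subset finite_subset by blast+

lemma finite_cross [simp]: "finite (cross v)"
  by (simp add: cross_def)

lemma cross_disjoint: "v \<in> A \<Longrightarrow> w \<in> A \<Longrightarrow> v \<noteq> w \<Longrightarrow> cross v \<inter> cross w = {}"
  using disjoint by (auto simp: cross_def doubleton_eq_iff)

lemma card_cross: "card (cross v) = card D"
  unfolding cross_def by (intro card_image) (auto simp: inj_on_def doubleton_eq_iff)

lemma cross_subset_complete_edges: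
  assumes "v \<in> A"
  shows "cross v \<subseteq> complete_edges n"
proof -
  have "v < n" "v \<notin> D" using assms A_subset disjoint by auto
  then show ?thesis using D_subset by (auto simp: cross_def doubleton_in_complete_edges_iff)
qed

lemma free_le: "free U v \<le> m"
proof -
  have "free U v \<le> card (cross v)" unfolding free_def by (intro card_mono) auto
  then show ?thesis using card_cross card_D_le by simp
qed

lemma card_Int_cross: "card (U \<inter> (\<Union>v\<in>A. cross v)) = sum (free U) A"
proof -
  have "U \<inter> (\<Union>v\<in>A. cross v) = (\<Union>v\<in>A. U \<inter> cross v)" by auto
  also have "card \<dots> = (\<Sum>v\<in>A. card (U \<inter> cross v))"
    using cross_disjoint by (intro card_UN_disjoint) fastforce+
  finally show ?thesis by (simp add: free_def)
qed

lemma card_all_cross: "all_cross U \<Longrightarrow> card U = sum (free U) A"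
  using card_Int_cross[of U] by (simp add: all_cross_def Int_absorb2)

lemma sum_free_le: "finite U \<Longrightarrow> sum (free U) A \<le> card U"
  using card_Int_cross[of U] card_mono[of U "U \<inter> (\<Union>v\<in>A. cross v)"] by simp

lemma free_Diff: "free (U - S) v = free U v - card (S \<inter> U \<inter> cross v)"
proof -
  have "(U - S) \<inter> cross v = U \<inter> cross v - S \<inter> U \<inter> cross v" by auto
  then show ?thesis unfolding free_def by (simp only:) (rule card_Diff_subset; auto)
qed

lemma ex_claim_with_free:
  assumes "\<And>v. v \<in> A \<Longrightarrow> u v \<le> free U v"
  obtains T where "T \<subseteq> U" "\<And>v. v \<in> A \<Longrightarrow> free (U - T) v = u v" "card T + sum u A = sum (free U) A"
proof -
  have "\<exists>T. T \<subseteq> U \<inter> cross v \<and> card T = free U v - u v" for v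
    by (metis diff_le_self free_def obtain_subset_with_card_n)
  then obtain t where t: "t v \<subseteq> U \<inter> cross v" "card (t v) = free U v - u v" for v by metis
  define T where "T = (\<Union>v\<in>A. t v)"
  have T: "T \<inter> U \<inter> cross v = t v" if "v \<in> A" for v
  proof -
    have "t w \<inter> cross v = {}" if "w \<in> A" "w \<noteq> v" for w
      using t(1)[of w] cross_disjoint[of w v] that \<open>v \<in> A\<close> by blast
    then show ?thesis using t(1)[of v] that unfolding T_def by blast
  qed
  have "T \<subseteq> U" "all_cross T" using t(1) unfolding T_def all_cross_def by blast+
  moreover have free: "free (U - T) v = u v" if "v \<in> A" for v
    using free_Diff[of U T v] T[OF that] t(2)[of v] assms[OF that] by simp
  moreover have "card T + sum u A = sum (free U) A"
  proof -
    have "free T v + u v = free U v" if "v \<in> A" for v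
    proof -
      have "T \<inter> cross v = t v" using T[OF that] \<open>T \<subseteq> U\<close> by blast
      then show ?thesis using t(2)[of v] assms[OF that] by (simp add: free_def)
    qed
    then have "sum (free U) A = (\<Sum>v\<in>A. free T v + u v)" by (intro sum.cong) auto
    then show ?thesis using card_all_cross[OF \<open>all_cross T\<close>] by (simp add: sum.distrib)
  qed
  ultimately show thesis using that by blast
qed

lemma exhausted_imp_doomed:
  assumes cross: "all_cross U" and exhausted: "exhausted A (free U) (deg G)"
    and deg: "\<And>v. deg G v < k"
  shows "doomed k G U" and "threshold (k - 1) \<le> \<rho> ^ (k - 1) * real (card U)"
proof -
  show "doomed k G U"
    unfolding doomed_def
  proof
    fix e assume e: "e \<in> U"
    then obtain v where v: "v \<in> A" "e \<in> cross v" using cross by (auto simp: all_cross_def)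
    then have "free U v > 0" using e by (auto simp: free_def card_gt_0_iff)
    then have "k \<le> Suc (deg G v)" using exhausted v(1) by (auto simp: exhausted_def)
    moreover have "v \<in> e" using v(2) by (auto simp: cross_def)
    ultimately show "\<exists>v\<in>e. k \<le> Suc (deg G v)" by blast
  qed
  have "threshold (k - 1) \<le> pot A (free U) (deg G)" using exhausted by (simp add: exhausted_def)
  also have "\<dots> \<le> \<rho> ^ (k - 1) * real (sum (free U) A)"
  proof (rule pot_le_power)
    show "deg G v \<le> k - 1" for v using deg[of v] by simp
  qed
  finally show "threshold (k - 1) \<le> \<rho> ^ (k - 1) * real (card U)"
    using card_all_cross[OF cross] by simp
qed

lemma spends_imp_good_reply:
  assumes cross: "all_cross U" and deg: "\<And>v. deg G v < k"
    and spends: "spends A (deg G) \<beta> (free U) u"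
  shows "\<exists>T. good_reply G U \<beta> T"
proof -
  obtain T where T: "T \<subseteq> U" "\<And>v. v \<in> A \<Longrightarrow> free (U - T) v = u v"
    "card T + sum u A = sum (free U) A"
    using spends ex_claim_with_free[of u U] unfolding spends_def by metis
  have cross': "all_cross (U - T)" using cross by (auto simp: all_cross_def)
  from spends consider (stable) "card T = \<beta>" "stable A u (deg G)"
    | (exhausted) "card T \<le> \<beta>" "exhausted A u (deg G)" using T(3) by (fastforce simp: spends_def)
  then have "good_reply G U \<beta> T"
  proof cases
    case stable
    have "stable A (free (U - T)) (deg G)"
      using stable(2) stable_cong[of A "free (U - T)" u] T(2) by blast
    then have "safe G (U - T)" using cross' by (simp add: safe_def)
    then show ?thesis using T(1) stable(1) by (simp add: good_reply_def)
  next
    case exhausted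
    have "exhausted A (free (U - T)) (deg G)"
      using exhausted(2) exhausted_cong[of A "free (U - T)" u] T(2) by blast
    then show ?thesis
      using exhausted_imp_doomed[OF cross' _ deg] T(1) exhausted(1) by (simp add: good_reply_def)
  qed
  then show ?thesis by blast
qed

text \<open>Edges that do not join the two sides are the first that Enforcer claims.\<close>

lemma surplus_imp_good_reply:
  assumes "finite U" and surplus: "surplus A 0 {} (free U) (deg G)" and deg: "\<And>v. deg G v < k"
    and "\<beta> \<le> b"
  shows "\<exists>T. good_reply G U \<beta> T"
proof -
  define Q where "Q = U - (\<Union>v\<in>A. cross v)"
  have "Q \<subseteq> U" by (auto simp: Q_def)
  then have "finite Q" using assms(1) finite_subset by blast
  have surplus_Diff: "surplus A 0 {} (free (U - Q')) (deg G)" if "Q' \<subseteq> Q" for Q'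
  proof -
    have "free (U - Q') v = free U v" if "v \<in> A" for v
    proof -
      have "Q' \<inter> U \<inter> cross v = {}" using that \<open>Q' \<subseteq> Q\<close> by (auto simp: Q_def)
      then show ?thesis by (simp add: free_Diff)
    qed
    then show ?thesis using surplus surplus_cong by blast
  qed
  show ?thesis
  proof (cases "\<beta> \<le> card Q")
    case True
    then obtain T where "T \<subseteq> Q" "card T = \<beta>" by (meson obtain_subset_with_card_n)
    then have "good_reply G U \<beta> T"
      using surplus_Diff \<open>Q \<subseteq> U\<close> by (auto simp: good_reply_def safe_def)
    then show ?thesis by blast
  next
    case False
    have "all_cross (U - Q)" by (auto simp: all_cross_def Q_def)
    moreover have "\<exists>u. spends A (deg G) (\<beta> - card Q) (free (U - Q)) u"
      using \<open>\<beta> \<le> b\<close> free_le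
      by (intro ex_spends_surplus[OF finite_A _ surplus_Diff[OF order.refl]]) auto
    ultimately obtain T where T: "good_reply G (U - Q) (\<beta> - card Q) T"
      using spends_imp_good_reply deg by blast
    then have "T \<subseteq> U - Q" by (simp add: good_reply_def)
    then have "card (T \<union> Q) = card T + card Q"
      using assms(1) \<open>finite Q\<close> by (intro card_Un_disjoint) (auto intro: finite_subset)
    moreover have "U - Q - T = U - (T \<union> Q)" by auto
    ultimately have "good_reply G U \<beta> (T \<union> Q)"
      using T False \<open>Q \<subseteq> U\<close> by (auto simp: good_reply_def)
    then show ?thesis by blast
  qed
qed

lemma raises_move:
  assumes pos: "position (complete_edges n) G U" and S: "S \<subseteq> U" and deg: "\<And>v. deg (G \<union> S) v < k"
  shows "raises A (free U) (deg G) (free (U - S)) (deg (G \<union> S))"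
  unfolding raises_def
proof (intro ballI conjI)
  fix v
  have "finite S" using S position_complete_edges_finite(2)[OF pos] finite_subset by blast
  then have "card (S \<inter> U \<inter> cross v) \<le> deg S v"
    unfolding deg_def by (intro card_mono) (auto simp: cross_def)
  then show "deg G v + (free U v - free (U - S) v) \<le> deg (G \<union> S) v"
    using deg_move[OF pos S, of v] by (simp add: free_Diff)
  show "free (U - S) v \<le> free U v" by (simp add: free_Diff)
qed (rule deg)

lemma safe_imp_good_reply:
  assumes pos: "position (complete_edges n) G U" and safe: "safe G U"
    and S: "S \<subseteq> U" "S \<noteq> {}" and deg: "\<And>v. deg (G \<union> S) v < k"
  shows "\<exists>T. good_reply (G \<union> S) (U - S) b T"
proof -
  have fin: "finite U" using position_complete_edges_finite[OF pos] by simp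
  note raises = raises_move[OF pos S(1) deg]
  from safe consider (cross) "all_cross U" "stable A (free U) (deg G)"
    | (surplus) "surplus A 0 {} (free U) (deg G)" by (auto simp: safe_def)
  then show ?thesis
  proof cases
    case cross
    then have cross': "all_cross (U - S)" by (auto simp: all_cross_def)
    have "card (U - S) < card U" using S fin by (intro psubset_card_mono) auto
    then have "sum (free (U - S)) A < sum (free U) A"
      using card_all_cross[OF cross(1)] card_all_cross[OF cross'] by simp
    then have "\<exists>u. spends A (deg (G \<union> S)) b (free (U - S)) u"
      using free_le by (intro stable_reply[OF finite_A _ cross(2) raises]) auto
    then show ?thesis using spends_imp_good_reply[OF cross' deg] by blast
  next
    case surplus
    then have "surplus A 0 {} (free (U - S)) (deg (G \<union> S))" using surplus_raise raises by blast
    then show ?thesis using fin deg by (intro surplus_imp_good_reply) auto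
  qed
qed

lemma safe_pot_ge: "safe G U \<Longrightarrow> threshold (k - 1) \<le> pot A (free U) (deg G)"
  unfolding safe_def using stable_pot_ge[OF finite_A] surplus_imp_stable by blast

lemma safe_nonempty: "safe G U \<Longrightarrow> threshold (k - 1) > 0 \<Longrightarrow> U \<noteq> {}"
  using safe_pot_ge[of G U] by (auto simp: pot_def free_def)

subsection \<open>The strict game\<close>

definition strict_inv :: "nat set set \<Rightarrow> nat set set \<Rightarrow> bool" where
  "strict_inv G U \<longleftrightarrow> full_rounds n b U \<and> U \<noteq> {} \<and> (safe G U \<or> doomed k G U)"

lemma strict_invI:
  assumes "full_rounds n b U" "finite U" "S \<subseteq> U" "card S = 1"
    and T: "T \<subseteq> U - S" "card T = b" "U - S - T \<noteq> {}" "safe G (U - S - T) \<or> doomed k G (U - S - T)"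
  shows "T \<in> strict_moves b (U - S) \<and> strict_inv G (U - S - T)"
proof -
  have fin: "finite (U - S)" "finite S" using assms(2,3) finite_subset by auto
  then have card: "card T \<le> card (U - S)" using T(1) by (intro card_mono)
  have "card (U - S - T) + card T = card (U - S)"
    using T(1) fin card by (simp add: card_Diff_subset finite_subset)
  moreover have "card (U - S) + card S = card U"
    using assms(2,3) fin card_mono[OF assms(2,3)] by (simp add: card_Diff_subset)
  ultimately have "card U = card (U - S - T) + (b + 1)" using assms(4) T(2) by simp
  then show ?thesis
    using T card full_rounds_round[OF assms(1)] by (simp add: strict_inv_def strict_moves_def)
qed

text \<open>If all unclaimed edges are doomed and at least \<open>star_rem n b\<close> of them are left, then Avoider
  has to claim one more of them.\<close>

lemma good_reply_imp_strict_inv: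
  assumes n: "n \<ge> 2" and rem: "real (star_rem n b) * \<rho> ^ (k - 1) \<le> threshold (k - 1)"
    and full: "full_rounds n b U" and fin: "finite U"
    and S: "S \<subseteq> U" "card S = 1" and good: "good_reply G (U - S) b T"
  shows "\<exists>T\<in>strict_moves b (U - S). strict_inv G (U - S - T)"
proof -
  have rem_pos: "0 < real (star_rem n b)" using star_rem_bounds(1)[OF n, of b] by simp
  have "T \<subseteq> U - S" using good by (simp add: good_reply_def)
  from good consider (safe) "card T = b" "safe G (U - S - T)"
    | (doomed) "card T \<le> b" "doomed k G (U - S - T)"
        "threshold (k - 1) \<le> \<rho> ^ (k - 1) * real (card (U - S - T))"
    by (auto simp: good_reply_def)
  then show ?thesis
  proof cases
    case safe
    have "0 < real (star_rem n b) * \<rho> ^ (k - 1)" using rem_pos \<rho>_pos by simp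
    then have "U - S - T \<noteq> {}" using safe_nonempty[OF safe(2)] rem by linarith
    then show ?thesis using strict_invI[OF full fin S \<open>T \<subseteq> U - S\<close>] safe by blast
  next
    case doomed
    have "real (star_rem n b) * \<rho> ^ (k - 1) \<le> real (card (U - S - T)) * \<rho> ^ (k - 1)"
      using doomed(3) rem by (simp add: mult.commute)
    then have "star_rem n b \<le> card (U - S - T)" using \<rho>_pos by (simp add: mult_le_cancel_right)
    moreover have "card (U - S - T) \<le> card (U - S)" using fin by (intro card_mono) auto
    moreover have "card U = Suc (card (U - S))"
      using S fin card_Diff_subset[of S U] card_mono[OF fin S(1)] finite_subset[OF S(1) fin] by simp
    ultimately have "b < card (U - S)" using less_card_if_star_rem_less_card[OF n full] by simp
    then obtain T' where T': "T \<subseteq> T'" "T' \<subseteq> U - S" "card T' = b"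
      using exists_subset_between[of T b "U - S"] doomed(1) \<open>T \<subseteq> U - S\<close> fin by auto
    then have "U - S - T' \<noteq> {}"
      using \<open>b < card (U - S)\<close> by (metis Diff_eq_empty_iff less_irrefl subset_antisym)
    moreover have "doomed k G (U - S - T')"
      by (rule doomed_antimono[OF doomed(2)]) (use T'(1) in blast)
    ultimately show ?thesis using strict_invI[OF full fin S T'(2,3)] by blast
  qed
qed

lemma strict_inv_step:
  assumes n: "n \<ge> 2" and rem: "real (star_rem n b) * \<rho> ^ (k - 1) \<le> threshold (k - 1)"
    and inv: "strict_inv G U" and pos: "position (complete_edges n) G U"
    and S: "S \<in> strict_moves 1 U" "S \<subseteq> U" "S \<noteq> {}" and deg: "\<And>v. deg (G \<union> S) v < k"
  shows "\<exists>T\<in>strict_moves b (U - S). strict_inv (G \<union> S) (U - S - T)"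
proof -
  have fin: "finite U" using position_complete_edges_finite[OF pos] by simp
  have "\<not> doomed k G U" using doomed_move[OF _ pos S(2,3)] deg by (meson not_le)
  then have "safe G U" using inv by (simp add: strict_inv_def)
  then obtain T where "good_reply (G \<union> S) (U - S) b T"
    using safe_imp_good_reply[OF pos _ S(2,3) deg] by blast
  moreover have "card S = 1"
    using S fin card_gt_0_iff[of U] by (auto simp: strict_moves_def)
  ultimately show ?thesis
    using good_reply_imp_strict_inv[OF n rem _ fin S(2)] inv by (auto simp: strict_inv_def)
qed

lemma enforcer_wins_strict:
  assumes "n \<ge> 2" "real (star_rem n b) * \<rho> ^ (k - 1) \<le> threshold (k - 1)"
    and "surplus A 0 {} (free (complete_edges n)) (deg {})"
  shows "wins_star_game Enforcer strict_moves k n b"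
proof (rule enforcer_wins_star_by_invariant[OF admissible_rule_strict, where I = strict_inv])
  have "card (complete_edges n) > 0" using assms(1) by (simp add: card_complete_edges)
  then have "complete_edges n \<noteq> {}" by auto
  then show "strict_inv {} (complete_edges n)"
    using assms(3) full_rounds_complete_edges by (simp add: strict_inv_def safe_def)
  show "\<exists>v. k \<le> deg G v" if "strict_inv G {}" for G using that by (simp add: strict_inv_def)
qed (use k_ge_2 strict_inv_step[OF assms(1,2)] in auto)

subsection \<open>The monotone game\<close>

text \<open>In the monotone game Enforcer may claim all edges but one as soon as some unclaimed edge
  meets a vertex of degree \<open>k - 1\<close>, so only states without such edges need a plan.\<close>

definition monotone_inv :: "nat set set \<Rightarrow> nat set set \<Rightarrow> bool" where
  "monotone_inv G U \<longleftrightarrow> U \<noteq> {} \<and>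
     (doomed k G U \<or> safe G U \<and> (\<forall>e\<in>U. \<forall>v\<in>e. Suc (deg G v) < k))"

lemma card_ge_if_low_degrees:
  assumes "safe G U" "finite U" and low: "\<And>e v. e \<in> U \<Longrightarrow> v \<in> e \<Longrightarrow> Suc (deg G v) < k"
  shows "threshold (k - 1) \<le> \<rho> ^ (k - 2) * real (card U)"
proof -
  have "pot A (free U) (deg G) \<le> \<rho> ^ (k - 2) * real (sum (free U) A)"
  proof (rule pot_le_power)
    fix v assume "free U v > 0"
    then obtain e where "e \<in> U" "e \<in> cross v"
      unfolding free_def by (metis IntD1 IntD2 card.empty ex_in_conv less_irrefl)
    then show "deg G v \<le> k - 2" using low[of e v] by (auto simp: cross_def)
  qed
  also have "\<dots> \<le> \<rho> ^ (k - 2) * real (card U)"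
    using sum_free_le[OF assms(2)] \<rho>_pos
    by (intro mult_left_mono) (auto simp only: of_nat_le_iff zero_le_power less_imp_le)
  finally show ?thesis using safe_pot_ge[OF assms(1)] by simp
qed

lemma card_after_move_ge:
  assumes large: "real (b + 1 + k * n) * \<rho> ^ (k - 2) \<le> threshold (k - 1)"
    and safe: "safe G U" and pos: "position (complete_edges n) G U" and S: "S \<subseteq> U"
    and low: "\<And>e v. e \<in> U \<Longrightarrow> v \<in> e \<Longrightarrow> Suc (deg G v) < k" and deg: "\<And>v. deg (G \<union> S) v < k"
  shows "b + 1 \<le> card (U - S)"
proof -
  have fin: "finite U" "finite S"
    using position_complete_edges_finite[OF pos] S finite_subset by auto
  have "threshold (k - 1) \<le> \<rho> ^ (k - 2) * real (card U)"
    using card_ge_if_low_degrees[OF safe fin(1)] low by blast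
  then have "real (b + 1 + k * n) * \<rho> ^ (k - 2) \<le> real (card U) * \<rho> ^ (k - 2)"
    using large by (simp add: mult.commute)
  then have "real (b + 1 + k * n) \<le> real (card U)"
    by (rule mult_right_le_imp_le) (use \<rho>_pos in simp)
  then have "b + 1 + k * n \<le> card U" by (simp only: of_nat_le_iff)
  moreover have "deg S v \<le> k" for v using deg_move[OF pos S, of v] deg[of v] by simp
  then have "2 * card S \<le> n * k"
    using pos S by (intro card_le_if_deg_le) (auto simp: position_def)
  ultimately show ?thesis using S fin by (simp add: card_Diff_subset mult.commute)
qed

lemma good_reply_imp_safe:
  assumes "good_reply G U \<beta> T" "threshold (k - 1) > 0"
    and low: "\<And>e v. e \<in> U \<Longrightarrow> v \<in> e \<Longrightarrow> Suc (deg G v) < k"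
  shows "T \<subseteq> U" "card T = \<beta>" "safe G (U - T)"
proof -
  have "\<not> (doomed k G (U - T) \<and> threshold (k - 1) \<le> \<rho> ^ (k - 1) * real (card (U - T)))"
  proof
    assume doomed: "doomed k G (U - T) \<and> threshold (k - 1) \<le> \<rho> ^ (k - 1) * real (card (U - T))"
    then have "card (U - T) \<noteq> 0" using assms(2) by (intro notI) simp
    then obtain e where e: "e \<in> U - T" by (metis card.empty ex_in_conv)
    then obtain v where "v \<in> e" "k \<le> Suc (deg G v)" using doomed by (auto simp: doomed_def)
    then show False using low[of e v] e by simp
  qed
  then show "T \<subseteq> U" "card T = \<beta>" "safe G (U - T)" using assms(1) by (auto simp: good_reply_def)
qed

lemma monotone_inv_step:
  assumes large: "real (b + 1 + k * n) * \<rho> ^ (k - 2) \<le> threshold (k - 1)"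
    and inv: "monotone_inv G U" and pos: "position (complete_edges n) G U"
    and S: "S \<subseteq> U" "S \<noteq> {}" and deg: "\<And>v. deg (G \<union> S) v < k"
  shows "\<exists>T\<in>monotone_moves b (U - S). monotone_inv (G \<union> S) (U - S - T)"
proof -
  have fin: "finite U" using position_complete_edges_finite[OF pos] by simp
  have "\<not> doomed k G U" using doomed_move[OF _ pos S] deg by (meson not_le)
  then have safe: "safe G U" and low: "\<And>e v. e \<in> U \<Longrightarrow> v \<in> e \<Longrightarrow> Suc (deg G v) < k"
    using inv by (auto simp: monotone_inv_def)
  show ?thesis
  proof (cases "\<exists>e\<in>U - S. \<exists>v\<in>e. k \<le> Suc (deg (G \<union> S) v)")
    case True
    then obtain e v where e: "e \<in> U - S" "v \<in> e" "k \<le> Suc (deg (G \<union> S) v)" by blast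
    have "b + 1 \<le> card (U - S)" using card_after_move_ge[OF large safe pos S(1) _ deg] low by blast
    then have "U - S - {e} \<in> monotone_moves b (U - S)"
      using e(1) fin by (auto simp: monotone_moves_def)
    moreover have "U - S - (U - S - {e}) = {e}" using e(1) by auto
    then have "monotone_inv (G \<union> S) (U - S - (U - S - {e}))"
      using e by (auto simp: monotone_inv_def doomed_def)
    ultimately show ?thesis by blast
  next
    case False
    have pos_threshold: "0 < threshold (k - 1)"
    proof -
      have "0 < real (b + 1 + k * n) * \<rho> ^ (k - 2)"
        using \<rho>_pos by (intro mult_pos_pos) (simp_all only: of_nat_0_less_iff zero_less_power)
      then show ?thesis using large by linarith
    qed
    obtain T where T: "good_reply (G \<union> S) (U - S) b T"
      using safe_imp_good_reply[OF pos safe S deg] by blast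
    have T': "T \<subseteq> U - S" "card T = b" "safe (G \<union> S) (U - S - T)"
      using good_reply_imp_safe[OF T pos_threshold] False by (auto simp: not_le)
    moreover have "U - S - T \<noteq> {}" using safe_nonempty T'(3) pos_threshold by blast
    ultimately have "monotone_inv (G \<union> S) (U - S - T)"
      using False by (auto simp: monotone_inv_def not_le)
    moreover have "T \<in> monotone_moves b (U - S)" using T' by (auto simp: monotone_moves_def)
    ultimately show ?thesis by blast
  qed
qed

lemma enforcer_wins_monotone:
  assumes "3 \<le> k" "2 \<le> n" "real (b + 1 + k * n) * \<rho> ^ (k - 2) \<le> threshold (k - 1)"
    and "surplus A 0 {} (free (complete_edges n)) (deg {})"
  shows "wins_star_game Enforcer monotone_moves k n b"
proof (rule enforcer_wins_star_by_invariant[OF admissible_rule_monotone, where I = monotone_inv])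
  have "card (complete_edges n) > 0" using assms(2) by (simp add: card_complete_edges)
  then have "complete_edges n \<noteq> {}" by auto
  then show "monotone_inv {} (complete_edges n)"
    using assms(1,4) by (simp add: monotone_inv_def safe_def)
  show "\<exists>v. k \<le> deg G v" if "monotone_inv G {}" for G using that by (simp add: monotone_inv_def)
qed (use assms(1) monotone_inv_step[OF assms(3)] in auto)

end

subsection \<open>Two blocks of equal size\<close>

locale two_blocks =
  fixes k n b m :: nat
  assumes k_ge_3: "k \<ge> 3" and m_ge: "8 * k \<le> m" and b_ge: "4 * k * m \<le> b" and n_ge: "2 * m \<le> n"
begin

definition ratio :: real where
  "ratio = 1 + real (b + 1) / real (m div 2)"

lemma b_ge_8m: "8 * m \<le> b"
proof -
  have "8 * m \<le> 4 * k * m" using k_ge_3 by (intro mult_le_mono1) simp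
  then show ?thesis using b_ge by (rule order.trans)
qed

lemma m_ge_24: "24 \<le> m"
  using k_ge_3 m_ge by simp

sublocale two_sided k b "4 * k" m m "m div (4 * k) + 1" "m div 2"
  ratio "real m ^ 2" n "{..<m}" "{m..<2 * m}"
proof
  show "m \<le> 4 * k * (m div (4 * k) + 1)"
    using k_ge_3 dividend_less_div_times[of "4 * k" m] by (simp add: mult.commute)
  have "4 * ((k - 1) * (m div (4 * k))) \<le> 4 * k * (m div (4 * k))" by simp
  also have "\<dots> \<le> m" by simp
  finally show "(k - 1) * (m div (4 * k) + 1 + 1) + m div 2 \<le> m"
    using m_ge k_ge_3 by (simp add: algebra_simps)
  show "real b + 1 \<le> (ratio - 1) * real (m div 2)" using m_ge_24 by (simp add: ratio_def)
qed (use k_ge_3 b_ge n_ge in \<open>auto simp: ratio_def\<close>)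

lemma surplus_initial: "surplus {..<m} 0 {} (free (complete_edges n)) (deg {})"
proof -
  have "free (complete_edges n) v = m" if "v < m" for v
  proof -
    have "free (complete_edges n) v = card (cross v)"
      using cross_subset_complete_edges[of v] that by (simp add: free_def Int_absorb1)
    then show ?thesis using card_cross by simp
  qed
  then show ?thesis
    unfolding surplus_def alive_sound_def sound_def pot_def threshold_0
    using k_ge_3 by (auto simp: power2_eq_square)
qed

lemma ratio_le: "ratio \<le> 5 * real b / real m"
proof -
  have "real m / 3 \<le> real (m div 2)" using m_ge_24 by linarith
  then have "real (b + 1) / real (m div 2) \<le> real (b + 1) / (real m / 3)"
    using m_ge_24 by (intro divide_left_mono) auto
  then have "ratio \<le> 1 + 3 * real (b + 1) / real m" by (simp add: ratio_def mult.commute)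
  also have "\<dots> = (real m + 3 * real b + 3) / real m" using m_ge_24 by (simp add: field_simps)
  also have "\<dots> \<le> 5 * real b / real m" using b_ge_8m m_ge_24 by (intro divide_right_mono) auto
  finally show ?thesis .
qed

lemma ratio_power_le: "ratio ^ i \<le> (5 * real b / real m) ^ i"
  using ratio_le \<rho>_pos by (intro power_mono) auto

lemma threshold_ge_blocks: "real m ^ 2 - real m * ratio ^ i \<le> threshold i"
proof -
  have "real (b + 4 * k * m) \<le> real (2 * (b + 1))" unfolding of_nat_le_iff using b_ge by simp
  then have "real m ^ 2 - 2 * real (m div 2) * ratio ^ i \<le> threshold i"
    using m_ge_24 by (intro threshold_ge[OF ratio_def]) auto
  moreover have "2 * real (m div 2) * ratio ^ i \<le> real m * ratio ^ i"
    using \<rho>_pos by (intro mult_right_mono) auto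
  ultimately show ?thesis by linarith
qed

lemma enforcer_wins_strict_blocks:
  assumes "2 * real b * (5 * real b / real m) ^ (k - 1) \<le> real m ^ 2"
  shows "wins_star_game Enforcer strict_moves k n b"
proof (rule enforcer_wins_strict[OF _ _ surplus_initial])
  show "n \<ge> 2" using m_ge_24 n_ge by simp
  then have "star_rem n b \<le> b + 1" by (rule star_rem_bounds)
  then have "real (star_rem n b) + real m \<le> 2 * real b" using b_ge_8m m_ge_24 by simp
  then have "(real (star_rem n b) + real m) * ratio ^ (k - 1)
      \<le> 2 * real b * (5 * real b / real m) ^ (k - 1)"
    using ratio_power_le \<rho>_pos by (intro mult_mono) auto
  then show "real (star_rem n b) * ratio ^ (k - 1) \<le> threshold (k - 1)"
    using threshold_ge_blocks[of "k - 1"] assms by (simp add: algebra_simps)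
qed

lemma enforcer_wins_monotone_blocks:
  assumes "2 * (5 * real b / real m) ^ (k - 1) \<le> real m" "k * n \<le> b"
  shows "wins_star_game Enforcer monotone_moves k n b"
proof (rule enforcer_wins_monotone[OF k_ge_3 _ _ surplus_initial])
  show "n \<ge> 2" using m_ge_24 n_ge by simp
  have "real (b + 1) = (ratio - 1) * real (m div 2)" using m_ge_24 by (simp add: ratio_def)
  also have "\<dots> \<le> ratio * (real m / 2)" using \<rho>_ge_1 by (intro mult_mono) auto
  finally have "2 * real (b + 1) \<le> ratio * real m" by simp
  moreover have "real (b + 1 + k * n) \<le> real (2 * (b + 1))" unfolding of_nat_le_iff
    using assms(2) by simp
  ultimately have "real (b + 1 + k * n) * ratio ^ (k - 2) \<le> ratio * real m * ratio ^ (k - 2)"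
    using \<rho>_pos by (intro mult_right_mono) auto
  also have "\<dots> = real m * ratio ^ Suc (k - 2)" by simp
  also have "Suc (k - 2) = k - 1" using k_ge_3 by simp
  finally have few: "real (b + 1 + k * n) * ratio ^ (k - 2) \<le> real m * ratio ^ (k - 1)" .
  have "2 * ratio ^ (k - 1) \<le> real m" using assms(1) ratio_power_le[of "k - 1"] by linarith
  then have "real m * (2 * ratio ^ (k - 1)) \<le> real m * real m" by (intro mult_left_mono) auto
  then have "2 * (real m * ratio ^ (k - 1)) \<le> real m ^ 2"
    by (simp add: power2_eq_square mult.left_commute)
  then show "real (b + 1 + k * n) * ratio ^ (k - 2) \<le> threshold (k - 1)"
    using few threshold_ge_blocks[of "k - 1"] by linarith
qed

end

section \<open>Enforcer's opening in the strict game\<close>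

lemma ex_maximal_killable:
  assumes "finite F" "\<And>e. e \<in> U \<Longrightarrow> \<not> e \<subseteq> D"
  obtains B where "B \<subseteq> F" "card {e \<in> U. e \<subseteq> D \<union> B} \<le> \<beta>"
    "\<And>v. v \<in> F - B \<Longrightarrow> \<beta> < card {e \<in> U. e \<subseteq> D \<union> insert v B}"
proof -
  define \<B> where "\<B> = {B. B \<subseteq> F \<and> card {e \<in> U. e \<subseteq> D \<union> B} \<le> \<beta>}"
  have "finite \<B>" using assms(1) by (simp add: \<B>_def)
  moreover have "{e \<in> U. e \<subseteq> D \<union> {}} = {}" using assms(2) by auto
  then have "{} \<in> \<B>" unfolding \<B>_def by (simp only: mem_Collect_eq card.empty) simp
  ultimately obtain B where B: "B \<in> \<B>" "\<And>B'. B' \<in> \<B> \<Longrightarrow> B \<subseteq> B' \<Longrightarrow> B = B'"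
    using finite_has_maximal[of \<B>] by blast
  show thesis
  proof (rule that)
    fix v assume v: "v \<in> F - B"
    then have "insert v B \<notin> \<B>" using B(2)[of "insert v B"] by blast
    then show "\<beta> < card {e \<in> U. e \<subseteq> D \<union> insert v B}"
      using v B(1) by (auto simp: \<B>_def not_le)
  qed (use B(1) in \<open>auto simp: \<B>_def\<close>)
qed

lemma ex_spread_claim:
  assumes F: "finite F" and C: "\<And>v. v \<in> F \<Longrightarrow> finite (C v)"
    and unique: "\<And>v e. v \<in> F \<Longrightarrow> e \<in> C v \<Longrightarrow> e \<inter> F = {v}"
    and enough: "\<And>v. v \<in> F \<Longrightarrow> \<beta> \<le> card (C v)" and "\<beta> \<le> card F * c"
  obtains T where "T \<subseteq> (\<Union>v\<in>F. C v)" "card T = \<beta>" "\<And>v. v \<in> F \<Longrightarrow> deg T v \<le> c"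
proof -
  obtain t where t: "\<forall>v\<in>F. t v \<le> c" "sum t F = \<beta>"
    using ex_bounded_distribution[OF F assms(5)] by blast
  have "t v \<le> card (C v)" if "v \<in> F" for v
    using member_le_sum[of v F t] enough[OF that] t(2) F that by simp
  then have "\<forall>v\<in>F. \<exists>S. S \<subseteq> C v \<and> card S = t v" by (meson obtain_subset_with_card_n)
  then obtain S where S: "\<And>v. v \<in> F \<Longrightarrow> S v \<subseteq> C v" "\<And>v. v \<in> F \<Longrightarrow> card (S v) = t v" by metis
  define T where "T = (\<Union>v\<in>F. S v)"
  have fin: "finite (S v)" if "v \<in> F" for v using that S(1) C finite_subset by blast
  have at: "{e \<in> T. v \<in> e} \<subseteq> S v" if v: "v \<in> F" for v
  proof
    fix e assume "e \<in> {e \<in> T. v \<in> e}"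
    then obtain w where w: "w \<in> F" "e \<in> S w" "v \<in> e" by (auto simp: T_def)
    then have "e \<inter> F = {w}" using S(1) unique by blast
    then show "e \<in> S v" using v w by auto
  qed
  have "card T = (\<Sum>v\<in>F. card (S v))"
    unfolding T_def
  proof (rule card_UN_disjoint[OF F])
    show "\<forall>v\<in>F. \<forall>w\<in>F. v \<noteq> w \<longrightarrow> S v \<inter> S w = {}"
    proof (intro ballI impI)
      fix v w assume "v \<in> F" "w \<in> F" "v \<noteq> w"
      then have "e \<inter> F = {v}" "e \<inter> F = {w}" if "e \<in> S v \<inter> S w" for e
        using that S(1) unique[of v e] unique[of w e] by auto
      then show "S v \<inter> S w = {}" using \<open>v \<noteq> w\<close> by blast
    qed
  qed (use fin in blast)
  then have "card T = \<beta>" using S(2) t(2) by simp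
  moreover have "deg T v \<le> c" if "v \<in> F" for v
  proof -
    have "deg T v \<le> card (S v)" unfolding deg_def using at fin that by (intro card_mono) auto
    then show ?thesis using S(2) t(1) that by auto
  qed
  moreover have "T \<subseteq> (\<Union>v\<in>F. C v)" using S(1) unfolding T_def by blast
  ultimately show thesis using that by blast
qed

lemma ex_claim_at_fresh:
  assumes "finite F" and U: "U \<subseteq> complete_edges n" and disjoint: "W \<inter> F = {}"
    and large: "\<And>v. v \<in> F \<Longrightarrow> \<beta> < card {e \<in> U. e \<subseteq> insert v W}"
    and inside: "card {e \<in> U. e \<subseteq> W} \<le> \<beta>" and "F \<noteq> {}" "n \<le> card F * c"
  obtains S where "S \<subseteq> U" "card S = \<beta> - card {e \<in> U. e \<subseteq> W}"
    "\<And>e. e \<in> S \<Longrightarrow> \<not> e \<subseteq> W \<and> e \<subseteq> W \<union> F" "\<And>v. v \<in> F \<Longrightarrow> deg S v \<le> c"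
proof -
  define C where "C v = {e \<in> U. e \<subseteq> insert v W \<and> \<not> e \<subseteq> W}" for v
  have "finite U" using U finite_complete_edges by (rule finite_subset)
  then have fin: "finite (C v)" for v by (simp add: C_def)
  have unique: "e \<inter> F = {v}" if "v \<in> F" "e \<in> C v" for v e
    using that disjoint by (auto simp: C_def)
  have enough: "\<beta> - card {e \<in> U. e \<subseteq> W} < card (C v)" if "v \<in> F" for v
  proof -
    have "{e \<in> U. e \<subseteq> insert v W} = {e \<in> U. e \<subseteq> W} \<union> C v" by (auto simp: C_def)
    then have "card {e \<in> U. e \<subseteq> insert v W} \<le> card {e \<in> U. e \<subseteq> W} + card (C v)"
      by (simp add: card_Un_le)
    then show ?thesis using large[OF that] inside by simp
  qed
  obtain v where v: "v \<in> F" using \<open>F \<noteq> {}\<close> by blast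
  have "card (C v) \<le> card {v} * n"
    using U unique[OF v] by (intro card_edges_touching_le) (auto simp: C_def)
  then have "\<beta> - card {e \<in> U. e \<subseteq> W} \<le> card F * c" using enough[OF v] \<open>n \<le> card F * c\<close> by simp
  then show thesis
  proof (rule ex_spread_claim[rotated 4])
    fix S assume S: "S \<subseteq> (\<Union>v\<in>F. C v)" "card S = \<beta> - card {e \<in> U. e \<subseteq> W}"
      "\<And>v. v \<in> F \<Longrightarrow> deg S v \<le> c"
    show thesis by (rule that[OF _ S(2) _ S(3)]) (use S(1) in \<open>auto simp: C_def\<close>)
  qed (use assms(1) fin unique enough in \<open>auto intro: less_imp_le\<close>)
qed

lemma ex_killing_and_spreading_claim:
  assumes "finite F" and U: "U \<subseteq> complete_edges n" and disjoint: "W \<inter> F = {}"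
    and large: "\<And>v. v \<in> F \<Longrightarrow> \<beta> < card {e \<in> U. e \<subseteq> insert v W}"
    and inside: "card {e \<in> U. e \<subseteq> W} \<le> \<beta>" and "F \<noteq> {}" "n \<le> card F * c"
  obtains T where "T \<subseteq> U" "card T = \<beta>" "\<And>e. e \<in> U - T \<Longrightarrow> \<not> e \<subseteq> W"
    "\<And>e. e \<in> T \<Longrightarrow> e \<subseteq> W \<union> F" "\<And>v. v \<in> F \<Longrightarrow> deg T v \<le> c"
proof -
  define K where "K = {e \<in> U. e \<subseteq> W}"
  obtain S where S: "S \<subseteq> U" "card S = \<beta> - card K"
    "\<And>e. e \<in> S \<Longrightarrow> \<not> e \<subseteq> W \<and> e \<subseteq> W \<union> F" "\<And>v. v \<in> F \<Longrightarrow> deg S v \<le> c"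
    using ex_claim_at_fresh[OF assms] unfolding K_def by blast
  have "finite U" using U finite_complete_edges by (rule finite_subset)
  then have fin: "finite K" "finite S" "K \<inter> S = {}"
    using S(1,3) by (auto simp: K_def intro: finite_subset)
  show thesis
  proof (rule that[of "K \<union> S"])
    show "card (K \<union> S) = \<beta>" using S(2) fin inside by (simp add: card_Un_disjoint K_def)
    fix v assume v: "v \<in> F"
    then have "{e \<in> K. v \<in> e} = {}" using disjoint by (auto simp: K_def)
    then have "deg K v = 0" by (simp only: deg_def card.empty)
    then show "deg (K \<union> S) v \<le> c" using deg_Un_disjoint[OF fin, of v] S(4)[OF v] by simp
  qed (use S(1,3) in \<open>auto simp: K_def\<close>)
qed

lemma ex_opening_claim:
  assumes "finite F" and U: "U \<subseteq> complete_edges n" and disjoint: "D \<inter> F = {}"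
    and unclaimed: "\<And>e. e \<in> U \<Longrightarrow> \<not> e \<subseteq> D" and "n \<le> f * c" "f \<ge> 1"
  obtains T B where "B \<subseteq> F" "T \<subseteq> U" "\<And>e. e \<in> U - T \<Longrightarrow> \<not> e \<subseteq> D \<union> B"
    "\<And>e. e \<in> T \<Longrightarrow> e \<subseteq> D \<union> F" "\<And>v. v \<in> F - B \<Longrightarrow> deg T v \<le> c"
    "card T = \<beta> \<and> f \<le> card (F - B) \<or> card T \<le> \<beta> \<and> card (F - B) < f"
proof -
  obtain B where B: "B \<subseteq> F" "card {e \<in> U. e \<subseteq> D \<union> B} \<le> \<beta>"
    and maximal: "\<And>v. v \<in> F - B \<Longrightarrow> \<beta> < card {e \<in> U. e \<subseteq> insert v (D \<union> B)}"
    using ex_maximal_killable[OF assms(1) unclaimed] by auto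
  have DB: "(D \<union> B) \<inter> (F - B) = {}" "D \<union> B \<union> (F - B) = D \<union> F" using disjoint B(1) by auto
  show thesis
  proof (cases "card (F - B) < f")
    case True
    show thesis
    proof (rule that[of B "{e \<in> U. e \<subseteq> D \<union> B}"])
      fix v assume "v \<in> F - B"
      then have "{e \<in> {e \<in> U. e \<subseteq> D \<union> B}. v \<in> e} = {}" using DB(1) by auto
      then show "deg {e \<in> U. e \<subseteq> D \<union> B} v \<le> c" unfolding deg_def by (simp only: card.empty)
    qed (use True B in auto)
  next
    case False
    then have "card (F - B) > 0" using \<open>f \<ge> 1\<close> by simp
    then have "F - B \<noteq> {}" by (intro notI) (simp only: card.empty)
    moreover have "n \<le> card (F - B) * c"
      using False mult_le_mono1[of f "card (F - B)" c] \<open>n \<le> f * c\<close> by linarith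
    ultimately obtain T where T: "T \<subseteq> U" "card T = \<beta>" "\<And>e. e \<in> U - T \<Longrightarrow> \<not> e \<subseteq> D \<union> B"
      "\<And>e. e \<in> T \<Longrightarrow> e \<subseteq> D \<union> B \<union> (F - B)" "\<And>v. v \<in> F - B \<Longrightarrow> deg T v \<le> c"
      using ex_killing_and_spreading_claim[OF _ U DB(1) maximal B(2)] assms(1) by blast
    show thesis
      by (rule that[OF B(1) T(1,3) _ T(5)]) (use T(2,4) DB(2) False in auto)
  qed
qed

text \<open>\<open>D\<close> are the dead vertices and \<open>F\<close> the fresh ones, which have level 0. In each move
  Enforcer kills as many fresh vertices as he can and spreads the rest of his budget over the
  others, at most \<open>c\<close> edges at each. When fewer than \<open>f\<close> fresh vertices are left, Avoider has
  claimed between \<open>qmin\<close> and \<open>qmax\<close> edges, and the two-sided strategy starts with the living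
  vertices of positive level against all others.\<close>

locale opening_phase = level_potential k b s n M \<Delta> \<mu> \<rho> P0
  for k b s n M \<Delta> \<mu> :: nat and \<rho> P0 :: real +
  fixes c f qmax qmin :: nat
  assumes n_ge_2: "n \<ge> 2" and n_le: "n \<le> f * c" and f_ge_1: "f \<ge> 1" and \<rho>_ge_2: "\<rho> \<ge> 2"
    and qmax: "n choose 2 \<le> (qmax - 1) * (b + 1)"
    and qmin: "qmin * (b + 1) \<le> (n - 2 * qmax - f) choose 2"
    and M_le: "M + (c + 2) * qmax \<le> n"
    and P0_eq: "P0 = real qmin * \<rho> * real \<mu>"
    and star_rem_le: "real (star_rem n b) * \<rho> ^ (k - 1) \<le> threshold (k - 1)"
begin

definition opening_inv ::
    "nat \<Rightarrow> nat set set \<Rightarrow> nat set set \<Rightarrow> nat set \<Rightarrow> nat set \<Rightarrow> bool" where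
  "opening_inv q G U D F \<longleftrightarrow> D \<inter> F = {} \<and> D \<union> F \<subseteq> {..<n} \<and> (\<forall>e\<in>U. \<not> e \<subseteq> D) \<and>
     (\<forall>v\<in>F. deg G v = 0) \<and> (\<forall>v\<in>{..<n} - D - F. 1 \<le> deg G v) \<and>
     real (card G) * \<rho> \<le> (\<Sum>v\<in>{..<n} - D - F. \<rho> ^ deg G v) \<and>
     (\<forall>v\<in>{..<n} - D. deg (complete_edges n - G - U) v \<le> c * q)"

definition opening_state :: "nat set set \<Rightarrow> nat set set \<Rightarrow> bool" where
  "opening_state G U \<longleftrightarrow> card U + card G * (b + 1) = n choose 2 \<and>
     (\<exists>D F. opening_inv (card G) G U D F \<and> f \<le> card F)"

definition main_state :: "nat set set \<Rightarrow> nat set set \<Rightarrow> bool" where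
  "main_state G U \<longleftrightarrow> (\<exists>A D. two_sided k b s n M \<Delta> \<mu> \<rho> n A D \<and>
     two_sided.strict_inv k b s n M \<Delta> \<rho> P0 n A D G U)"

lemma qmax_pos: "qmax \<ge> 1"
proof -
  have "n choose 2 > 0" using n_ge_2 by simp
  then have "0 < (qmax - 1) * (b + 1)" using qmax by linarith
  then show ?thesis by auto
qed

lemma M_pos: "M \<ge> 1"
proof -
  have "\<mu> \<noteq> 0" using \<rho>_gain by (cases "\<mu> = 0") auto
  then show ?thesis using margin by simp
qed

lemma card_less_qmax:
  assumes "card U + card G * (b + 1) = n choose 2"
  shows "card G < qmax"
proof -
  have "card G * (b + 1) \<le> (qmax - 1) * (b + 1)" using assms qmax by linarith
  then have "card G \<le> qmax - 1" by (simp only: mult_le_cancel2)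
  then show ?thesis using qmax_pos by simp
qed

lemma opening_state_nonempty:
  assumes "opening_state G {}" "G \<subseteq> complete_edges n"
  shows False
proof -
  let ?X = "complete_edges n"
  obtain D F where inv: "opening_inv (card G) G {} D F" and "f \<le> card F"
    using assms(1) by (auto simp: opening_state_def)
  then have "F \<noteq> {}" using f_ge_1 by auto
  then obtain v where v: "v \<in> F" by blast
  then have "v \<in> {..<n} - D" "deg G v = 0" "deg (?X - G) v \<le> c * card G"
    using inv by (auto simp: opening_inv_def)
  moreover have "deg ?X v = deg G v + deg (?X - G) v"
    using deg_Un_disjoint[of G "?X - G" v] assms(2) finite_subset[OF assms(2)]
    by (simp add: Un_absorb1)
  ultimately have "n - 1 \<le> c * card G" using deg_complete_edges[of v n] by simp
  also have "\<dots> \<le> c * qmax"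
    using card_less_qmax[of "{}" G] assms(1) by (intro mult_le_mono2) (simp add: opening_state_def)
  also have "\<dots> + 2 \<le> (c + 2) * qmax" using qmax_pos by (simp add: algebra_simps)
  finally show False using M_le M_pos by linarith
qed

subsection \<open>One round of the opening\<close>

lemma sum_power_raise:
  fixes d d' :: "'a \<Rightarrow> nat"
  assumes "finite W'" "W \<subseteq> W'" and mono: "\<And>v. d v \<le> d' v"
    and x: "x \<in> W'" "1 \<le> d' x" "x \<in> W \<Longrightarrow> 1 \<le> d x \<and> d x < d' x"
  shows "(\<Sum>v\<in>W. \<rho> ^ d v) + \<rho> \<le> (\<Sum>v\<in>W'. \<rho> ^ d' v)"
proof -
  define g where "g v = (if v \<in> W then \<rho> ^ d v else 0)" for v
  have "g v \<le> \<rho> ^ d' v" for v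
    using mono[of v] \<rho>_ge_1 by (auto simp: g_def intro: power_increasing)
  then have "sum g (W' - {x}) \<le> (\<Sum>v\<in>W' - {x}. \<rho> ^ d' v)" by (intro sum_mono)
  moreover have "g x + \<rho> \<le> \<rho> ^ d' x"
  proof (cases "x \<in> W")
    case False
    then show ?thesis using power_increasing[OF x(2) \<rho>_ge_1] by (simp add: g_def)
  next
    case True
    then have dx: "1 \<le> d x" "Suc (d x) \<le> d' x" using x(3) by auto
    have "\<rho> \<le> \<rho> ^ d x" using power_increasing[OF dx(1) \<rho>_ge_1] by simp
    moreover have "2 * \<rho> ^ d x \<le> \<rho> * \<rho> ^ d x" using \<rho>_ge_2 by (intro mult_right_mono) auto
    moreover have "\<rho> * \<rho> ^ d x \<le> \<rho> ^ d' x" using power_increasing[OF dx(2) \<rho>_ge_1] by simp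
    ultimately show ?thesis using True by (simp add: g_def)
  qed
  moreover have "(\<Sum>v\<in>W. \<rho> ^ d v) = sum g W'"
    using assms(1,2) by (simp add: g_def sum.inter_restrict[symmetric] Int_absorb1)
  ultimately show ?thesis using assms(1) x(1) by (simp add: sum.remove[of W' x])
qed

lemma opening_inv_avoider_move:
  assumes inv: "opening_inv q G U D F" and pos: "position (complete_edges n) G U" and e: "e \<in> U"
  shows "opening_inv q (insert e G) (U - {e}) D (F - e)"
proof -
  have new: "finite G" "e \<notin> G" "e \<in> complete_edges n"
    using pos e position_complete_edges_finite[OF pos] by (auto simp: position_def)
  note deg_new = deg_insert[OF new(1,2)]
  have "\<not> e \<subseteq> D" using inv e by (simp add: opening_inv_def)
  then obtain x where x: "x \<in> e" "x \<notin> D" "x < n" using new(3) by (auto simp: complete_edges_def)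
  have "(\<Sum>v\<in>{..<n} - D - F. \<rho> ^ deg G v) + \<rho>
      \<le> (\<Sum>v\<in>{..<n} - D - (F - e). \<rho> ^ deg (insert e G) v)"
    by (rule sum_power_raise[of _ _ _ _ x]) (use x inv deg_new in \<open>auto simp: opening_inv_def\<close>)
  then have "real (card (insert e G)) * \<rho> \<le> (\<Sum>v\<in>{..<n} - D - (F - e). \<rho> ^ deg (insert e G) v)"
    using inv new(1,2) by (simp add: opening_inv_def algebra_simps)
  moreover have "complete_edges n - insert e G - (U - {e}) = complete_edges n - G - U"
    using e by auto
  ultimately show ?thesis using inv deg_new unfolding opening_inv_def by auto
qed

lemma opening_inv_enforcer_move:
  assumes inv: "opening_inv q G U D F" and pos: "position (complete_edges n) G U"
    and B: "B \<subseteq> F" and T: "T \<subseteq> U" "\<And>e. e \<in> U - T \<Longrightarrow> \<not> e \<subseteq> D \<union> B"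
    "\<And>e. e \<in> T \<Longrightarrow> e \<subseteq> D \<union> F" "\<And>v. v \<in> F - B \<Longrightarrow> deg T v \<le> c"
  shows "opening_inv (Suc q) G (U - T) (D \<union> B) (F - B)"
proof -
  have "deg (complete_edges n - G - (U - T)) v \<le> c * Suc q" if v: "v \<in> {..<n} - (D \<union> B)" for v
  proof -
    have "complete_edges n - G - (U - T) = (complete_edges n - G - U) \<union> T"
      using pos T(1) by (auto simp: position_def)
    then have "deg (complete_edges n - G - (U - T)) v = deg (complete_edges n - G - U) v + deg T v"
      using T(1) position_complete_edges_finite[OF pos]
      by (simp only:) (intro deg_Un_disjoint, auto intro: finite_subset)
    moreover have "deg T v \<le> c"
    proof (cases "v \<in> F - B")
      case False
      then have "{e \<in> T. v \<in> e} = {}" using v T(3) by blast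
      then show ?thesis by (simp only: deg_def card.empty)
    qed (rule T(4))
    moreover have "deg (complete_edges n - G - U) v \<le> c * q"
      using inv v by (simp add: opening_inv_def)
    ultimately show ?thesis by simp
  qed
  moreover have "{..<n} - (D \<union> B) - (F - B) = {..<n} - D - F" using B by auto
  ultimately show ?thesis using inv B T(2) unfolding opening_inv_def by auto
qed

subsection \<open>From the opening to the main phase\<close>

lemma card_living_le:
  assumes "opening_inv q G U D F" "position (complete_edges n) G U" "card G \<le> qmax"
  shows "card ({..<n} - D - F) \<le> 2 * qmax"
proof -
  have "card ({..<n} - D - F) \<le> 2 * card G"
    using assms(1,2) by (intro card_le_if_deg_pos) (auto simp: position_def opening_inv_def)
  then show ?thesis using assms(3) by simp
qed

lemma qmin_le_card:
  assumes inv: "opening_inv q G U D F" and pos: "position (complete_edges n) G U"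
    and "card G \<le> qmax" "card F < f" and total: "n choose 2 \<le> card U + card G * (b + 1)"
  shows "qmin \<le> card G"
proof -
  have DF: "D \<union> F \<subseteq> {..<n}" using inv by (simp add: opening_inv_def)
  have "finite D" "finite F" using finite_subset[OF DF] by auto
  have "n \<le> card ({..<n} - D - F) + card D + card F"
  proof -
    have "{..<n} = ({..<n} - D - F) \<union> (D \<union> F)" using DF by auto
    then have "n = card (({..<n} - D - F) \<union> (D \<union> F))" by simp
    then show ?thesis using card_Un_le[of "{..<n} - D - F" "D \<union> F"] card_Un_le[of D F] by linarith
  qed
  then have "n - 2 * qmax - f \<le> card D" using card_living_le[OF inv pos assms(3)] assms(4) by simp
  then have "(n - 2 * qmax - f) choose 2 \<le> card D choose 2" by (rule binomial_right_mono)
  also have "\<dots> = card {e \<in> complete_edges n. e \<subseteq> D}"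
    using card_complete_edges_inside \<open>finite D\<close> DF by simp
  also have "\<dots> \<le> card (complete_edges n - U)"
    using inv by (intro card_mono) (auto simp: opening_inv_def)
  also have "\<dots> = (n choose 2) - card U"
    using pos position_complete_edges_finite[OF pos]
    by (simp add: card_Diff_subset position_def card_complete_edges)
  finally have "qmin * (b + 1) \<le> card G * (b + 1)" using qmin total by linarith
  then show ?thesis by (simp only: mult_le_cancel2)
qed

lemma sound_after_opening:
  assumes inv: "opening_inv q G U D F" and pos: "position (complete_edges n) G U"
    and "card G \<le> qmax" "q \<le> qmax" and v: "v \<in> {..<n} - D - F"
    and C: "C = (\<lambda>w. {v, w}) ` (D \<union> F)"
  shows "sound (card (U \<inter> C)) (deg G v)"
proof -
  have DF: "D \<union> F \<subseteq> {..<n}" using inv by (simp add: opening_inv_def)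
  have "C \<subseteq> complete_edges n" using v DF unfolding C by (auto simp: doubleton_in_complete_edges_iff)
  then have "C \<subseteq> (U \<inter> C) \<union> {e \<in> G. v \<in> e} \<union> {e \<in> complete_edges n - G - U. v \<in> e}"
    unfolding C by auto
  then have "card C \<le> card ((U \<inter> C) \<union> {e \<in> G. v \<in> e} \<union> {e \<in> complete_edges n - G - U. v \<in> e})"
    using position_complete_edges_finite[OF pos] by (intro card_mono) auto
  also have "\<dots> \<le> card (U \<inter> C) + deg G v + deg (complete_edges n - G - U) v"
    unfolding deg_def by (meson add_le_mono1 card_Un_le le_trans)
  also have "deg (complete_edges n - G - U) v \<le> c * q" using inv v by (simp add: opening_inv_def)
  also have "c * q \<le> c * qmax" using assms(4) by (rule mult_le_mono2)
  finally have "card C \<le> card (U \<inter> C) + deg G v + c * qmax" by simp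
  moreover have "card C = card (D \<union> F)"
    unfolding C by (intro card_image) (auto simp: inj_on_def doubleton_eq_iff)
  moreover have "n \<le> card (D \<union> F) + 2 * qmax"
  proof -
    have "{..<n} - D - F = {..<n} - (D \<union> F)" by auto
    then have "card ({..<n} - D - F) = n - card (D \<union> F)"
      using card_Diff_subset[OF finite_subset[OF DF] DF] by simp
    then show ?thesis using card_living_le[OF inv pos assms(3)] by simp
  qed
  moreover have "(c + 2) * qmax = c * qmax + 2 * qmax" by (simp add: algebra_simps)
  moreover have "deg G v \<le> deg G v * (\<Delta> + 1)" by simp
  ultimately show ?thesis unfolding sound_def using M_le by linarith
qed

lemma two_sided_after_opening:
  assumes "opening_inv q G U D F"
  shows "two_sided k b s n M \<Delta> \<mu> \<rho> n ({..<n} - D - F) (D \<union> F)"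
proof
  have "D \<union> F \<subseteq> {..<n}" using assms by (simp add: opening_inv_def)
  then show "D \<union> F \<subseteq> {..<n}" "card (D \<union> F) \<le> n" using card_mono[of "{..<n}" "D \<union> F"] by auto
qed auto

lemma surplus_after_opening:
  assumes inv: "opening_inv q G U D F" and pos: "position (complete_edges n) G U"
    and "card G \<le> qmax" "q \<le> qmax" "card F < f" "n choose 2 \<le> card U + card G * (b + 1)"
    and deg: "\<And>v. deg G v < k"
    and u: "\<And>v. u v = card (U \<inter> (\<lambda>w. {v, w}) ` (D \<union> F))"
  shows "surplus ({..<n} - D - F) 0 {} u (deg G)"
proof -
  let ?W = "{..<n} - D - F"
  have sound: "sound (u v) (deg G v)" if "v \<in> ?W" for v
    using sound_after_opening[OF inv pos assms(3,4) that] u by simp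
  have "P0 \<le> real (card G) * \<rho> * real \<mu>"
    unfolding P0_eq
    using qmin_le_card[OF inv pos assms(3,5,6)] \<rho>_pos by (intro mult_right_mono) auto
  also have "\<dots> \<le> (\<Sum>v\<in>?W. \<rho> ^ deg G v) * real \<mu>"
    using inv by (intro mult_right_mono) (auto simp: opening_inv_def)
  also have "\<dots> = (\<Sum>v\<in>?W. \<rho> ^ deg G v * real \<mu>)" by (rule sum_distrib_right)
  also have "\<dots> \<le> pot ?W u (deg G)"
    unfolding pot_def using sound_ge[OF sound deg] \<rho>_pos by (intro sum_mono mult_left_mono) auto
  finally show ?thesis using sound k_ge_2 by (simp add: surplus_def alive_sound_def)
qed

lemma main_state_after_opening:
  assumes inv: "opening_inv q G U D F" and pos: "position (complete_edges n) G U"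
    and "q \<le> qmax" and deg: "\<And>v. deg G v < k" and "card F < f"
    and prev: "full_rounds n b U0" "finite U0" "S \<subseteq> U0" "card S = 1" "U = U0 - S - T"
    and total: "card U0 + card G * (b + 1) = (n choose 2) + (b + 1)" "card G \<le> qmax"
    and T: "T \<subseteq> U0 - S" "card T \<le> b"
  shows "\<exists>T\<in>strict_moves b (U0 - S). main_state G (U0 - S - T)"
proof -
  interpret two_sided k b s n M \<Delta> \<mu> \<rho> P0 n "{..<n} - D - F" "D \<union> F"
    using inv by (rule two_sided_after_opening)
  have fin: "finite (U0 - S)" "finite T" "finite S"
    using prev(2,3) T(1) by (auto intro: finite_subset)
  have "card U = card (U0 - S) - card T" using T(1) fin prev(5) by (simp add: card_Diff_subset)
  moreover have "card (U0 - S) = card U0 - 1" using prev(3,4) fin(3) by (simp add: card_Diff_subset)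
  ultimately have "n choose 2 \<le> card U + card G * (b + 1)" using total(1) T(2) by linarith
  then have "surplus ({..<n} - D - F) 0 {} (free U) (deg G)"
    by (intro surplus_after_opening[OF inv pos total(2) assms(3,5) _ deg])
      (simp_all add: free_def cross_def)
  then obtain T2 where T2: "good_reply G U (b - card T) T2"
    using surplus_imp_good_reply[of U G "b - card T"] fin prev(5) deg by auto
  then have "T2 \<subseteq> U0 - S - T" by (simp add: good_reply_def prev(5))
  then have "card (T \<union> T2) = card T + card T2"
    using fin by (intro card_Un_disjoint) (auto intro: finite_subset)
  moreover have "U - T2 = U0 - S - (T \<union> T2)" using prev(5) by auto
  ultimately have "good_reply G (U0 - S) b (T \<union> T2)"
    using T2 T prev(5) by (auto simp: good_reply_def)
  then have "\<exists>T\<in>strict_moves b (U0 - S). strict_inv G (U0 - S - T)"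
    using good_reply_imp_strict_inv[OF n_ge_2 star_rem_le prev(1-4)] by blast
  then show ?thesis unfolding main_state_def using two_sided_axioms by blast
qed

lemma main_state_step:
  assumes "main_state G U" "position (complete_edges n) G U" "S \<in> strict_moves 1 U" "S \<subseteq> U" "S \<noteq> {}"
    and "\<And>v. deg (G \<union> S) v < k"
  shows "\<exists>T\<in>strict_moves b (U - S). main_state (G \<union> S) (U - S - T)"
proof -
  obtain A D where AD: "two_sided k b s n M \<Delta> \<mu> \<rho> n A D"
    "two_sided.strict_inv k b s n M \<Delta> \<rho> P0 n A D G U" using assms(1) by (auto simp: main_state_def)
  interpret two_sided k b s n M \<Delta> \<mu> \<rho> P0 n A D by (rule AD(1))
  show ?thesis
    using strict_inv_step[OF n_ge_2 star_rem_le AD(2) assms(2-6)] AD(1)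
    unfolding main_state_def by blast
qed

lemma ex_opening_inv_reply:
  assumes inv: "opening_inv q G U D F" and pos: "position (complete_edges n) G U"
  obtains T D' F' where "T \<subseteq> U" "opening_inv (Suc q) G (U - T) D' F'"
    "card T = b \<and> f \<le> card F' \<or> card T \<le> b \<and> card F' < f"
proof -
  have "finite F" using inv finite_subset[of "D \<union> F" "{..<n}"] by (auto simp: opening_inv_def)
  then obtain T B where B: "B \<subseteq> F"
    and T: "T \<subseteq> U" "\<And>e. e \<in> U - T \<Longrightarrow> \<not> e \<subseteq> D \<union> B" "\<And>e. e \<in> T \<Longrightarrow> e \<subseteq> D \<union> F"
      "\<And>v. v \<in> F - B \<Longrightarrow> deg T v \<le> c"
    and outcome: "card T = b \<and> f \<le> card (F - B) \<or> card T \<le> b \<and> card (F - B) < f"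
    using ex_opening_claim[of F U n D f c b] inv pos n_le f_ge_1
    unfolding opening_inv_def position_def by metis
  show thesis by (rule that[OF T(1) opening_inv_enforcer_move[OF inv pos B T] outcome])
qed

lemma opening_stateI:
  assumes "opening_inv (card G) G (V - T) D F" "f \<le> card F" "finite V" "T \<subseteq> V" "card T = b"
    and "card V + card G * (b + 1) = (n choose 2) + b"
  shows "opening_state G (V - T)" and "T \<in> strict_moves b V"
proof -
  have "card T \<le> card V" using assms(3,4) by (intro card_mono)
  moreover have "card (V - T) = card V - card T"
    using assms(3,4) by (simp add: card_Diff_subset finite_subset)
  ultimately show "opening_state G (V - T)" using assms by (auto simp: opening_state_def)
  show "T \<in> strict_moves b V" using assms(4,5) \<open>card T \<le> card V\<close> by (simp add: strict_moves_def)
qed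

lemma opening_state_step:
  assumes state: "opening_state G U" and pos: "position (complete_edges n) G U"
    and S: "S \<in> strict_moves 1 U" "S \<subseteq> U" "S \<noteq> {}" and deg: "\<And>v. deg (G \<union> S) v < k"
  shows "\<exists>T\<in>strict_moves b (U - S).
    main_state (G \<union> S) (U - S - T) \<or> opening_state (G \<union> S) (U - S - T)"
proof -
  have fin: "finite U" "finite G" using position_complete_edges_finite[OF pos] by auto
  obtain D F where inv: "opening_inv (card G) G U D F"
    and total: "card U + card G * (b + 1) = n choose 2"
      using state by (auto simp: opening_state_def)
  have card_S: "card S = 1" using S fin card_gt_0_iff[of U] by (auto simp: strict_moves_def)
  then obtain e where e: "S = {e}" by (auto simp: card_1_singleton_iff)
  have "e \<notin> G" using pos S(2) e by (auto simp: position_def)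
  then have card_G: "card (G \<union> S) = Suc (card G)" using fin e by simp
  have card_U: "card U = Suc (card (U - S))" using fin(1) S(2) e card_Suc_Diff1[of U e] by simp
  note pos' = position_move[OF pos S(2)]
  have "opening_inv (card G) (G \<union> S) (U - S) D (F - e)"
    using opening_inv_avoider_move[OF inv pos, of e] S(2) e by simp
  from ex_opening_inv_reply[OF this pos'] obtain T D' F' where T: "T \<subseteq> U - S"
    and inv': "opening_inv (card (G \<union> S)) (G \<union> S) (U - S - T) D' F'"
    and "card T = b \<and> f \<le> card F' \<or> card T \<le> b \<and> card F' < f" unfolding card_G by blast
  then consider "card T = b" "f \<le> card F'" | "card T \<le> b" "card F' < f" by blast
  then show ?thesis
  proof cases
    case 1
    have "card (U - S) + card (G \<union> S) * (b + 1) = (n choose 2) + b"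
      using total card_G card_U by simp
    then show ?thesis using opening_stateI[OF inv' 1(2) _ T 1(1)] fin by blast
  next
    case 2
    have "full_rounds n b U"
      using total by (auto simp: full_rounds_def intro: exI[of _ "card G"])
    moreover have "card U + card (G \<union> S) * (b + 1) = (n choose 2) + (b + 1)"
      using total card_G by simp
    moreover have "card (G \<union> S) \<le> qmax" using card_less_qmax[OF total] card_G by simp
    ultimately have "\<exists>T\<in>strict_moves b (U - S). main_state (G \<union> S) (U - S - T)"
      using main_state_after_opening[OF inv' position_Diff[OF pos'] _ deg 2(2)] fin(1) S(2) card_S
        T 2(1) by blast
    then show ?thesis by blast
  qed
qed

lemma opening_state_initial: "opening_state {} (complete_edges n)"
proof -
  have "f \<le> n"
  proof (rule ccontr)
    assume "\<not> f \<le> n"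
    then have "n - 2 * qmax - f < 2" by simp
    then have "qmin * (b + 1) \<le> 0" using qmin binomial_eq_0[of "n - 2 * qmax - f" 2] by linarith
    then have "P0 = 0" using P0_eq by simp
    then have "threshold (k - 1) \<le> 0" using threshold_antimono[of 0 "k - 1"] threshold_0 by linarith
    moreover have "0 < real (star_rem n b) * \<rho> ^ (k - 1)"
      using star_rem_bounds(1)[OF n_ge_2, of b] \<rho>_pos by simp
    ultimately show False using star_rem_le by linarith
  qed
  moreover have "\<not> e \<subseteq> {}" if "e \<in> complete_edges n" for e
    using that by (auto simp: complete_edges_def)
  ultimately have "opening_inv 0 {} (complete_edges n) {} {..<n} \<and> f \<le> card {..<n}"
    by (auto simp: opening_inv_def)
  then show ?thesis
    unfolding opening_state_def card.empty
    by (intro conjI exI[of _ "{}"] exI[of _ "{..<n}"]) (simp_all add: card_complete_edges)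
qed

lemma enforcer_wins: "wins_star_game Enforcer strict_moves k n b"
proof (rule enforcer_wins_star_by_invariant[OF admissible_rule_strict,
      where I = "\<lambda>G U. main_state G U \<or> opening_state G U"])
  fix G assume "main_state G {} \<or> opening_state G {}" "position (complete_edges n) G {}"
  then have "main_state G {}" using opening_state_nonempty by (auto simp: position_def)
  then show "\<exists>v. k \<le> deg G v" by (auto simp: main_state_def two_sided.strict_inv_def)
next
  fix G U S assume "main_state G U \<or> opening_state G U" and pos: "position (complete_edges n) G U"
    and S: "S \<in> strict_moves 1 U" "S \<subseteq> U" "S \<noteq> {}" and deg: "\<And>v. deg (G \<union> S) v < k"
  then show "\<exists>T\<in>strict_moves b (U - S). main_state (G \<union> S) (U - S - T)
      \<or> opening_state (G \<union> S) (U - S - T)"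
    using main_state_step[OF _ pos S deg] opening_state_step[OF _ pos S deg] by blast
qed (use k_ge_2 opening_state_initial in auto)

end

section \<open>Strict games with a small remainder\<close>

lemma real_div_le_Suc: "real a / real c \<le> real (a div c) + 1"
proof -
  have "\<lfloor>real a / real c\<rfloor> = int (a div c)" by (rule floor_divide_of_nat_eq)
  then show ?thesis by linarith
qed

lemma real_choose_two: "real (n choose 2) = real n * (real n - 1) / 2"
proof -
  have "2 * (n choose 2) = n * (n - 1)" unfolding choose_two by (intro dvd_mult_div_cancel) auto
  then have "2 * real (n choose 2) = real n * real (n - 1)" by (metis of_nat_mult of_nat_numeral)
  then show ?thesis by (cases n) auto
qed

lemma real_choose_two_le: "real (n choose 2) \<le> real n ^ 2 / 2"
  by (simp add: real_choose_two power2_eq_square algebra_simps)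

text \<open>The potential argument leaves about \<open>n ^ (k + 1) / (2 * b ^ (k - 1))\<close> edges, minus about \<open>n\<close>
  for the passages between levels. With \<open>\<xi> = n ^ k / (2 * b) ^ (k - 1)\<close> this is at least
  \<open>(2 * \<xi> - 1) * n\<close> up to lower order terms, which exceeds \<open>\<xi> * n\<close> because the factor \<open>0.4\<close> in
  the bound on \<open>b\<close> gives \<open>\<xi> \<ge> 25 / 16\<close>. The lower order terms are multiples of \<open>\<epsilon> = 1 / L\<close>.\<close>

locale opening_parameters =
  fixes k n b L :: nat
  assumes k_ge_3: "k \<ge> 3" and L: "L = 100 * k" and n_ge: "4 * L * (L + 2) \<le> n"
    and b_ge: "L * (L + 2) * n \<le> b" and b_le: "2 * L * b \<le> n ^ 2"
    and b_power_le: "25 / 16 * (2 * real b) ^ (k - 1) \<le> real n ^ k"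
begin

definition \<epsilon> :: real where
  "\<epsilon> = 1 / real L"

definition \<tau> :: real where
  "\<tau> = real b / real n"

definition qmax :: nat where
  "qmax = (n choose 2) div (b + 1) + 2"

definition f :: nat where
  "f = n div L + 1"

definition qmin :: nat where
  "qmin = ((n - 2 * qmax - f) choose 2) div (b + 1)"

definition M :: nat where
  "M = n - (L + 2) * qmax"

definition \<Delta> :: nat where
  "\<Delta> = n div (k * L) + 1"

definition \<mu> :: nat where
  "\<mu> = M - (k - 1) * (\<Delta> + 1)"

definition \<rho> :: real where
  "\<rho> = 1 + real (b + 1) / real \<mu>"

definition \<xi> :: real where
  "\<xi> = real n ^ k / (2 * real b) ^ (k - 1)"

lemma L_ge_300: "L \<ge> 300"
  using k_ge_3 by (simp add: L)

lemma eps: "0 < \<epsilon>" "\<epsilon> \<le> 1 / 300" "real k * \<epsilon> = 1 / 100"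
proof -
  show "0 < \<epsilon>" "\<epsilon> \<le> 1 / 300" using L_ge_300 by (auto simp: \<epsilon>_def field_simps)
  have "real L = 100 * real k" by (simp add: L)
  then show "real k * \<epsilon> = 1 / 100" using k_ge_3 by (simp add: \<epsilon>_def)
qed

lemma le_eps_multI: "real L * y \<le> z \<Longrightarrow> y \<le> \<epsilon> * z"
  using L_ge_300 by (simp add: \<epsilon>_def field_simps)

lemma n_ge_real: "4 * real L * (real L + 2) \<le> real n"
  using of_nat_mono[OF n_ge, where 'a = real] by (simp add: algebra_simps)

lemma b_ge_real: "real L * (real L + 2) * real n \<le> real b"
  using of_nat_mono[OF b_ge, where 'a = real] by (simp add: algebra_simps)

lemma b_le_real: "2 * real L * real b \<le> real n ^ 2"
  using of_nat_mono[OF b_le, where 'a = real] by (simp add: algebra_simps)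

lemma L_le_n: "real L \<le> real n"
proof -
  have "0 \<le> real L * real L" by simp
  then have "real L \<le> 4 * real L * (real L + 2)" by (simp add: algebra_simps)
  then show ?thesis using n_ge_real by linarith
qed

lemma n_pos: "real n > 0"
  using L_le_n L_ge_300 by simp

lemma Ln_le_b: "real L * real n \<le> real b"
proof -
  have "real L * 1 * real n \<le> real L * (real L + 2) * real n"
    by (intro mult_right_mono mult_left_mono) auto
  then show ?thesis using b_ge_real by simp
qed

lemma n_le_b: "real n \<le> real b"
proof -
  have "1 * real n \<le> real L * real n" using L_ge_300 by (intro mult_right_mono) auto
  then show ?thesis using Ln_le_b by simp
qed

lemma b_pos: "real b > 0"
  using n_le_b n_pos by simp

lemma \<tau>_pos: "\<tau> > 0"
  using b_pos n_pos by (simp add: \<tau>_def)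

lemma one_le_eps_n: "1 \<le> \<epsilon> * real n"
  using L_le_n by (intro le_eps_multI) simp

lemma Suc_b_le: "real (b + 1) \<le> (1 + \<epsilon>) * real b"
proof -
  have "\<epsilon> * real n \<le> \<epsilon> * real b" using n_le_b eps by (intro mult_left_mono) auto
  then show ?thesis using one_le_eps_n by (simp add: algebra_simps)
qed

lemma qmax_le: "real qmax \<le> real n ^ 2 / (2 * real b) + 2"
proof -
  have "real ((n choose 2) div (b + 1)) \<le> real (n choose 2) / real (b + 1)"
    by (rule of_nat_div_le_of_nat)
  also have "\<dots> \<le> (real n ^ 2 / 2) / real b" using real_choose_two_le b_pos by (intro frac_le) auto
  finally show ?thesis by (simp add: qmax_def)
qed

lemma opening_loss_le: "real ((L + 2) * qmax) \<le> \<epsilon> * real n"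
proof (rule le_eps_multI)
  have "real L * real ((L + 2) * qmax) = real L * (real L + 2) * real qmax"
    by (simp add: algebra_simps)
  also have "\<dots> \<le> real L * (real L + 2) * (real n ^ 2 / (2 * real b) + 2)"
    using qmax_le by (intro mult_left_mono) auto
  also have "\<dots> = real L * (real L + 2) * real n * (real n / (2 * real b)) + 2 * real L * (real L + 2)"
    by (simp add: distrib_left power2_eq_square)
  also have "real L * (real L + 2) * real n * (real n / (2 * real b)) \<le> real b * (real n / (2 * real b))"
    using b_ge_real by (intro mult_right_mono) auto
  also have "\<dots> = real n / 2" using b_pos by simp
  finally show "real L * real ((L + 2) * qmax) \<le> real n" using n_ge_real by linarith
qed

lemma opening_loss_le_n: "(L + 2) * qmax \<le> n"
proof -
  have "\<epsilon> * real n \<le> 1 * real n" using eps n_pos by (intro mult_right_mono) auto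
  then have "real ((L + 2) * qmax) \<le> real n" using opening_loss_le by linarith
  then show ?thesis by (simp only: of_nat_le_iff)
qed

lemma M_ge: "(1 - \<epsilon>) * real n \<le> real M"
  using opening_loss_le opening_loss_le_n unfolding M_def
  by (simp only: of_nat_diff) (simp add: algebra_simps)

lemma damage_le: "real ((k - 1) * (\<Delta> + 1)) \<le> 2 * \<epsilon> * real n"
proof -
  have "real (n div (k * L)) \<le> real n / real (k * L)" by (rule of_nat_div_le_of_nat)
  then have "real L * (real k * real (\<Delta> + 1)) \<le> real L * (real k * (real n / real (k * L) + 2))"
    by (intro mult_left_mono) (auto simp: \<Delta>_def)
  also have "\<dots> = real n + 2 * real L * real k"
    using k_ge_3 L_ge_300 by (simp add: field_simps)
  also have "2 * real L * real k \<le> 4 * real L * (real L + 2)"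
    by (intro mult_mono) (auto simp: L)
  finally have "real L * (real k * real (\<Delta> + 1)) \<le> 2 * real n" using n_ge_real by linarith
  then have "real k * real (\<Delta> + 1) \<le> \<epsilon> * (2 * real n)" by (rule le_eps_multI)
  moreover have "real ((k - 1) * (\<Delta> + 1)) \<le> real k * real (\<Delta> + 1)"
    unfolding of_nat_mult by (intro mult_right_mono) auto
  ultimately show ?thesis by simp
qed

lemma damage_le_M: "(k - 1) * (\<Delta> + 1) \<le> M"
proof -
  have "2 * \<epsilon> * real n \<le> (1 - \<epsilon>) * real n" using eps n_pos by (intro mult_right_mono) auto
  then have "real ((k - 1) * (\<Delta> + 1)) \<le> real M" using damage_le M_ge by linarith
  then show ?thesis by (simp only: of_nat_le_iff)
qed

lemma \<mu>_ge: "(1 - 3 * \<epsilon>) * real n \<le> real \<mu>"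
  using M_ge damage_le damage_le_M unfolding \<mu>_def
  by (simp only: of_nat_diff) (simp add: algebra_simps)

lemma \<mu>_le: "real \<mu> \<le> real n"
  by (simp add: \<mu>_def M_def)

lemma \<mu>_pos: "real \<mu> > 0"
proof -
  have "0 < (1 - 3 * \<epsilon>) * real n" using eps n_pos by (intro mult_pos_pos) auto
  then show ?thesis using \<mu>_ge by linarith
qed

lemma \<rho>_ge_2: "\<rho> \<ge> 2"
  using \<mu>_le \<mu>_pos n_le_b by (simp add: \<rho>_def)

lemma \<rho>_le: "\<rho> \<le> (1 + 6 * \<epsilon>) * \<tau>"
proof -
  have "real (b + 1) / real \<mu> \<le> ((1 + \<epsilon>) * real b) / ((1 - 3 * \<epsilon>) * real n)"
    using Suc_b_le \<mu>_ge eps n_pos by (intro frac_le) auto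
  also have "\<dots> = (1 + \<epsilon>) / (1 - 3 * \<epsilon>) * \<tau>" by (simp add: \<tau>_def)
  also have "\<dots> \<le> (1 + 5 * \<epsilon>) * \<tau>"
  proof (rule mult_right_mono)
    have "\<epsilon> * (15 * \<epsilon>) \<le> \<epsilon> * 1" using eps by (intro mult_left_mono) auto
    then have "1 + \<epsilon> \<le> (1 + 5 * \<epsilon>) * (1 - 3 * \<epsilon>)" by (simp add: algebra_simps)
    then show "(1 + \<epsilon>) / (1 - 3 * \<epsilon>) \<le> 1 + 5 * \<epsilon>" using eps by (subst pos_divide_le_eq) auto
  qed (use \<tau>_pos in simp)
  finally have "real (b + 1) / real \<mu> \<le> (1 + 5 * \<epsilon>) * \<tau>" .
  moreover have "1 \<le> \<epsilon> * \<tau>"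
    using Ln_le_b n_pos by (intro le_eps_multI) (simp add: \<tau>_def field_simps)
  ultimately show ?thesis unfolding \<rho>_def by (simp add: algebra_simps)
qed

lemma dead_ge: "(1 - 3 * \<epsilon>) * real n \<le> real (n - 2 * qmax - f)"
proof -
  have "real (n div L) \<le> \<epsilon> * real n"
    using of_nat_div_le_of_nat[of n L, where 'a = real] by (simp add: \<epsilon>_def)
  then have "real f \<le> 2 * (\<epsilon> * real n)" using one_le_eps_n by (simp add: f_def)
  moreover have "2 * real qmax \<le> real ((L + 2) * qmax)"
    unfolding of_nat_mult by (intro mult_right_mono) auto
  ultimately have "2 * real qmax + real f \<le> 3 * \<epsilon> * real n" using opening_loss_le by linarith
  then show ?thesis by (simp add: algebra_simps)
qed

lemma dead_choose_two_ge: "(1 - 8 * \<epsilon>) * (real n ^ 2 / 2) \<le> real ((n - 2 * qmax - f) choose 2)"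
proof -
  define y where "y = real (n - 2 * qmax - f)"
  have "(1 - 4 * \<epsilon>) * real n \<le> y - 1"
    using dead_ge one_le_eps_n by (simp add: y_def algebra_simps)
  moreover have "0 \<le> (1 - 4 * \<epsilon>) * real n" using eps by simp
  ultimately have "((1 - 4 * \<epsilon>) * real n) * ((1 - 4 * \<epsilon>) * real n) \<le> y * (y - 1)"
    by (intro mult_mono) auto
  moreover have "(1 - 8 * \<epsilon>) * real n ^ 2 \<le> (1 - 4 * \<epsilon>) ^ 2 * real n ^ 2"
    by (intro mult_right_mono) (auto simp: power2_eq_square algebra_simps)
  ultimately have "(1 - 8 * \<epsilon>) * real n ^ 2 \<le> y * (y - 1)"
    by (simp add: power2_eq_square mult_ac)
  then show ?thesis by (simp add: real_choose_two y_def)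
qed

lemma qmin_ge: "(1 - 10 * \<epsilon>) * (real n / (2 * \<tau>)) \<le> real qmin"
proof -
  define y where "y = real n / (2 * \<tau>)"
  have "(1 - 9 * \<epsilon>) * y \<le> (1 - 8 * \<epsilon>) / (1 + \<epsilon>) * y"
  proof (rule mult_right_mono)
    have "(1 - 9 * \<epsilon>) * (1 + \<epsilon>) \<le> 1 - 8 * \<epsilon>" by (simp add: algebra_simps)
    then show "1 - 9 * \<epsilon> \<le> (1 - 8 * \<epsilon>) / (1 + \<epsilon>)" using eps by (subst pos_le_divide_eq) auto
  qed (use \<tau>_pos in \<open>simp add: y_def\<close>)
  also have "\<dots> = ((1 - 8 * \<epsilon>) * (real n ^ 2 / 2)) / ((1 + \<epsilon>) * real b)"
    unfolding y_def \<tau>_def using n_pos by (simp add: power2_eq_square field_simps)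
  also have "\<dots> \<le> real ((n - 2 * qmax - f) choose 2) / real (b + 1)"
    using Suc_b_le dead_choose_two_ge eps by (intro frac_le) auto
  also have "\<dots> \<le> real qmin + 1" unfolding qmin_def by (rule real_div_le_Suc)
  finally have "(1 - 9 * \<epsilon>) * y \<le> real qmin + 1" .
  moreover have "1 \<le> \<epsilon> * y"
    using b_le_real n_pos b_pos unfolding y_def \<tau>_def
    by (intro le_eps_multI) (simp add: field_simps power2_eq_square)
  ultimately have "(1 - 10 * \<epsilon>) * y \<le> real qmin" by (simp add: algebra_simps)
  then show ?thesis by (simp only: y_def)
qed

lemma \<xi>_ge: "\<xi> \<ge> 25 / 16"
  unfolding \<xi>_def using b_power_le b_pos by (subst pos_le_divide_eq) auto

lemma \<rho>_power_le: "\<rho> ^ (k - 2) \<le> 107 / 100 * \<tau> ^ (k - 2)"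
proof -
  have "(1 + 6 * \<epsilon>) ^ (k - 2) \<le> exp (6 * \<epsilon>) ^ (k - 2)"
    using eps by (intro power_mono exp_ge_add_one_self) auto
  also have "\<dots> = exp (real (k - 2) * (6 * \<epsilon>))" by (rule exp_of_nat_mult[symmetric])
  also have "\<dots> \<le> exp (6 / 100)"
  proof -
    have "real (k - 2) * (6 * \<epsilon>) \<le> real k * (6 * \<epsilon>)" using eps by (intro mult_right_mono) auto
    moreover have "real k * (6 * \<epsilon>) = 6 / 100" using eps(3) by simp
    ultimately show ?thesis by (simp only: exp_le_cancel_iff)
  qed
  also have "\<dots> \<le> 1 + 6 / 100 + (6 / 100)\<^sup>2" by (rule exp_bound) auto
  also have "\<dots> \<le> (107 / 100 :: real)" by (simp add: power2_eq_square)
  finally have "(1 + 6 * \<epsilon>) ^ (k - 2) \<le> 107 / 100" .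
  then have "((1 + 6 * \<epsilon>) * \<tau>) ^ (k - 2) \<le> 107 / 100 * \<tau> ^ (k - 2)"
    unfolding power_mult_distrib using \<tau>_pos by (intro mult_right_mono) auto
  moreover have "\<rho> ^ (k - 2) \<le> ((1 + 6 * \<epsilon>) * \<tau>) ^ (k - 2)"
    using \<rho>_le \<rho>_ge_2 by (intro power_mono) auto
  ultimately show ?thesis by linarith
qed

lemma \<xi>_\<tau>_power_le: "\<xi> * \<tau> ^ (k - 2) \<le> real n / (4 * \<tau>)"
proof -
  obtain l where l: "k = l + 3" using k_ge_3 le_Suc_ex by (metis add.commute)
  have "(2::real) ^ 2 \<le> 2 ^ (l + 2)" by (intro power_increasing) auto
  then have "real n ^ 2 / (2 ^ (l + 2) * real b) \<le> real n ^ 2 / (4 * real b)"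
    using b_pos by (intro divide_left_mono mult_right_mono mult_pos_pos) auto
  moreover have "\<xi> * \<tau> ^ (k - 2) = real n ^ 2 / (2 ^ (l + 2) * real b)"
    using n_pos b_pos unfolding \<xi>_def \<tau>_def unfolding l
    by (simp add: power_mult_distrib power_divide power_add power3_eq_cube
        power2_eq_square field_simps)
  ultimately show ?thesis by (simp add: \<tau>_def power2_eq_square)
qed

lemma potential_suffices:
  "(real n * \<xi> + 101 / 100 * real n) * \<rho> ^ (k - 2) \<le> real qmin * real \<mu>"
proof -
  define y where "y = real n / (2 * \<tau>) * real n"
  have "real n * (101 / 100) \<le> real n * (65 / 100 * \<xi>)"
    using \<xi>_ge n_pos by (intro mult_left_mono) auto
  then have "real n * \<xi> + 101 / 100 * real n \<le> 165 / 100 * (real n * \<xi>)" by (simp add: mult_ac)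
  then have "(real n * \<xi> + 101 / 100 * real n) * \<rho> ^ (k - 2)
      \<le> 165 / 100 * (real n * \<xi>) * (107 / 100 * \<tau> ^ (k - 2))"
    using \<rho>_power_le n_pos \<xi>_ge \<rho>_ge_2 by (intro mult_mono) auto
  also have "\<dots> = 17655 / 10000 * (real n * (\<xi> * \<tau> ^ (k - 2)))" by simp
  also have "\<dots> \<le> 17655 / 10000 * (real n * (real n / (4 * \<tau>)))"
    using \<xi>_\<tau>_power_le n_pos by (intro mult_left_mono) auto
  also have "\<dots> = 17655 / 20000 * y" by (simp add: y_def)
  also have "\<dots> \<le> (1 - 10 * \<epsilon>) * (1 - 3 * \<epsilon>) * y"
  proof (rule mult_right_mono)
    have "1 - 13 * \<epsilon> \<le> (1 - 10 * \<epsilon>) * (1 - 3 * \<epsilon>)" by (simp add: algebra_simps)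
    then show "17655 / 20000 \<le> (1 - 10 * \<epsilon>) * (1 - 3 * \<epsilon>)" using eps by linarith
  qed (use \<tau>_pos in \<open>simp add: y_def\<close>)
  also have "\<dots> = ((1 - 10 * \<epsilon>) * (real n / (2 * \<tau>))) * ((1 - 3 * \<epsilon>) * real n)" by (simp add: y_def)
  also have "\<dots> \<le> real qmin * real \<mu>" using qmin_ge \<mu>_ge eps n_pos \<tau>_pos by (intro mult_mono) auto
  finally show ?thesis .
qed

sublocale level_potential k b "k * L" n M \<Delta> \<mu> \<rho> "real qmin * \<rho> * real \<mu>"
proof
  show "n \<le> k * L * \<Delta>"
    using dividend_less_div_times[of "k * L" n] k_ge_3 L_ge_300 by (simp add: \<Delta>_def mult.commute)
  have "k * L * n \<le> L * (L + 2) * n" by (intro mult_le_mono1) (simp add: L)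
  then show "k * L * n \<le> b" using b_ge by (rule order.trans)
  show "(k - 1) * (\<Delta> + 1) + \<mu> \<le> M" using damage_le_M by (simp add: \<mu>_def)
  show "real b + 1 \<le> (\<rho> - 1) * real \<mu>" using \<mu>_pos by (simp add: \<rho>_def)
qed (use k_ge_3 \<rho>_ge_2 in auto)

lemma level_losses_le: "real (b + k * L * n) \<le> 101 / 100 * real (b + 1)"
proof -
  have "real (k * L * n) = 1 / 100 * (real L * real L * real n)" by (simp add: L)
  also have "\<dots> \<le> 1 / 100 * (real L * (real L + 2) * real n)" by (simp add: algebra_simps)
  also have "\<dots> \<le> 1 / 100 * real b" using b_ge_real by simp
  finally show ?thesis by simp
qed

lemma star_rem_le_threshold:
  assumes "small_remainder k n b"
  shows "real (star_rem n b) * \<rho> ^ (k - 1) \<le> threshold (k - 1)"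
proof -
  have "k - 1 = Suc (k - 2)" using k_ge_3 by simp
  then have power: "\<rho> ^ (k - 1) = \<rho> ^ (k - 2) * \<rho>" by simp
  have "real (star_rem n b) \<le> real n * \<xi>"
    using assms unfolding small_remainder_def \<xi>_def by simp
  then have "(real (star_rem n b) + 101 / 100 * real \<mu>) * \<rho> ^ (k - 1)
      \<le> (real n * \<xi> + 101 / 100 * real n) * \<rho> ^ (k - 1)"
    using \<mu>_le \<rho>_pos by (intro mult_right_mono) auto
  also have "\<dots> = (real n * \<xi> + 101 / 100 * real n) * \<rho> ^ (k - 2) * \<rho>"
    unfolding power by (simp only: mult.assoc)
  also have "\<dots> \<le> real qmin * real \<mu> * \<rho>"
    using potential_suffices \<rho>_pos by (intro mult_right_mono) auto
  finally have "(real (star_rem n b) + 101 / 100 * real \<mu>) * \<rho> ^ (k - 1) \<le> real qmin * \<rho> * real \<mu>"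
    by (simp only: mult_ac)
  moreover have "real qmin * \<rho> * real \<mu> - 101 / 100 * real \<mu> * \<rho> ^ (k - 1) \<le> threshold (k - 1)"
    using level_losses_le \<mu>_pos by (intro threshold_ge[OF \<rho>_def]) auto
  ultimately show ?thesis by (simp add: algebra_simps)
qed

lemma enforcer_wins_small_remainder:
  assumes "small_remainder k n b"
  shows "wins_star_game Enforcer strict_moves k n b"
proof -
  interpret opening_phase k b "k * L" n M \<Delta> \<mu> \<rho> "real qmin * \<rho> * real \<mu>" L f qmax qmin
  proof
    show "n \<le> f * L"
      using dividend_less_div_times[of L n] L_ge_300 by (simp add: f_def)
    show "n choose 2 \<le> (qmax - 1) * (b + 1)"
      using dividend_less_div_times[of "b + 1" "n choose 2"] by (simp add: qmax_def)
    show "qmin * (b + 1) \<le> (n - 2 * qmax - f) choose 2"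
      unfolding qmin_def by (rule div_times_less_eq_dividend)
    show "M + (L + 2) * qmax \<le> n" using opening_loss_le_n by (simp add: M_def)
    show "n \<ge> 2" using L_le_n L_ge_300 by simp
  qed (use \<rho>_ge_2 star_rem_le_threshold[OF assms] in \<open>auto simp: f_def\<close>)
  show ?thesis by (rule enforcer_wins)
qed

end

section \<open>The scales of the bias\<close>

definition upper_scale :: "nat \<Rightarrow> nat \<Rightarrow> real" where
  "upper_scale k n = real n powr (real k / (real k - 1))"

definition lower_scale :: "nat \<Rightarrow> nat \<Rightarrow> real" where
  "lower_scale k n = real n powr ((real k + 1) / real k)"

lemma upper_scale_nonneg: "0 \<le> upper_scale k n"
  by (simp add: upper_scale_def)

lemma lower_scale_nonneg: "0 \<le> lower_scale k n"
  by (simp add: lower_scale_def)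

lemma powr_ratio_power:
  assumes "q > 0" "n > 0"
  shows "(real n powr (real p / real q)) ^ q = real n ^ p"
proof -
  have "(real n powr (real p / real q)) ^ q = real n powr (real p / real q * real q)"
    using assms powr_realpow[of "real n powr (real p / real q)" q] by (simp add: powr_powr)
  then show ?thesis using assms by (simp add: powr_realpow)
qed

lemma upper_scale_power:
  assumes "k \<ge> 2" "n > 0"
  shows "upper_scale k n ^ (k - 1) = real n ^ k"
  using powr_ratio_power[of "k - 1" n k] assms by (simp add: upper_scale_def of_nat_diff)

lemma lower_scale_power:
  assumes "k > 0" "n > 0"
  shows "lower_scale k n ^ k = real n ^ (k + 1)"
  using powr_ratio_power[of k n "k + 1"] assms by (simp add: lower_scale_def add.commute)

lemma lower_scale_le_upper_scale:
  assumes "k \<ge> 2"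
  shows "lower_scale k n \<le> upper_scale k n"
proof (cases "n = 0")
  case False
  have "(real k + 1) / real k \<le> real k / (real k - 1)" using assms by (simp add: field_simps)
  then show ?thesis
    unfolding upper_scale_def lower_scale_def using False by (intro powr_mono) auto
qed (simp add: upper_scale_def lower_scale_def)

lemma eventually_le_real: "\<forall>\<^sub>F n in sequentially. C \<le> real n"
  using filterlim_real_sequentially by (simp add: filterlim_at_top)

lemma eventually_linear_le_powr:
  fixes a C :: real
  assumes "a > 1"
  shows "\<forall>\<^sub>F n in sequentially. C * real n \<le> real n powr a"
proof -
  have "filterlim (\<lambda>n. real n powr (a - 1)) at_top sequentially" using assms by real_asymp
  then have "\<forall>\<^sub>F n in sequentially. C \<le> real n powr (a - 1)" by (simp add: filterlim_at_top)
  then show ?thesis using eventually_gt_at_top[of "0::nat"]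
  proof eventually_elim
    case (elim n)
    have "C * real n \<le> real n powr (a - 1) * real n" using elim by (intro mult_right_mono) auto
    also have "\<dots> = real n powr a" using elim powr_add[of "real n" "a - 1" 1] by simp
    finally show ?case .
  qed
qed

lemma eventually_linear_le_scales:
  assumes "k \<ge> 2"
  shows "\<forall>\<^sub>F n in sequentially.
    n > 0 \<and> C * real n \<le> lower_scale k n \<and> C * real n \<le> upper_scale k n"
proof (intro eventually_conj eventually_gt_at_top)
  show "\<forall>\<^sub>F n in sequentially. C * real n \<le> lower_scale k n"
    unfolding lower_scale_def
    using assms by (intro eventually_linear_le_powr) (simp add: field_simps)
  show "\<forall>\<^sub>F n in sequentially. C * real n \<le> upper_scale k n"
    unfolding upper_scale_def
    using assms by (intro eventually_linear_le_powr) (simp add: field_simps)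
qed

lemma eventually_upper_scale_le_square:
  assumes "k \<ge> 3"
  shows "\<forall>\<^sub>F n in sequentially. C * upper_scale k n \<le> real n ^ 2"
proof -
  have "\<forall>\<^sub>F n in sequentially. \<bar>C\<bar> * real n powr (3 / 2) \<le> real n ^ 2" by real_asymp
  then show ?thesis using eventually_gt_at_top[of "0::nat"]
  proof eventually_elim
    case (elim n)
    have "upper_scale k n \<le> real n powr (3 / 2)"
      unfolding upper_scale_def using assms elim by (intro powr_mono) (auto simp: field_simps)
    then have "\<bar>C\<bar> * upper_scale k n \<le> \<bar>C\<bar> * real n powr (3 / 2)" by (intro mult_left_mono) auto
    moreover have "C * upper_scale k n \<le> \<bar>C\<bar> * upper_scale k n"
      using upper_scale_nonneg by (intro mult_right_mono) auto
    ultimately show ?case using elim by linarith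
  qed
qed

subsection \<open>Biases above the scales\<close>

lemma avoider_wins_above_upper_scale:
  assumes "admissible_rule R" "k \<ge> 2" "n > 0" and b: "2 * upper_scale k n \<le> real (b + 1)"
  shows "wins_star_game Avoider R k n b"
proof (rule avoider_wins_if_level_bound_le_1[OF assms(1,2)])
  define q where "q = real (b + 1)"
  have "q > 0" by (simp add: q_def)
  have "(2 * upper_scale k n) ^ (k - 1) \<le> q ^ (k - 1)"
    using b upper_scale_nonneg by (intro power_mono) (auto simp: q_def)
  then have "2 ^ (k - 1) * real n ^ k \<le> q ^ (k - 1)"
    using upper_scale_power[OF assms(2,3)] by (simp add: power_mult_distrib)
  moreover have "real n ^ k = real n * real n ^ (k - 1)" using assms(2) by (cases k) auto
  ultimately show "level_bound n b (k - 1) \<le> 1"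
    using \<open>q > 0\<close> unfolding level_bound_def q_def[symmetric]
    by (simp add: power_divide power_mult_distrib field_simps)
qed

lemma level_bound_less_above_lower_scale:
  assumes "k \<ge> 1" "n > 0" and b: "2 * lower_scale k n < real (b + 1)"
  shows "real n * level_bound n b (k - 1) < real (b + 1) / 2"
proof -
  define q where "q = real (b + 1)"
  have "q > 0" by (simp add: q_def)
  have "(2 * lower_scale k n) ^ k < q ^ k"
    using b lower_scale_nonneg assms(1) by (intro power_strict_mono) (auto simp: q_def)
  then have "2 ^ k * real n ^ (k + 1) < q ^ k"
    using lower_scale_power[of k n] assms by (simp add: power_mult_distrib)
  moreover obtain l where "k = Suc l" using assms(1) by (cases k) auto
  ultimately show ?thesis
    using \<open>q > 0\<close> unfolding level_bound_def q_def[symmetric]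
    by (simp add: power_divide power_mult_distrib field_simps)
qed

lemma not_enforcer_wins_if_avoider_wins:
  assumes "admissible_rule R" "b \<ge> 1" "wins_star_game Avoider R k n b"
  shows "\<not> wins_star_game Enforcer R k n b"
  using avoider_wins_imp_not_enforcer_wins[OF assms(1) finite_complete_edges assms(2)] assms(3)
  by (simp add: wins_star_game_def)

lemma enforcer_wins_imp_le_upper_scale:
  assumes "admissible_rule R" "k \<ge> 2" "n > 0" "b \<ge> 1" "wins_star_game Enforcer R k n b"
  shows "real b \<le> 2 * upper_scale k n"
  using avoider_wins_above_upper_scale[OF assms(1-3)]
    not_enforcer_wins_if_avoider_wins[OF assms(1,4)] assms(5)
  by (cases "2 * upper_scale k n \<le> real (b + 1)") auto

subsection \<open>Biases below the scales\<close>

lemma ex_deg_ge_if_card_large: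
  assumes "G \<subseteq> complete_edges n" "k \<ge> 1"
    and small: "(b + 1) * (k - 1) < n - 1" and large: "n choose 2 \<le> card G * (b + 1)"
  shows "\<exists>v. k \<le> deg G v"
proof (rule ccontr)
  assume "\<not> (\<exists>v. k \<le> deg G v)"
  then have "deg G v < k" for v by (simp add: not_le)
  then have "deg G v \<le> k - 1" for v
    by (metis Suc_pred' assms(2) less_Suc_eq_le less_le_trans zero_less_one)
  then have "2 * card G \<le> n * (k - 1)" by (rule card_le_if_deg_le[OF assms(1)])
  then have "(b + 1) * (2 * card G) \<le> (b + 1) * (n * (k - 1))" by (rule mult_le_mono2)
  also have "\<dots> = n * ((b + 1) * (k - 1))" by (rule mult.left_commute)
  also have "\<dots> < n * (n - 1)" using small by (intro mult_strict_left_mono) auto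
  also have "\<dots> = 2 * (n choose 2)"
    unfolding choose_two by (intro dvd_mult_div_cancel[symmetric]) auto
  also have "\<dots> \<le> (b + 1) * (2 * card G)" using large by (simp add: algebra_simps)
  finally show False by simp
qed

lemma enforcer_wins_if_average_degree_large:
  assumes R: "admissible_rule R" and "k \<ge> 1" and small: "(b + 1) * (k - 1) < n - 1"
  shows "wins_star_game Enforcer R k n b"
proof (rule enforcer_wins_star_by_invariant[OF R \<open>k \<ge> 1\<close>,
      where I = "\<lambda>G U. n choose 2 \<le> card G * (b + 1) + card U"])
  show "n choose 2 \<le> card {} * (b + 1) + card (complete_edges n)" by (simp add: card_complete_edges)
next
  fix G assume "n choose 2 \<le> card G * (b + 1) + card ({} :: nat set set)"
    and pos: "position (complete_edges n) G {}"
  then have "n choose 2 \<le> card G * (b + 1)" by simp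
  then show "\<exists>v. k \<le> deg G v"
    using pos by (intro ex_deg_ge_if_card_large[OF _ \<open>k \<ge> 1\<close> small]) (auto simp: position_def)
next
  fix G U S
  assume total: "n choose 2 \<le> card G * (b + 1) + card U" and pos: "position (complete_edges n) G U"
    and S: "S \<subseteq> U" "S \<noteq> {}"
  have fin: "finite G" "finite U" "finite S"
    using position_complete_edges_finite[OF pos] S(1) finite_subset by auto
  obtain T where T: "T \<subseteq> U - S" "card T = min b (card (U - S))"
    by (meson min.cobounded2 obtain_subset_with_card_n)
  have "card U = card S + card (U - S)" "card (U - S) = card T + card (U - S - T)"
    using card_Un_disjoint[of S "U - S"] card_Un_disjoint[of T "U - S - T"]
      S(1) T(1) fin finite_subset[OF T(1)]
    by (simp_all add: Un_absorb1 Un_commute)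
  moreover have "card T \<le> b" using T(2) by simp
  moreover have "card (G \<union> S) = card G + card S"
    using pos S(1) fin by (intro card_Un_disjoint) (auto simp: position_def)
  moreover have "1 * b \<le> card S * b"
    using S(2) fin(3) by (intro mult_le_mono1) (simp add: card_gt_0_iff Suc_le_eq)
  ultimately have "n choose 2 \<le> card (G \<union> S) * (b + 1) + card (U - S - T)"
    using total by (simp only: add_mult_distrib add_mult_distrib2 mult_1_right)
  then show "\<exists>T\<in>R b (U - S). n choose 2 \<le> card (G \<union> S) * (b + 1) + card (U - S - T)"
    using admissible_ruleI[OF R T] by blast
qed

lemma two_blocks_linear_bias:
  fixes k n b m :: nat
  defines "K \<equiv> 8 * k ^ 2"
  assumes "k \<ge> 3" and nb: "n \<le> b * k" and n: "8 * k * K \<le> n" and m: "m = n div (4 * k\<^sup>2)"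
  shows "two_blocks k n b m" and "n \<le> K * m"
proof -
  have km: "4 * k\<^sup>2 * m \<le> n" by (simp add: m)
  have "1 * K \<le> 8 * k * K" using \<open>k \<ge> 3\<close> by (intro mult_le_mono1) simp
  then have "K \<le> n" using n by linarith
  then have "4 * k\<^sup>2 \<le> n" by (simp add: K_def)
  then have "1 \<le> m" unfolding m using \<open>k \<ge> 3\<close> by (simp add: div_greater_zero_iff Suc_le_eq)
  then have "4 * k\<^sup>2 * 1 \<le> 4 * k\<^sup>2 * m" by (intro mult_le_mono2)
  moreover have "n < m * (4 * k\<^sup>2) + 4 * k\<^sup>2"
    unfolding m using \<open>k \<ge> 3\<close> dividend_less_div_times[of "4 * k\<^sup>2" n] by simp
  moreover have "K * m = 4 * k\<^sup>2 * m + m * (4 * k\<^sup>2)" by (simp add: K_def)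
  ultimately show nm: "n \<le> K * m" by linarith
  show "two_blocks k n b m"
  proof
    have "4 * k * m * k = 4 * k\<^sup>2 * m" by (simp add: power2_eq_square)
    then have "4 * k * m * k \<le> b * k" using km nb by linarith
    then show "4 * k * m \<le> b" using \<open>k \<ge> 3\<close> by simp
    have "K * (8 * k) \<le> K * m" using n nm by (metis le_trans mult.commute)
    then show "8 * k \<le> m" using \<open>k \<ge> 3\<close> by (simp add: K_def)
    have "2 * m \<le> 4 * k\<^sup>2 * m"
      using \<open>k \<ge> 3\<close> by (intro mult_le_mono1) (simp add: power2_eq_square)
    then show "2 * m \<le> n" using km by linarith
  qed (rule \<open>k \<ge> 3\<close>)
qed

lemma enforcer_wins_linear_bias:
  fixes k n b C :: nat
  defines "K \<equiv> 8 * k ^ 2"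
  assumes "k \<ge> 3" and nb: "n \<le> b * k" and bn: "b \<le> C * n" and n: "8 * k * K \<le> n"
    and n_large: "2 * real C * (5 * real C * real K) ^ (k - 1) * real K ^ 2 \<le> real n"
  shows "wins_star_game Enforcer strict_moves k n b"
proof -
  define m where "m = n div (4 * k\<^sup>2)"
  interpret two_blocks k n b m
    using two_blocks_linear_bias(1)[OF \<open>k \<ge> 3\<close> nb _ m_def] n by (simp add: K_def)
  have nm: "n \<le> K * m"
    using two_blocks_linear_bias(2)[OF \<open>k \<ge> 3\<close> nb _ m_def] n by (simp add: K_def)
  have m_pos: "real m > 0" using m_ge_24 by simp
  have nm_real: "real n \<le> real K * real m" using of_nat_mono[OF nm, where 'a = real] by simp
  have bn_real: "real b \<le> real C * real n" using of_nat_mono[OF bn, where 'a = real] by simp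
  have "real C * real n \<le> real C * (real K * real m)" using nm_real by (intro mult_left_mono) auto
  then have "5 * real b / real m \<le> 5 * real C * real K"
    using bn_real m_pos by (simp add: pos_divide_le_eq)
  then have "2 * real b * (5 * real b / real m) ^ (k - 1)
      \<le> 2 * (real C * real n) * (5 * real C * real K) ^ (k - 1)"
    using bn_real by (intro mult_mono power_mono) auto
  then have "2 * real b * (5 * real b / real m) ^ (k - 1) * real K ^ 2
      \<le> 2 * (real C * real n) * (5 * real C * real K) ^ (k - 1) * real K ^ 2"
    by (rule mult_right_mono) simp
  also have "\<dots> = (2 * real C * (5 * real C * real K) ^ (k - 1) * real K ^ 2) * real n" by simp
  also have "\<dots> \<le> real n * real n" using n_large by (intro mult_right_mono) auto
  also have "\<dots> \<le> (real K * real m) * (real K * real m)" using nm_real by (intro mult_mono) auto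
  also have "\<dots> = real m ^ 2 * real K ^ 2" by (simp add: power2_eq_square)
  finally have "2 * real b * (5 * real b / real m) ^ (k - 1) \<le> real m ^ 2"
    using \<open>k \<ge> 3\<close> by (simp add: K_def)
  then show ?thesis by (rule enforcer_wins_strict_blocks)
qed

lemma enforcer_wins_superlinear_bias:
  assumes "k \<ge> 3" and L: "L = 100 * k" and "4 * L * (L + 2) \<le> n" "L * (L + 2) * n \<le> b"
    and square: "2 * real L * upper_scale k n \<le> real n ^ 2"
    and b: "real b \<le> 0.4 * upper_scale k n" and "small_remainder k n b"
  shows "wins_star_game Enforcer strict_moves k n b"
proof -
  have "n > 0" using assms(1,3) L by (cases n) auto
  interpret opening_parameters k n b L
  proof
    have "2 * real L * real b \<le> 2 * real L * upper_scale k n"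
      using b upper_scale_nonneg[of k n] by (intro mult_left_mono) auto
    then have "real (2 * L * b) \<le> real (n ^ 2)" using square by simp
    then show "2 * L * b \<le> n ^ 2" by (simp only: of_nat_le_iff)
    have "(2 * real b) ^ (k - 1) \<le> (0.8 * upper_scale k n) ^ (k - 1)"
      using b by (intro power_mono) auto
    also have "\<dots> = 0.8 ^ (k - 1) * real n ^ k"
      unfolding power_mult_distrib using upper_scale_power[of k n] assms(1) \<open>n > 0\<close> by simp
    also have "(0.8::real) ^ (k - 1) \<le> 0.8 ^ 2" using assms(1) by (intro power_decreasing) auto
    finally have "(2 * real b) ^ (k - 1) \<le> 0.8 ^ 2 * real n ^ k" by (simp add: mult_right_mono)
    then show "25 / 16 * (2 * real b) ^ (k - 1) \<le> real n ^ k" by (simp add: power2_eq_square)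
  qed (use assms in auto)
  show ?thesis by (rule enforcer_wins_small_remainder) fact
qed

lemma le_mult_if_diff_le:
  fixes k n b :: nat
  assumes "n - 1 \<le> (b + 1) * (k - 1)" "k * k \<le> n" "1 \<le> b" "1 \<le> k"
  shows "n \<le> b * k"
proof -
  obtain l where k: "k = Suc l" using assms(4) by (cases k) auto
  have n: "n \<le> b * l + l + 1" using assms(1) by (simp add: k)
  have "k \<le> b"
  proof (rule ccontr)
    assume "\<not> k \<le> b"
    then have "b * l \<le> l * l" by (intro mult_le_mono1) (simp add: k)
    moreover have "k * k = l * l + 2 * l + 1" by (simp add: k)
    ultimately show False using n assms(2,3) \<open>\<not> k \<le> b\<close> k by linarith
  qed
  then show ?thesis using n by (simp add: k)
qed

lemma enforcer_wins_strict_below_upper_scale: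
  fixes k n b L K C :: nat
  defines "L \<equiv> 100 * k" and "K \<equiv> 8 * k ^ 2" and "C \<equiv> L * (L + 2)"
  assumes "k \<ge> 3" and n: "4 * L * (L + 2) \<le> n" "8 * k * K \<le> n"
    "2 * real C * (5 * real C * real K) ^ (k - 1) * real K ^ 2 \<le> real n"
    and square: "2 * real L * upper_scale k n \<le> real n ^ 2"
    and b: "1 \<le> b" "real b \<le> 0.4 * upper_scale k n" "small_remainder k n b"
  shows "wins_star_game Enforcer strict_moves k n b"
proof -
  consider (small) "(b + 1) * (k - 1) < n - 1"
    | (medium) "n - 1 \<le> (b + 1) * (k - 1)" "b \<le> C * n" | (large) "C * n \<le> b" by linarith
  then show ?thesis
  proof cases
    case small
    then show ?thesis
      using \<open>k \<ge> 3\<close> by (intro enforcer_wins_if_average_degree_large admissible_rule_strict) auto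
  next
    case medium
    have "1 * K \<le> 8 * k * K" using \<open>k \<ge> 3\<close> by (intro mult_le_mono1) simp
    then have "K \<le> n" using n(2) by linarith
    then have "k * k \<le> n" by (simp add: K_def power2_eq_square)
    then have "n \<le> b * k" using le_mult_if_diff_le[OF medium(1) _ b(1)] \<open>k \<ge> 3\<close> by simp
    then show ?thesis
      using enforcer_wins_linear_bias[OF \<open>k \<ge> 3\<close> _ medium(2)] n(2,3) by (simp add: K_def)
  next
    case large
    then show ?thesis
      using enforcer_wins_superlinear_bias[OF \<open>k \<ge> 3\<close> _ n(1) _ square b(2,3)]
      by (simp add: C_def L_def)
  qed
qed

lemma eventually_enforcer_wins_strict:
  assumes "k \<ge> 3"
  shows "\<forall>\<^sub>F n in sequentially. \<forall>b. 1 \<le> b \<and> real b \<le> 0.4 * upper_scale k n \<and>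
    small_remainder k n b \<longrightarrow> wins_star_game Enforcer strict_moves k n b"
proof -
  define L where "L = 100 * k"
  define K where "K = 8 * k ^ 2"
  define C where "C = L * (L + 2)"
  have "\<forall>\<^sub>F n in sequentially. real (4 * L * (L + 2)) \<le> real n" by (rule eventually_le_real)
  moreover have "\<forall>\<^sub>F n in sequentially. real (8 * k * K) \<le> real n" by (rule eventually_le_real)
  moreover have "\<forall>\<^sub>F n in sequentially.
    2 * real C * (5 * real C * real K) ^ (k - 1) * real K ^ 2 \<le> real n" by (rule eventually_le_real)
  moreover have "\<forall>\<^sub>F n in sequentially. 2 * real L * upper_scale k n \<le> real n ^ 2"
    using assms by (rule eventually_upper_scale_le_square)
  ultimately show ?thesis
  proof eventually_elim
    case (elim n)
    then have "4 * L * (L + 2) \<le> n" "8 * k * K \<le> n" by (simp_all only: of_nat_le_iff)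
    with elim show ?case
      using enforcer_wins_strict_below_upper_scale[OF assms] by (simp only: L_def K_def C_def) blast
  qed
qed

lemma enforcer_wins_monotone_below_upper_scale:
  assumes "k \<ge> 3" and n: "24 * k \<le> n" and nb: "2 * k * n \<le> b"
    and b: "real b \<le> upper_scale k n / 180"
  shows "wins_star_game Enforcer monotone_moves k n b"
proof -
  define m where "m = n div 2"
  have "n > 0" using n assms(1) by simp
  have m: "2 * m \<le> n" "n \<le> 3 * m" using n assms(1) by (auto simp: m_def)
  interpret two_blocks k n b m
  proof
    have "2 * k * (2 * m) \<le> 2 * k * n" using m(1) by (intro mult_le_mono2)
    moreover have "4 * k * m = 2 * k * (2 * m)" by simp
    ultimately show "4 * k * m \<le> b" using nb by linarith
  qed (use assms(1) n m in auto)
  have "5 * real b / real m \<le> (5 * (upper_scale k n / 180)) / (real n / 3)"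
    using b m \<open>n > 0\<close> upper_scale_nonneg[of k n] by (intro frac_le) auto
  then have "5 * real b / real m \<le> upper_scale k n / (12 * real n)" by simp
  then have "(5 * real b / real m) ^ (k - 1) \<le> (upper_scale k n / (12 * real n)) ^ (k - 1)"
    by (intro power_mono) auto
  also have "\<dots> = real n ^ k / (12 ^ (k - 1) * real n ^ (k - 1))"
    using upper_scale_power[of k n] assms(1) \<open>n > 0\<close> by (simp add: power_divide power_mult_distrib)
  also have "\<dots> = real n / 12 ^ (k - 1)"
    using \<open>n > 0\<close> assms(1) power_minus_mult[of k "real n"] by (simp add: field_simps)
  also have "\<dots> \<le> real n / 12 ^ 1" using assms(1) by (intro divide_left_mono power_increasing) auto
  finally have "2 * (5 * real b / real m) ^ (k - 1) \<le> real m" using m(2) by simp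
  then show ?thesis using nb by (intro enforcer_wins_monotone_blocks) auto
qed

section \<open>Biases with extreme remainders\<close>

lemma div_div_bounds:
  fixes N Q :: nat
  assumes "0 < Q" "Q \<le> N"
  shows "0 < N div Q" "Q \<le> N div (N div Q)" "N div (N div Q) < 2 * Q"
proof -
  show pos: "0 < N div Q" using assms by (simp add: div_greater_zero_iff)
  have "Q * (N div Q) \<le> N" by simp
  then show "Q \<le> N div (N div Q)" using pos by (simp add: less_eq_div_iff_mult_less_eq)
  have "N < (N div Q) * Q + Q" using dividend_less_div_times[OF assms(1), of N] by simp
  also have "\<dots> \<le> (N div Q) * Q + (N div Q) * Q" using pos by simp
  finally show "N div (N div Q) < 2 * Q" using pos by (simp add: div_less_iff_less_mult mult_ac)
qed

lemma ex_bias_small_star_rem: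
  assumes "n \<ge> 2" "0 < Q" "Q \<le> (n choose 2) - 1" "((n choose 2) - 1) div Q \<le> Q"
  obtains b where "Q \<le> b + 1" "b + 1 < 2 * Q" "star_rem n b \<le> ((n choose 2) - 1) div Q"
proof -
  define N where "N = (n choose 2) - 1"
  define p where "p = N div Q"
  define b where "b = N div p - 1"
  have p: "0 < p" "Q \<le> N div p" "N div p < 2 * Q"
    using div_div_bounds[of Q N] assms(2,3) by (simp_all add: p_def N_def)
  then have b: "b + 1 = N div p" using assms(2) by (simp add: b_def)
  have "p \<le> Q" using assms(4) by (simp add: p_def N_def)
  then have "N mod p < b + 1" using p(2) mod_less_divisor[OF p(1), of N] b by linarith
  moreover have "N = p * (b + 1) + N mod p" unfolding b by simp
  ultimately have "N mod (b + 1) = N mod p" by (metis mod_less mod_mult_self3)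
  then have "star_rem n b \<le> p"
    using star_rem_eq_mod[OF assms(1), of b] mod_less_divisor[OF p(1), of N] by (simp add: N_def)
  then show thesis using that[of b] p b by (simp add: p_def N_def)
qed

lemma ex_bias_large_star_rem:
  assumes "n \<ge> 2" "0 < Q" "Q \<le> n choose 2" "2 * ((n choose 2) div Q) \<le> Q"
  obtains b where "Q \<le> b" "b < 2 * Q" "b + 1 \<le> 2 * star_rem n b"
proof -
  define N where "N = n choose 2"
  define p where "p = N div Q"
  define b where "b = N div p"
  have b: "0 < p" "Q \<le> b" "b < 2 * Q"
    using div_div_bounds[of Q N] assms(2,3) by (simp_all add: b_def p_def N_def)
  have p_le: "2 * p \<le> b" using assms(4) b(2) by (simp add: p_def N_def)
  define r where "r = b + 1 - (p - N mod p)"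
  have "N = p * b + N mod p" by (simp add: b_def)
  moreover have "N mod p < p" using b(1) by simp
  moreover have "(p - 1) * (b + 1) + (b + 1) = p * b + p" using b(1) by (cases p) auto
  ultimately have "N = (p - 1) * (b + 1) + r" "r \<le> b + 1" "b + 1 \<le> r + p"
    unfolding r_def using p_le by linarith+
  note r = this
  have "star_rem n b = r"
  proof (rule star_rem_eqI[OF assms(1) _ _ r(2)])
    show "n choose 2 = (p - 1) * (b + 1) + r" using r(1) by (simp only: N_def)
    show "1 \<le> r" using r(3) p_le b(1) by linarith
  qed
  then show thesis using that[of b] b r(3) p_le by simp
qed

lemma choose_two_div_le:
  assumes "N \<le> n choose 2" "c * real n \<le> real Q" "c > 0" "n > 0"
  shows "real (N div Q) \<le> real n / (2 * c)"
proof -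
  have "real (N div Q) \<le> real N / real Q" by (rule of_nat_div_le_of_nat)
  also have "\<dots> \<le> (real n ^ 2 / 2) / (c * real n)"
  proof (rule frac_le)
    show "real N \<le> real n ^ 2 / 2"
      using assms(1) real_choose_two_le[of n] by (meson of_nat_mono order.trans)
  qed (use assms in auto)
  also have "\<dots> = real n / (2 * c)" using assms(3,4) by (simp add: power2_eq_square)
  finally show ?thesis .
qed

lemma choose_two_ge: "n \<ge> 2 \<Longrightarrow> real n ^ 2 / 4 \<le> real (n choose 2)"
  by (simp add: real_choose_two power2_eq_square field_simps)

section \<open>Threshold biases\<close>

lemma theta_infinitely_oftenI: "f \<in> \<Theta>(g) \<Longrightarrow> theta_infinitely_often f g"
  unfolding theta_infinitely_often_def by (intro exI[of _ "\<lambda>i. i"]) (auto simp: strict_mono_def)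

lemma bigo_realI:
  assumes "\<forall>\<^sub>F n in F. real (f n) \<le> C * g n" "\<And>n. 0 \<le> g n"
  shows "(\<lambda>n. real (f n)) \<in> O[F](g)"
  using assms by (intro bigoI[of _ C]) auto

lemma bigomega_realI:
  assumes "\<forall>\<^sub>F n in F. C * g n \<le> real (f n)" "C > 0" "\<And>n. 0 \<le> g n"
  shows "(\<lambda>n. real (f n)) \<in> \<Omega>[F](g)"
  using assms by (intro landau_omega.bigI[of C]) auto

context
  fixes k :: nat
  assumes k_ge_3: "k \<ge> 3"
begin

lemma k_ge_2: "k \<ge> 2"
  using k_ge_3 by simp

lemma eventually_ex_small_remainder:
  "\<forall>\<^sub>F n in sequentially.
    \<exists>b\<ge>1. upper_scale k n / 20 \<le> real b \<and> real b \<le> 0.4 * upper_scale k n \<and> small_remainder k n b"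
  using eventually_linear_le_scales[OF k_ge_2, of 100]
    eventually_upper_scale_le_square[OF k_ge_3, of 4] eventually_ge_at_top[of "5::nat"]
proof eventually_elim
  case (elim n)
  have scale: "100 * real n \<le> upper_scale k n" "real n \<ge> 5" using elim by auto
  define Q where "Q = nat \<lceil>upper_scale k n / 10\<rceil>"
  have Q: "upper_scale k n / 10 \<le> real Q" "real Q \<le> upper_scale k n / 10 + 1"
    unfolding Q_def using scale by linarith+
  have "upper_scale k n \<le> real (n choose 2)" using choose_two_ge[of n] elim by simp
  then have "Q \<le> (n choose 2) - 1" using Q scale by linarith
  moreover have "real (((n choose 2) - 1) div Q) \<le> real n / (2 * 10)"
    using Q scale by (intro choose_two_div_le) auto
  then have few: "((n choose 2) - 1) div Q < n" using scale by simp
  moreover have "n \<le> Q" using Q scale by linarith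
  ultimately have Q': "2 \<le> n" "0 < Q" "Q \<le> (n choose 2) - 1" "((n choose 2) - 1) div Q \<le> Q" "n \<le> Q"
    using elim(3) by linarith+
  obtain b where b: "Q \<le> b + 1" "b + 1 < 2 * Q" "star_rem n b \<le> ((n choose 2) - 1) div Q"
    using ex_bias_small_star_rem[OF Q'(1-4)] by blast
  have "b \<ge> 1" using b(1) Q'(5) elim(3) by simp
  have b_upper: "real b \<le> 0.4 * upper_scale k n" "upper_scale k n / 20 \<le> real b"
    using b Q scale by linarith+
  have "(2 * real b) ^ (k - 1) \<le> upper_scale k n ^ (k - 1)" using b_upper by (intro power_mono) auto
  then have "real n * (2 * real b) ^ (k - 1) \<le> real n * real n ^ k"
    using upper_scale_power[of k n] k_ge_3 elim(3) by (intro mult_left_mono) auto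
  then have "real n \<le> real n ^ (k + 1) / (2 * real b) ^ (k - 1)"
    using \<open>b \<ge> 1\<close> by (subst pos_le_divide_eq) auto
  then have "small_remainder k n b" unfolding small_remainder_def using b(3) few by linarith
  then show ?case using \<open>b \<ge> 1\<close> b_upper by blast
qed

lemma eventually_ex_avoider_wins:
  "\<forall>\<^sub>F n in sequentially.
    \<exists>b\<ge>1. real b \<le> 6 * lower_scale k n \<and> wins_star_game Avoider strict_moves k n b"
  using eventually_linear_le_scales[OF k_ge_2, of 4]
    eventually_upper_scale_le_square[OF k_ge_3, of 20] eventually_ge_at_top[of "5::nat"]
proof eventually_elim
  case (elim n)
  have scale: "4 * real n \<le> lower_scale k n" "real n \<ge> 5" "20 * lower_scale k n \<le> real n ^ 2"
    using elim lower_scale_le_upper_scale[OF k_ge_2, of n] by auto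
  define Q where "Q = nat \<lceil>2 * lower_scale k n\<rceil>"
  have Q: "2 * lower_scale k n \<le> real Q" "real Q \<le> 2 * lower_scale k n + 1"
    unfolding Q_def using scale by linarith+
  have "Q > 0" using Q scale by linarith
  moreover have "Q \<le> n choose 2"
  proof -
    have "real Q \<le> real n ^ 2 / 4" using Q scale by linarith
    then have "real Q \<le> real (n choose 2)" using choose_two_ge[of n] elim(3) by linarith
    then show ?thesis by simp
  qed
  moreover have "real ((n choose 2) div Q) \<le> real n / (2 * 8)"
    using Q scale by (intro choose_two_div_le) auto
  then have "2 * ((n choose 2) div Q) \<le> Q" using Q scale by linarith
  ultimately obtain b where b: "Q \<le> b" "b < 2 * Q" "b + 1 \<le> 2 * star_rem n b"
    using ex_bias_large_star_rem[of n Q] elim(3) by auto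
  have "real n * level_bound n b (k - 1) < real (b + 1) / 2"
    using k_ge_3 elim(3) b(1) Q by (intro level_bound_less_above_lower_scale) auto
  also have "\<dots> \<le> real (star_rem n b)" using of_nat_mono[OF b(3), where 'a = real] by simp
  finally have "wins_star_game Avoider strict_moves k n b"
    using k_ge_3 elim(3) by (intro avoider_wins_strict_if_star_rem_large) auto
  moreover have "real b \<le> 6 * lower_scale k n" using b(2) Q scale by linarith
  moreover have "b \<ge> 1" using b(1) \<open>Q > 0\<close> by simp
  ultimately show ?case by blast
qed

subsection \<open>The monotone threshold bias\<close>

lemma enforcer_wins_monotone_iff:
  assumes "n > 0" "b \<ge> 1"
  shows "wins_star_game Enforcer monotone_moves k n b \<longleftrightarrow> b \<le> f_mon k n"
proof -
  let ?wins = "wins_star_game Enforcer monotone_moves k n"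
  define W where "W = insert 0 {b. 1 \<le> b \<and> ?wins b}"
  have "b \<le> nat \<lfloor>2 * upper_scale k n\<rfloor>" if "b \<in> W" for b
    using that enforcer_wins_imp_le_upper_scale[OF admissible_rule_monotone k_ge_2 assms(1)]
    by (auto simp: W_def le_nat_floor)
  then have fin: "finite W" by (meson finite_nat_set_iff_bounded_le)
  have iff: "?wins b \<longleftrightarrow> b \<le> Max W" if "b \<ge> 1" for b
  proof
    assume "?wins b"
    then show "b \<le> Max W" using that fin by (intro Max_ge) (auto simp: W_def)
  next
    assume "b \<le> Max W"
    moreover have "Max W \<in> W" using fin by (intro Max_in) (auto simp: W_def)
    ultimately have "?wins (Max W)" using that by (auto simp: W_def)
    then show "?wins b"
      using enforcer_wins_monotone_antimono \<open>b \<le> Max W\<close> unfolding wins_star_game_def by blast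
  qed
  have "f_mon k n = Max W"
    unfolding f_mon_def
  proof (rule Greatest_equality)
    show "y \<le> Max W" if "\<forall>b\<ge>1. ?wins b \<longleftrightarrow> b \<le> y" for y
      using that iff[of y] by (cases "y \<ge> 1") auto
  qed (use iff in blast)
  then show ?thesis using iff assms(2) by simp
qed

lemma f_mon_bigo: "(\<lambda>n. real (f_mon k n)) \<in> O(upper_scale k)"
proof (rule bigo_realI[where C = 2])
  show "\<forall>\<^sub>F n in sequentially. real (f_mon k n) \<le> 2 * upper_scale k n"
    using eventually_gt_at_top[of "0::nat"]
  proof eventually_elim
    case (elim n)
    then show ?case
      using enforcer_wins_monotone_iff[of n "f_mon k n"] upper_scale_nonneg[of k n]
        enforcer_wins_imp_le_upper_scale[OF admissible_rule_monotone k_ge_2 elim]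
      by (cases "f_mon k n \<ge> 1") auto
  qed
qed (rule upper_scale_nonneg)

lemma f_mon_bigomega: "(\<lambda>n. real (f_mon k n)) \<in> \<Omega>(upper_scale k)"
proof (rule bigomega_realI[where C = "1 / 360"])
  show "\<forall>\<^sub>F n in sequentially. 1 / 360 * upper_scale k n \<le> real (f_mon k n)"
    using eventually_linear_le_scales[OF k_ge_2, of "360 * (2 * real k + 1)"]
      eventually_ge_at_top[of "24 * k"]
  proof eventually_elim
    case (elim n)
    define b where "b = nat \<lfloor>upper_scale k n / 180\<rfloor>"
    have b: "real b \<le> upper_scale k n / 180" "upper_scale k n / 180 - 1 < real b"
      unfolding b_def using upper_scale_nonneg[of k n] by linarith+
    have "360 * (2 * real k * real n) + 360 * real n \<le> upper_scale k n"
      using elim by (simp add: algebra_simps)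
    moreover have "0 \<le> 2 * real k * real n" "1 \<le> real n" using elim by auto
    ultimately have large: "360 \<le> upper_scale k n" "2 * real k * real n \<le> real b"
      using b by linarith+
    then have "real (2 * k * n) \<le> real b" by simp
    then have "2 * k * n \<le> b" by (simp only: of_nat_le_iff)
    then have "wins_star_game Enforcer monotone_moves k n b"
      using enforcer_wins_monotone_below_upper_scale[OF k_ge_3 elim(2)] b(1) by blast
    moreover have "b \<ge> 1" using b large by linarith
    ultimately have "b \<le> f_mon k n" using enforcer_wins_monotone_iff elim by blast
    then show ?case using b large by linarith
  qed
qed (auto simp: upper_scale_nonneg)

subsection \<open>The upper and the lower threshold bias\<close>

lemma f_plus:
  assumes "n > 0"
  shows f_plus_le: "real (f_plus k n) \<le> 2 * upper_scale k n"
    and avoider_wins_if_f_plus_less: "f_plus k n < b \<Longrightarrow> wins_star_game Avoider strict_moves k n b"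
proof -
  let ?P = "\<lambda>f. \<forall>b>f. wins_star_game Avoider strict_moves k n b"
  define f where "f = nat \<lfloor>2 * upper_scale k n\<rfloor>"
  have "2 * upper_scale k n \<le> real (b + 1)" if "f < b" for b using that unfolding f_def by linarith
  then have P: "?P f"
    using avoider_wins_above_upper_scale[OF admissible_rule_strict k_ge_2 assms] by blast
  then have "f_plus k n \<le> f" unfolding f_plus_def by (rule Least_le)
  then show "real (f_plus k n) \<le> 2 * upper_scale k n"
    unfolding f_def using upper_scale_nonneg[of k n] by linarith
  show "wins_star_game Avoider strict_moves k n b" if "f_plus k n < b"
    using LeastI[of ?P, OF P] that unfolding f_plus_def by blast
qed

lemma le_f_plus:
  assumes "n > 0" "b \<ge> 1" "wins_star_game Enforcer strict_moves k n b"
  shows "b \<le> f_plus k n"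
  using avoider_wins_if_f_plus_less[OF assms(1)] assms(3)
    not_enforcer_wins_if_avoider_wins[OF admissible_rule_strict assms(2)] by (meson not_le)

lemma f_minus:
  assumes "n > 0"
  shows enforcer_wins_if_le_f_minus:
      "1 \<le> b \<Longrightarrow> b \<le> f_minus k n \<Longrightarrow> wins_star_game Enforcer strict_moves k n b"
    and le_f_minus:
      "(\<And>b. 1 \<le> b \<Longrightarrow> b \<le> f \<Longrightarrow> wins_star_game Enforcer strict_moves k n b) \<Longrightarrow> f \<le> f_minus k n"
proof -
  let ?P = "\<lambda>f. \<forall>b\<ge>1. b \<le> f \<longrightarrow> wins_star_game Enforcer strict_moves k n b"
  have bounded: "f \<le> nat \<lfloor>2 * upper_scale k n\<rfloor>" if "?P f" for f
    using that enforcer_wins_imp_le_upper_scale[OF admissible_rule_strict k_ge_2 assms, of f]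
    by (cases "f \<ge> 1") (auto simp: le_nat_floor)
  have "?P (f_minus k n)"
    unfolding f_minus_def by (rule GreatestI_nat[of ?P 0]) (use bounded in auto)
  then show "1 \<le> b \<Longrightarrow> b \<le> f_minus k n \<Longrightarrow> wins_star_game Enforcer strict_moves k n b" by blast
  assume "\<And>b. 1 \<le> b \<Longrightarrow> b \<le> f \<Longrightarrow> wins_star_game Enforcer strict_moves k n b"
  then have "?P f" by blast
  then show "f \<le> f_minus k n"
    unfolding f_minus_def using bounded by (rule Greatest_le_nat)
qed

lemma f_plus_bigo: "(\<lambda>n. real (f_plus k n)) \<in> O(upper_scale k)"
  by (rule bigo_realI[where C = 2])
    (use f_plus_le upper_scale_nonneg in \<open>auto intro: eventually_mono[OF eventually_gt_at_top[of 0]]\<close>)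

lemma f_plus_bigomega: "(\<lambda>n. real (f_plus k n)) \<in> \<Omega>(upper_scale k)"
proof (rule bigomega_realI[where C = "1 / 20"])
  show "\<forall>\<^sub>F n in sequentially. 1 / 20 * upper_scale k n \<le> real (f_plus k n)"
    using eventually_gt_at_top[of "0::nat"] eventually_enforcer_wins_strict[OF k_ge_3]
      eventually_ex_small_remainder
  proof eventually_elim
    case (elim n)
    then obtain b where "b \<ge> 1" "upper_scale k n / 20 \<le> real b"
      "wins_star_game Enforcer strict_moves k n b"
      by blast
    moreover then have "b \<le> f_plus k n" using le_f_plus elim(1) by blast
    ultimately show ?case by linarith
  qed
qed (auto simp: upper_scale_nonneg)

lemma f_minus_bigo: "(\<lambda>n. real (f_minus k n)) \<in> O(lower_scale k)"
proof (rule bigo_realI[where C = 6])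
  show "\<forall>\<^sub>F n in sequentially. real (f_minus k n) \<le> 6 * lower_scale k n"
    using eventually_gt_at_top[of "0::nat"] eventually_ex_avoider_wins
  proof eventually_elim
    case (elim n)
    then obtain b where b: "b \<ge> 1" "real b \<le> 6 * lower_scale k n"
      "wins_star_game Avoider strict_moves k n b"
      by blast
    then have "f_minus k n \<le> b"
      using enforcer_wins_if_le_f_minus[OF elim(1)]
        not_enforcer_wins_if_avoider_wins[OF admissible_rule_strict]
      by (meson nat_le_linear)
    then show ?case using b(2) by linarith
  qed
qed (rule lower_scale_nonneg)

subsection \<open>Biases with small remainders\<close>

definition plus_biases :: "nat \<Rightarrow> nat set" where
  "plus_biases n = {b. 1 \<le> b \<and> real b \<le> 0.4 * upper_scale k n \<and> small_remainder k n b}"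

definition minus_biases :: "nat \<Rightarrow> nat set" where
  "minus_biases n = {b. 1 \<le> b \<and> real b \<le> 0.4 * upper_scale k n \<and>
     (\<forall>b'. 1 \<le> b' \<and> b' \<le> b \<longrightarrow> small_remainder k n b')}"

lemma e_plus_eq: "e_plus k n = Max (plus_biases n)"
  by (simp add: e_plus_def plus_biases_def upper_scale_def)

lemma e_minus_eq: "e_minus k n = Max (minus_biases n)"
  by (simp add: e_minus_def minus_biases_def upper_scale_def)

lemma minus_biases_subset: "minus_biases n \<subseteq> plus_biases n"
  by (auto simp: minus_biases_def plus_biases_def)

lemma finite_plus_biases: "finite (plus_biases n)"
  by (rule finite_subset[of _ "{..nat \<lfloor>0.4 * upper_scale k n\<rfloor>}"])
    (auto simp: plus_biases_def le_nat_floor)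

lemma finite_minus_biases: "finite (minus_biases n)"
  using minus_biases_subset finite_plus_biases by (rule finite_subset)

lemma small_remainder_if_less_lower_scale:
  assumes "n \<ge> 2" "1 \<le> b" "2 * real b < lower_scale k n"
  shows "small_remainder k n b"
proof -
  have "star_rem n b \<le> 2 * b" using star_rem_bounds(2)[OF assms(1), of b] assms(2) by simp
  then have "real (star_rem n b) * (2 * real b) ^ (k - 1) \<le> 2 * real b * (2 * real b) ^ (k - 1)"
    by (intro mult_right_mono) auto
  also have "\<dots> = (2 * real b) ^ k" using k_ge_3 by (cases k) auto
  also have "\<dots> < lower_scale k n ^ k" using assms(3) k_ge_3 by (intro power_strict_mono) auto
  also have "\<dots> = real n ^ (k + 1)" using lower_scale_power k_ge_3 assms(1) by simp
  finally show ?thesis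
    unfolding small_remainder_def using assms(2) by (subst pos_less_divide_eq) auto
qed

lemma floor_lower_scale_in_minus_biases:
  assumes "n \<ge> 2" "1 \<le> 0.4 * lower_scale k n"
  shows "nat \<lfloor>0.4 * lower_scale k n\<rfloor> \<in> minus_biases n"
proof -
  define b where "b = nat \<lfloor>0.4 * lower_scale k n\<rfloor>"
  have b: "b \<ge> 1" "real b \<le> 0.4 * lower_scale k n" unfolding b_def using assms(2) by linarith+
  then have "small_remainder k n b'" if "1 \<le> b'" "b' \<le> b" for b'
    using that assms by (intro small_remainder_if_less_lower_scale) auto
  moreover have "real b \<le> 0.4 * upper_scale k n"
    using b(2) lower_scale_le_upper_scale[OF k_ge_2, of n] by simp
  ultimately show ?thesis using b(1) unfolding minus_biases_def b_def by blast
qed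

lemma eventually_minus_biases_nonempty:
  "\<forall>\<^sub>F n in sequentially. n > 0 \<and> nat \<lfloor>0.4 * lower_scale k n\<rfloor> \<in> minus_biases n \<and> 5 \<le> lower_scale k n"
  using eventually_linear_le_scales[OF k_ge_2, of 5] eventually_ge_at_top[of "2::nat"]
proof eventually_elim
  case (elim n)
  then have "5 \<le> lower_scale k n" by linarith
  then show ?case using elim floor_lower_scale_in_minus_biases[of n] by simp
qed

lemma e_minus_bigomega: "(\<lambda>n. real (e_minus k n)) \<in> \<Omega>(lower_scale k)"
proof (rule bigomega_realI[where C = "1 / 5"])
  show "\<forall>\<^sub>F n in sequentially. 1 / 5 * lower_scale k n \<le> real (e_minus k n)"
    using eventually_minus_biases_nonempty
  proof eventually_elim
    case (elim n)
    then have "nat \<lfloor>0.4 * lower_scale k n\<rfloor> \<le> e_minus k n"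
      unfolding e_minus_eq using finite_minus_biases by (intro Max_ge) auto
    then show ?case using elim by linarith
  qed
qed (auto simp: lower_scale_nonneg)

lemma e_plus_le_f_plus: "\<forall>\<^sub>F n in sequentially. e_plus k n \<le> f_plus k n"
  using eventually_enforcer_wins_strict[OF k_ge_3] eventually_minus_biases_nonempty
proof eventually_elim
  case (elim n)
  have "plus_biases n \<noteq> {}" using elim(2) minus_biases_subset by blast
  then have "e_plus k n \<in> plus_biases n" unfolding e_plus_eq
    using finite_plus_biases by (rule Max_in[rotated])
  then show ?case using elim by (intro le_f_plus) (auto simp: plus_biases_def)
qed

lemma e_minus_le_f_minus: "\<forall>\<^sub>F n in sequentially. e_minus k n \<le> f_minus k n"
  using eventually_enforcer_wins_strict[OF k_ge_3] eventually_minus_biases_nonempty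
proof eventually_elim
  case (elim n)
  have "minus_biases n \<noteq> {}" using elim(2) by blast
  then have e: "e_minus k n \<in> minus_biases n"
    unfolding e_minus_eq using finite_minus_biases by (rule Max_in[rotated])
  show ?case
  proof (rule le_f_minus)
    fix b assume b: "1 \<le> b" "b \<le> e_minus k n"
    then have "real b \<le> 0.4 * upper_scale k n" "small_remainder k n b"
      using e by (auto simp: minus_biases_def)
    then show "wins_star_game Enforcer strict_moves k n b" using elim(1) b(1) by blast
  qed (use elim(2) in simp)
qed

lemma f_minus_bigomega: "(\<lambda>n. real (f_minus k n)) \<in> \<Omega>(lower_scale k)"
proof -
  have "(\<lambda>n. real (f_minus k n)) \<in> \<Omega>(\<lambda>n. real (e_minus k n))"
    using e_minus_le_f_minus by (intro bigomega_realI[where C = 1]) (auto elim: eventually_mono)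
  then show ?thesis using e_minus_bigomega by (rule landau_omega.big_trans)
qed

lemma lower_scale_bigo_log: "lower_scale k \<in> O(\<lambda>n. lower_scale k n * ln (real n))"
proof (rule bigoI[where c = 1])
  have "\<forall>\<^sub>F n in sequentially. 1 \<le> ln (real n)" by real_asymp
  then show "\<forall>\<^sub>F n in sequentially. norm (lower_scale k n) \<le> 1 * norm (lower_scale k n * ln (real n))"
  proof eventually_elim
    case (elim n)
    then show ?case
      using mult_left_mono[OF elim lower_scale_nonneg[of k n]] lower_scale_nonneg[of k n] by simp
  qed
qed

end

theorem theorem1:
  fixes k :: nat
  assumes "k \<ge> 3"
  shows
    "(\<lambda>n. real (f_mon k n)) \<in> \<Theta>(\<lambda>n. real n powr (real k / (real k - 1)))
     \<and>
     ((\<forall>\<^sub>F n in sequentially. e_plus k n \<le> f_plus k n)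
      \<and> (\<lambda>n. real (f_plus k n)) \<in> O(\<lambda>n. real n powr (real k / (real k - 1)))
      \<and> theta_infinitely_often (\<lambda>n. real (f_plus k n)) (\<lambda>n. real n powr (real k / (real k - 1))))
     \<and>
     ((\<lambda>n. real (e_minus k n)) \<in> \<Omega>(\<lambda>n. real n powr ((real k + 1) / real k))
      \<and> (\<forall>\<^sub>F n in sequentially. e_minus k n \<le> f_minus k n)
      \<and> (\<lambda>n. real (f_minus k n)) \<in> O(\<lambda>n. real n powr ((real k + 1) / real k) * ln (real n))
      \<and> theta_infinitely_often (\<lambda>n. real (f_minus k n)) (\<lambda>n. real n powr ((real k + 1) / real k)))"
proof -
  have "(\<lambda>n. real (f_mon k n)) \<in> \<Theta>(upper_scale k)"
    using f_mon_bigo f_mon_bigomega assms by (intro bigthetaI)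
  moreover have "theta_infinitely_often (\<lambda>n. real (f_plus k n)) (upper_scale k)"
    using f_plus_bigo f_plus_bigomega assms by (intro theta_infinitely_oftenI bigthetaI)
  moreover have "(\<lambda>n. real (f_minus k n)) \<in> O(\<lambda>n. lower_scale k n * ln (real n))"
    by (rule landau_o.big_trans[OF f_minus_bigo[OF assms] lower_scale_bigo_log[OF assms]])
  moreover have "theta_infinitely_often (\<lambda>n. real (f_minus k n)) (lower_scale k)"
    using f_minus_bigo f_minus_bigomega assms by (intro theta_infinitely_oftenI bigthetaI)
  ultimately show ?thesis
    using e_plus_le_f_plus f_plus_bigo e_minus_bigomega e_minus_le_f_minus assms
    unfolding upper_scale_def[abs_def] lower_scale_def[abs_def] by blast
qed

end
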